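(* Let $\gamma>-2$, $N\in\mathbb{N}$ and $z\in\mathbb{C}$. Then $$\mathbb{E}\big(|\det(G_N-z)|^{\gamma}\big)=\frac{R_\gamma(0)}{N!(2\pi)^N}\int_{[-\pi,\pi]^N}\prod_{j=1}^N e^{-\frac{i\gamma\theta_j}{4}}|1+e^{i\theta_j}|^{\gamma/2}e^{N|z|^2e^{i\theta_j}}\prod_{1\le j<l\le N}|e^{i\theta_l}-e^{i\theta_j}|^2\,d\theta_1\cdots d\theta_N,$$ i.e. $R_\gamma(0)\int_{U(N)}\det(U)^{-\gamma/4}|\det(I+U)|^{\gamma/2}\exp(N|z|^2\mathrm{Tr}\,U)\,d\mu(U)$ with eigenangles taken in $[-\pi,\pi]$, where $$R_\gamma(0)=\mathbb{E}\big(|\det G_N|^\gamma\big)=N^{-\gamma N/2}\prod_{j=0}^{N-1}\frac{\Gamma(\frac{\gamma}{2}+j+1)}{\Gamma(j+1)}.$$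
   Context: $G_N=N^{-1/2}G$ where $G$ is an $N\times N$ matrix of i.i.d. standard complex Gaussian entries (density $\pi^{-1}e^{-|w|^2}$). $d\mu$ is the normalized Haar measure on $U(N)$. *)

theory Defs
  imports "HOL-Probability.Probability" "Jordan_Normal_Form.Determinant"
begin

definition complex_gauss :: "complex measure" where
  "complex_gauss = density lborel (\<lambda>w. ennreal (exp (- (cmod w)\<^sup>2) / pi))"

definition ginibre_entries :: "nat \<Rightarrow> (nat \<times> nat \<Rightarrow> complex) measure" where
  "ginibre_entries N = PiM ({..<N} \<times> {..<N}) (\<lambda>_. complex_gauss)"

definition ginibre_mat :: "nat \<Rightarrow> (nat \<times> nat \<Rightarrow> complex) \<Rightarrow> complex mat" where
  "ginibre_mat N G = mat N N (\<lambda>ij. G ij / complex_of_real (sqrt (real N)))"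

definition R_gamma0 :: "nat \<Rightarrow> real \<Rightarrow> real" where
  "R_gamma0 N \<gamma> = real N powr (- \<gamma> * real N / 2) *
     (\<Prod>j<N. Gamma (\<gamma> / 2 + real j + 1) / Gamma (real j + 1))"

end

theory Submission
  imports Defs "HOL-Complex_Analysis.Complex_Analysis" "HOL-Real_Asymp.Real_Asymp"
begin

text \<open>Write \<open>a = \<gamma> / 2\<close>, \<open>w = sqrt N * z\<close>, \<open>t = \<bar>w\<bar>\<^sup>2\<close>. By Heine's identity the circular integral is a multiple of the
  \<open>N \<times> N\<close> Toeplitz determinant \<open>T N\<close> whose \<open>(i, k)\<close> entry is \<open>h (k - i) t\<close>, where
  \<open>h k s = (\<Sum>j. (a gchoose j) * s ^ (j + k) / fact (j + k))\<close>. As \<open>h k\<close> has derivative \<open>h (k - 1)\<close>, this is the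
  Wronskian of \<open>h 0, ..., h (N - 1)\<close>.

  On the Gaussian side no eigenvalue density is needed. Consider more generally the shift by \<open>diag(w, ..., w, w * v)\<close>
  and let \<open>\<Phi> N v\<close> be the moment. Plane rotations, which preserve the Gaussian law, reduce the last column to a single entry
  and remove it, leaving a matrix of the same kind of size \<open>N - 1\<close>. This gives
  \<open>\<Phi> (M + 1) v = E ((p + \<beta>) powr a * \<Phi> M (sqrt (p / (p + \<beta>))))\<close> with \<open>p = \<bar>g - w * v\<bar>\<^sup>2\<close> for a standard complex Gaussian \<open>g\<close> and an
  independent \<open>\<beta>\<close> of law Gamma(\<open>M\<close>). In the variable \<open>s = t * v\<^sup>2\<close> the recursion maps functions \<open>F\<close> for which
  \<open>(t - s) ^ (M - 1) * F s\<close> is a combination of \<open>h 0, ..., h (M - 1)\<close> to functions \<open>K\<close> for which \<open>(t - s) ^ M * K s\<close> is a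
  combination of \<open>h 0, ..., h M\<close>, with an explicit coefficient of \<open>h M\<close> proportional to \<open>F t\<close>. Such a combination
  vanishes to order \<open>M\<close> at \<open>t\<close>, so Cramer's rule yields \<open>K t / F t\<close> as a multiple of \<open>T (M + 1) / T M\<close>, and the
  quotients telescope.\<close>

section \<open>Toeplitz entries\<close>

text \<open>The special last diagonal entry is forced: the row rotation that clears the last column
  multiplies the shift in one remaining diagonal entry by a cosine and leaves the others alone, so
  scalar shifts are not preserved, but this one-parameter family is. The shape of the induction
  hypothesis comes from comparing two expansions. The recursion gives \<open>exp s * K s\<close>
  with coefficients Gamma(a + 1 + M + n) / n!^2 times moments of F on [0, t]; Kummer's formula gives
  \<open>exp s * h k s\<close> with coefficients Gamma(a + 1 + n) / n!^2 times a falling factorial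
  of degree k in n. Multiplication by (t - s) / t lowers the Gamma argument by one and, by the
  three-term relation of the h k, removes the highest moment, so that M multiplications leave t^n
  times a polynomial in n. A priori its degree may reach 2 M - 1, but the moments concentrate at the
  end point t, and their rate of decay forces degree at most M and expresses the top coefficient
  through \<open>F t\<close>. Strict positivity of the moments permits division by the smaller
  determinant.\<close>

definition binom_coeff :: "real \<Rightarrow> int \<Rightarrow> real" where
  "binom_coeff a j = (if j < 0 then 0 else a gchoose nat j)"

text \<open>Fourier coefficient of (1 + 1/zeta)^a exp(s zeta) at zeta^k, for every integer k. The
  sum runs over the exponent n of s, with \<open>binom_coeff\<close> zero at negative arguments, so
  that differentiation is a plain shift of n for either sign of k.\<close>

definition toep_entry :: "real \<Rightarrow> int \<Rightarrow> real \<Rightarrow> real" where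
  "toep_entry a k s = (\<Sum>n. binom_coeff a (int n - k) / fact n * s ^ n)"

lemma Suc_mult_divide_fact: "real (Suc n) * x / fact (Suc n) = x / (fact n :: real)"
  by (simp add: fact_Suc del: of_nat_Suc)

text \<open>Both sides vanish for j \<le> 0, so the recursion can be used under sums and for Fourier
  coefficients without distinguishing the sign of the index.\<close>

lemma binom_coeff_rec: "of_int j * binom_coeff a j = (a + 1 - of_int j) * binom_coeff a (j - 1)"
proof (cases "j \<le> 0")
  case True
  then show ?thesis by (auto simp: binom_coeff_def)
next
  case False
  define n where "n = nat (j - 1)"
  have j: "j = int n + 1" using False by (simp add: n_def)
  have "real (Suc n) * (a gchoose Suc n) = (a gchoose n) * (a - n)"
    by (metis mult.commute
        add_diff_cancel_left' gbinomial_mult_1' right_diff_distrib)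
  then show ?thesis by (simp add: j binom_coeff_def nat_add_distrib algebra_simps)
qed

text \<open>The ratio (a - n) / (n + 1) of consecutive coefficients is at most |a| + 1 in modulus.
  This geometric bound is crude, but the factorial in \<open>toep_entry\<close> absorbs it.\<close>

lemma abs_binom_coeff_le:
  fixes a :: real defines "K \<equiv> \<bar>a\<bar> + 1"
  shows "\<bar>binom_coeff a j\<bar> \<le> K ^ nat j"
proof -
  have "\<bar>a gchoose n\<bar> \<le> K ^ n" for n
  proof (induction n)
    case (Suc n)
    have "real (Suc n) * (a gchoose Suc n) = (a - n) * (a gchoose n)"
      using binom_coeff_rec[of "int (Suc n)" a] by (simp add: binom_coeff_def nat_add_distrib algebra_simps)
    then have "(a gchoose Suc n) = (a - n) / real (Suc n) * (a gchoose n)"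
      by (simp add: field_simps)
    then have "\<bar>a gchoose Suc n\<bar> = \<bar>a - n\<bar> / real (Suc n) * \<bar>a gchoose n\<bar>"
      by (simp add: abs_mult)
    also have "\<dots> \<le> K * K ^ n"
    proof (rule mult_mono[OF _ Suc.IH])
      have "\<bar>a - n\<bar> \<le> K * real (Suc n)"
      proof -
        have "0 \<le> \<bar>a\<bar> * real n" by simp
        moreover have "K * real (Suc n) = \<bar>a\<bar> * real n + \<bar>a\<bar> + real n + 1" by (simp add: K_def algebra_simps)
        ultimately show ?thesis by linarith
      qed
      then show "\<bar>a - n\<bar> / real (Suc n) \<le> K" by (simp add: field_simps)
    qed (auto simp: K_def)
    finally show ?case by simp
  qed (simp add: K_def)
  then show ?thesis by (simp add: binom_coeff_def)
qed

lemma summable_toep_entry: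
  "summable (\<lambda>n. norm (binom_coeff a (int n - k) / fact n * s ^ n))"
proof (rule summable_comparison_test')
  let ?K = "\<bar>a\<bar> + 1"
  show "summable (\<lambda>n. ?K ^ nat (- k) * (inverse (fact n) * (?K * \<bar>s\<bar>) ^ n))"
    by (rule summable_mult[OF summable_exp])
  fix n :: nat
  have "\<bar>binom_coeff a (int n - k)\<bar> \<le> ?K ^ nat (int n - k)" by (rule abs_binom_coeff_le)
  also have "\<dots> \<le> ?K ^ (nat (- k) + n)" by (rule power_increasing) auto
  finally have "\<bar>binom_coeff a (int n - k)\<bar> \<le> ?K ^ nat (- k) * ?K ^ n" by (simp add: power_add)
  then have "\<bar>binom_coeff a (int n - k)\<bar> * (\<bar>s\<bar> ^ n / fact n) \<le> (?K ^ nat (- k) * ?K ^ n) * (\<bar>s\<bar> ^ n / fact n)"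
    by (rule mult_right_mono) auto
  then show "norm (norm (binom_coeff a (int n - k) / fact n * s ^ n)) \<le> ?K ^ nat (- k) * (inverse (fact n) * (?K * \<bar>s\<bar>) ^ n)"
    by (simp add: abs_mult power_abs power_mult_distrib divide_inverse mult_ac)
qed

lemma toep_entry_sums: "(\<lambda>n. binom_coeff a (int n - k) / fact n * s ^ n) sums toep_entry a k s"
  unfolding toep_entry_def by (rule summable_sums[OF summable_norm_cancel[OF summable_toep_entry]])

lemma DERIV_toep_entry [derivative_intros]:
  assumes "(f has_real_derivative D) (at x within S)"
  shows "((\<lambda>x. toep_entry a k (f x)) has_real_derivative toep_entry a (k - 1) (f x) * D) (at x within S)"
proof -
  have "DERIV (toep_entry a k) s :> toep_entry a (k - 1) s" for s
  proof -
    have "DERIV (\<lambda>x. \<Sum>n. binom_coeff a (int n - k) / fact n * x ^ n) s :>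
          (\<Sum>n. diffs (\<lambda>n. binom_coeff a (int n - k) / fact n) n * s ^ n)"
    proof (rule termdiffs_strong'[where K = "\<bar>s\<bar> + 1"])
      show "summable (\<lambda>n. binom_coeff a (int n - k) / fact n * x ^ n)" for x
        by (rule summable_norm_cancel[OF summable_toep_entry])
    qed simp
    moreover have "diffs (\<lambda>n. binom_coeff a (int n - k) / fact n) n = binom_coeff a (int n - (k - 1)) / fact n" for n
    proof -
      have "int (Suc n) - k = int n - (k - 1)" by simp
      then show ?thesis by (simp only: diffs_def times_divide_eq_right Suc_mult_divide_fact)
    qed
    ultimately show ?thesis by (simp add: toep_entry_def [abs_def])
  qed
  from DERIV_chain2[OF this assms] show ?thesis .
qed

lemma continuous_on_toep_entry [continuous_intros]:
  assumes "continuous_on S f"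
  shows "continuous_on S (\<lambda>x. toep_entry a k (f x))"
proof -
  have "continuous_on UNIV (toep_entry a k)"
    by (auto intro!: continuous_at_imp_continuous_on DERIV_isCont DERIV_toep_entry[where f = "\<lambda>x. x", simplified] DERIV_ident)
  from continuous_on_compose2[OF this assms] show ?thesis by simp
qed

lemma toep_entry_0: "toep_entry a k 0 = binom_coeff a (- k)"
  using sums_unique2[OF toep_entry_sums[of a k 0] powser_sums_zero] by simp

text \<open>The symbol f = (1 + 1/zeta)^a exp(s zeta) satisfies (1 + 1/zeta) zeta f' = (s zeta + s -
  a/zeta) f; this relation is its coefficient at zeta^k.\<close>

lemma toep_entry_rec:
  "(a + of_int k + 1) * toep_entry a (k + 1) s = (s - of_int k) * toep_entry a k s + s * toep_entry a (k - 1) s"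
proof -
  let ?b = "binom_coeff a"
  have shift: "(\<lambda>n. real n * ?b (int n - k - 1) / fact n * s ^ n) sums (s * toep_entry a k s)"
    for k
  proof (rule sums_Suc_imp)
    show "(\<lambda>n. real (Suc n) * ?b (int (Suc n) - k - 1) / fact (Suc n) * s ^ Suc n) sums (s * toep_entry a k s)"
    proof (rule sums_cong[THEN iffD1, OF _ sums_mult[OF toep_entry_sums[of a k s], of s]])
      fix n
      have "int (Suc n) - k - 1 = int n - k" by simp
      then show "s * (?b (int n - k) / fact n * s ^ n) = real (Suc n) * ?b (int (Suc n) - k - 1) / fact (Suc n) * s ^ Suc n"
        by (simp only: Suc_mult_divide_fact) simp
    qed
  qed simp
  have 1: "(\<lambda>n. (a + of_int k + 1) * (?b (int n - (k+1)) / fact n * s ^ n)) sums ((a + of_int k + 1) * toep_entry a (k + 1) s)"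
    by (intro sums_mult toep_entry_sums)
  have 2: "(\<lambda>n. real n * ?b (int n - k - 1) / fact n * s ^ n - of_int k * (?b (int n - k) / fact n * s ^ n)
        + real n * ?b (int n - (k - 1) - 1) / fact n * s ^ n) sums
     (s * toep_entry a k s - of_int k * toep_entry a k s + s * toep_entry a (k - 1) s)"
    by (intro sums_add sums_diff shift sums_mult toep_entry_sums)
  have "(a + of_int k + 1) * (?b (int n - (k+1)) / fact n * s ^ n) =
     real n * ?b (int n - k - 1) / fact n * s ^ n - of_int k * (?b (int n - k) / fact n * s ^ n)
        + real n * ?b (int n - (k - 1) - 1) / fact n * s ^ n" for n
  proof -
    have "(a + of_int k + 1) * ?b (int n - (k+1)) = real n * ?b (int n - k - 1) - of_int k * ?b (int n - k) + real n * ?b (int n - (k - 1) - 1)"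
      using binom_coeff_rec[of "int n - k" a] by (simp add: algebra_simps)
    then have "(a + of_int k + 1) * ?b (int n - (k+1)) * (s ^ n / fact n) = (real n * ?b (int n - k - 1) - of_int k * ?b (int n - k) + real n * ?b (int n - (k - 1) - 1)) * (s ^ n / fact n)"
      by simp
    then show ?thesis by (simp add: algebra_simps add_divide_distrib diff_divide_distrib)
  qed
  from sums_unique2[OF 1[unfolded this] 2] show ?thesis by (simp add: algebra_simps)
qed

lemma gchoose_add_nat:
  fixes a :: real
  assumes "a > -1" "k \<le> p"
  shows "(a + real p gchoose (p - k)) = Gamma (a + 1 + real p) / (fact (p - k) * Gamma (a + real k + 1))"
proof -
  have "(a + real p) + 1 \<notin> \<int>\<^sub>\<le>\<^sub>0" using assms by (auto elim!: nonpos_Ints_cases)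
  then have "(a + real p gchoose (p - k)) = Gamma (a + real p + 1) / (fact (p - k) * Gamma (a + real p - real (p - k) + 1))"
    by (rule gbinomial_Gamma)
  then show ?thesis using assms by (simp add: of_nat_diff algebra_simps)
qed

text \<open>Kummer's transformation of the confluent hypergeometric function.\<close>

lemma toep_entry_kummer:
  fixes a s :: real
  assumes a: "a > -1"
  shows "(\<lambda>p. Gamma (a + 1 + real p) / (fact p)\<^sup>2 * (fact k * real (p choose k)) * s ^ p) sums
           (Gamma (a + real k + 1) * exp s * toep_entry a (int k) s)"
proof -
  let ?b = "binom_coeff a"
  have "(\<lambda>p. \<Sum>i\<le>p. (inverse (fact i) * s ^ i) * (?b (int (p - i) - int k) / fact (p - i) * s ^ (p - i))) sums
     ((\<Sum>n. inverse (fact n) * s ^ n) * (\<Sum>n. ?b (int n - int k) / fact n * s ^ n))"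
  proof (rule Cauchy_product_sums[OF _ summable_toep_entry])
    show "summable (\<lambda>n. norm (inverse (fact n) * s ^ n))"
      using summable_norm_exp[of s] by simp
  qed
  moreover have "(\<Sum>n. inverse (fact n) * s ^ n) = exp s" by (simp add: exp_def scaleR_conv_of_real)
  moreover have "(\<Sum>i\<le>p. (inverse (fact i) * s ^ i) * (?b (int (p - i) - int k) / fact (p - i) * s ^ (p - i)))
      = Gamma (a + 1 + real p) / (fact p)\<^sup>2 * (fact k * real (p choose k)) / Gamma (a + real k + 1) * s ^ p" for p
  proof -
    have "(\<Sum>i\<le>p. (inverse (fact i) * s ^ i) * (?b (int (p - i) - int k) / fact (p - i) * s ^ (p - i)))
       = (\<Sum>i\<le>p. real (p choose i) * ?b (int (p - i) - int k)) / fact p * s ^ p"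
      unfolding sum_divide_distrib sum_distrib_right
    proof (rule sum.cong[OF refl])
      fix i assume "i \<in> {..p}"
      then have "i \<le> p" by simp
      have "s ^ i * s ^ (p - i) = s ^ p" using \<open>i \<le> p\<close> by (simp flip: power_add)
      moreover have "inverse (fact i) / fact (p - i) = real (p choose i) / fact p"
        using binomial_fact[OF \<open>i \<le> p\<close>, where 'a = real] by (simp add: field_simps)
      moreover have "(inverse (fact i) * s ^ i) * (?b (int (p - i) - int k) / fact (p - i) * s ^ (p - i))
        = inverse (fact i) / fact (p - i) * ?b (int (p - i) - int k) * (s ^ i * s ^ (p - i))" by simp
      ultimately show "(inverse (fact i) * s ^ i) * (?b (int (p - i) - int k) / fact (p - i) * s ^ (p - i))
        = real (p choose i) * ?b (int (p - i) - int k) / fact p * s ^ p"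
        by (simp only:) simp
    qed
    \<comment> \<open>Terms with i > p - k vanish; what remains is Vandermonde's convolution for p
      and a.\<close>
    also have "(\<Sum>i\<le>p. real (p choose i) * ?b (int (p - i) - int k)) =
        (if k \<le> p then (a + real p gchoose (p - k)) else 0)"
    proof (cases "k \<le> p")
      case True
      have "(\<Sum>i\<le>p. real (p choose i) * ?b (int (p - i) - int k)) = (\<Sum>i\<in>{0..p-k}. real (p choose i) * ?b (int (p - i) - int k))"
        by (rule sum.mono_neutral_right) (auto simp: binom_coeff_def)
      also have "\<dots> = (\<Sum>i=0..p-k. (real p gchoose i) * (a gchoose (p - k - i)))"
      proof (rule sum.cong[OF refl])
        fix i assume "i \<in> {0..p-k}"
        then have "int (p - i) - int k = int (p - k - i)" using True by auto
        then show "real (p choose i) * ?b (int (p - i) - int k) = (real p gchoose i) * (a gchoose (p - k - i))"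
          by (simp add: binom_coeff_def binomial_gbinomial)
      qed
      also have "\<dots> = (real p + a gchoose (p - k))" by (rule gbinomial_Vandermonde)
      finally show ?thesis using True by (simp add: add.commute)
    next
      case False
      then show ?thesis by (auto simp: binom_coeff_def intro!: sum.neutral)
    qed
    also have "(if k \<le> p then (a + real p gchoose (p - k)) else 0) / fact p * s ^ p
      = Gamma (a + 1 + real p) / (fact p)\<^sup>2 * (fact k * real (p choose k)) / Gamma (a + real k + 1) * s ^ p"
    proof (cases "k \<le> p")
      case True
      have "fact k * real (p choose k) = fact p / fact (p - k)"
        using binomial_fact[OF True, where 'a = real] by (simp add: field_simps)
      then have "Gamma (a + 1 + real p) / (fact p)\<^sup>2 * (fact k * real (p choose k)) / Gamma (a + real k + 1) * s ^ p
         = Gamma (a + 1 + real p) / (fact p)\<^sup>2 * (fact p / fact (p - k)) / Gamma (a + real k + 1) * s ^ p"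
        by (simp only:)
      then show ?thesis using True a by (simp add: gchoose_add_nat power2_eq_square mult_ac)
    qed (simp add: binomial_eq_0)
    finally show ?thesis .
  qed
  ultimately have "(\<lambda>p. Gamma (a + 1 + real p) / (fact p)\<^sup>2 * (fact k * real (p choose k)) / Gamma (a + real k + 1) * s ^ p)
     sums (exp s * toep_entry a (int k) s)"
    by (simp add: toep_entry_def)
  from sums_mult[OF this, of "Gamma (a + real k + 1)"]
  have "(\<lambda>p. Gamma (a + real k + 1) * (Gamma (a + 1 + real p) / (fact p)\<^sup>2 * (fact k * real (p choose k)) / Gamma (a + real k + 1) * s ^ p))
     sums (Gamma (a + real k + 1) * exp s * toep_entry a (int k) s)" by (simp add: mult.assoc)
  moreover have "Gamma (a + real k + 1) \<noteq> 0"
    using a Gamma_real_pos[of "a + real k + 1"] by linarith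
  ultimately show ?thesis by simp
qed

section \<open>The recursion on combinations of Toeplitz entries\<close>

text \<open>The effect on v of multiplying the series in s/t with coefficients Gamma(b + 1 + n) /
  n!^2 * v n by 1 - s/t, when the product is written with Gamma(b + n) instead. The truncated
  \<open>n - 1\<close> at n = 0 is harmless because of the factor n^2.\<close>

definition zstep :: "real \<Rightarrow> (nat \<Rightarrow> real) \<Rightarrow> nat \<Rightarrow> real" where
  "zstep b v n = (b + real n) * v n - (real n)\<^sup>2 * v (n - 1)"

text \<open>The parameter of \<open>zstep\<close> runs from a + M down to a + 1, so that the weight
  Gamma(a + 1 + M + n) becomes Gamma(a + 1 + n), the one in Kummer's series.\<close>

fun zsteps :: "real \<Rightarrow> nat \<Rightarrow> (nat \<Rightarrow> real) \<Rightarrow> nat \<Rightarrow> real" where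
  "zsteps a 0 v = v"
| "zsteps a (Suc M) v = zsteps a M (zstep (a + 1 + real M) v)"

lemma Gamma_plus1_pos: "x > 0 \<Longrightarrow> Gamma (x + 1) = x * Gamma (x :: real)"
  by (rule Gamma_plus1) (auto elim!: nonpos_Ints_cases)

lemma zstep_series:
  fixes b s t G :: real
  assumes b: "b > 0" and t: "t > 0"
  assumes G: "(\<lambda>n. (s / t) ^ n * (Gamma (b + 1 + real n) / (fact n)\<^sup>2) * v n) sums G"
  shows "(\<lambda>n. (s / t) ^ n * (Gamma (b + real n) / (fact n)\<^sup>2) * zstep b v n) sums ((t - s) / t * G)"
proof -
  let ?f = "\<lambda>n. (s / t) ^ n * (Gamma (b + 1 + real n) / (fact n)\<^sup>2) * v n"
  let ?g = "\<lambda>n. if n = 0 then 0 else (s / t) * ?f (n - 1)"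
  have "?g sums ((s / t) * G)"
    by (rule sums_Suc_imp) (use sums_mult[OF G, of "s / t"] in auto)
  from sums_diff[OF G this]
  have *: "(\<lambda>n. ?f n - ?g n) sums ((t - s) / t * G)" using t by (simp add: field_simps)
  have "?f n - ?g n = (s / t) ^ n * (Gamma (b + real n) / (fact n)\<^sup>2) * zstep b v n" for n
  proof (cases n)
    case 0
    have "Gamma (b + 1) = b * Gamma b" using b by (rule Gamma_plus1_pos)
    then show ?thesis using 0 by (simp add: zstep_def)
  next
    case (Suc m)
    have "Gamma (b + 1 + real n) = (b + real n) * Gamma (b + real n)"
      using Gamma_plus1_pos[of "b + real n"] b by (simp add: algebra_simps)
    moreover have "Gamma (b + 1 + real m) = Gamma (b + real n)" using Suc by (simp add: algebra_simps)
    moreover have "(real n)\<^sup>2 / (fact n)\<^sup>2 = 1 / (fact m :: real)\<^sup>2"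
      using Suc by (simp add: power_mult_distrib del: of_nat_Suc)
    moreover have "W * (g / F) * ((b + N) * x - N2 * y) = W * (((b + N) * g) / F) * x - W * (g * (N2 / F)) * y"
      for W g F N N2 x y :: real by (simp add: algebra_simps diff_divide_distrib add_divide_distrib)
    ultimately have "(s / t) ^ n * (Gamma (b + real n) / (fact n)\<^sup>2) * zstep b v n =
       ?f n - (s / t) ^ n * (Gamma (b + 1 + real m) * (1 / (fact m)\<^sup>2)) * v (n - 1)"
      by (simp only: zstep_def)
    then show ?thesis using Suc by simp
  qed
  with * show ?thesis by simp
qed

lemma zsteps_series:
  fixes a s t G :: real
  assumes a: "a > -1" and t: "t > 0"
  assumes G: "(\<lambda>n. (s / t) ^ n * (Gamma (a + 1 + real M + real n) / (fact n)\<^sup>2) * v n) sums G"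
  shows "(\<lambda>n. (s / t) ^ n * (Gamma (a + 1 + real n) / (fact n)\<^sup>2) * zsteps a M v n) sums (((t - s) / t) ^ M * G)"
  using G
proof (induction M arbitrary: v G)
  case (Suc M)
  have "(\<lambda>n. (s / t) ^ n * (Gamma (a + 1 + real M + real n) / (fact n)\<^sup>2) * zstep (a + 1 + real M) v n)
     sums ((t - s) / t * G)"
    using Suc.prems a t by (intro zstep_series) (auto simp: algebra_simps)
  from Suc.IH[OF this] show ?case by (simp add: mult_ac)
qed simp

definition toep_moment :: "real \<Rightarrow> real \<Rightarrow> int \<Rightarrow> nat \<Rightarrow> real" where
  "toep_moment a t k n = integral {0..t} (\<lambda>x. x ^ n * toep_entry a k x)"

text \<open>Integration by parts on [0, t], with an antiderivative \<open>P\<close> found from the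
  derivative rule and \<open>toep_entry_rec\<close>. The parameter is matched to k, so that no
  moment of index k survives.\<close>

lemma zstep_toep_moment:
  fixes a t :: real
  assumes t: "t > 0"
  shows "zstep (a + 1 + real k) (toep_moment a t (int k)) n =
     t ^ n * ((a + 1 + real k) * toep_entry a (int k + 1) t + (real k - real n) * toep_entry a (int k) t)
     - real k * toep_moment a t (int k - 1) n"
proof -
  let ?h = "\<lambda>k. toep_entry a k"
  define P where "P x = x ^ n * ((a + 1 + real k) * ?h (int k + 1) x + (real k - real n) * ?h (int k) x)" for x
  define p where "p x = (a + 1 + real k + real n) * (x ^ n * ?h (int k) x)
     - (real n)\<^sup>2 * (x ^ (n - 1) * ?h (int k) x) + real k * (x ^ n * ?h (int k - 1) x)" for x
  have "(P has_real_derivative p x) (at x within {0..t})" for x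
  proof -
    have rec: "(a + 1 + real k) * ?h (int k + 1) x = (x - real k) * ?h (int k) x + x * ?h (int k - 1) x"
      using toep_entry_rec[of a "int k" x] by (simp add: algebra_simps)
    have "(P has_real_derivative (real n * x ^ (n - 1)) * ((a + 1 + real k) * ?h (int k + 1) x + (real k - real n) * ?h (int k) x)
       + x ^ n * ((a + 1 + real k) * ?h (int k) x + (real k - real n) * ?h (int k - 1) x)) (at x within {0..t})"
      unfolding P_def by (auto intro!: derivative_eq_intros)
    also have "(real n * x ^ (n - 1)) * ((a + 1 + real k) * ?h (int k + 1) x + (real k - real n) * ?h (int k) x)
       + x ^ n * ((a + 1 + real k) * ?h (int k) x + (real k - real n) * ?h (int k - 1) x) = p x"
      unfolding rec p_def by (cases n) (simp_all add: algebra_simps power2_eq_square)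
    finally show ?thesis .
  qed
  then have "(p has_integral (P t - P 0)) {0..t}"
    using t by (intro fundamental_theorem_of_calculus) (auto simp: has_real_derivative_iff_has_vector_derivative)
  \<comment> \<open>For n > 0 the power vanishes. For n = 0 the entry of index k + 1 vanishes at 0,
    and so does the other term: by its entry if k > 0, by its factor k if k = 0.\<close>
  moreover have "P 0 = 0" by (cases "n = 0") (simp_all add: P_def toep_entry_0 binom_coeff_def)
  ultimately have "integral {0..t} p = P t" by (simp add: integral_unique)
  moreover have "integral {0..t} p = (a + 1 + real k + real n) * toep_moment a t (int k) n
     - (real n)\<^sup>2 * toep_moment a t (int k) (n - 1) + real k * toep_moment a t (int k - 1) n"
    unfolding p_def toep_moment_def
    by (subst integral_add integral_diff; (intro integrable_continuous_interval continuous_intros)?)+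
       (simp add: integral_mult_right)
  ultimately show ?thesis by (simp add: zstep_def P_def algebra_simps)
qed

text \<open>With parameter a + 1 + M, the moment of index k is reproduced with factor M - k, apart
  from a moment of index k - 1 and a boundary term, t^n times a linear polynomial. Thus index M
  drops out, and each step shortens the combination by one.\<close>

lemma zsteps_toep_moment_poly:
  fixes a t :: real
  assumes t: "t > 0"
  assumes "\<And>n. v n = (\<Sum>k<M. d k * toep_moment a t (int k) n) + t ^ n * poly P (real n)"
  shows "\<exists>Q. \<forall>n. zsteps a M v n = t ^ n * poly Q (real n)"
  using assms(2)
proof (induction M arbitrary: v d P)
  case (Suc M)
  let ?u = "\<lambda>k. toep_moment a t (int k)"
  let ?h = "\<lambda>k. toep_entry a k t"
  let ?b = "a + 1 + real M"
  have zu: "zstep ?b (?u k) n = (real M - real k) * ?u k n - real k * toep_moment a t (int k - 1) n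
      + t ^ n * poly [: (a + 1 + real k) * ?h (int k + 1) + real k * ?h (int k), - ?h (int k) :] (real n)" for k n
    using zstep_toep_moment[OF t, of a k n] by (simp add: zstep_def algebra_simps)
  \<comment> \<open>Action of \<open>zstep\<close> on t^n P(n): passing to n - 1 costs a factor 1/t
    and replaces P by its composition with X - 1.\<close>
  define R where "R = [: ?b, 1 :] * P - Polynomial.smult (1 / t) ([: 0, 0, 1 :] * (P \<circ>\<^sub>p [: -1, 1 :]))"
  have zp: "zstep ?b (\<lambda>n. t ^ n * poly P (real n)) n = t ^ n * poly R (real n)" for n
    using t by (cases n) (simp_all add: zstep_def R_def poly_pcompose field_simps power2_eq_square)
  have "zstep ?b v n = (\<Sum>k<M. ((real M - real k) * d k - real (Suc k) * d (Suc k)) * ?u k n)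
     + t ^ n * poly ((\<Sum>k<Suc M. Polynomial.smult (d k) [: (a + 1 + real k) * ?h (int k + 1) + real k * ?h (int k), - ?h (int k) :]) + R) (real n)" for n
  proof -
    have "zstep ?b v n = (\<Sum>k<Suc M. d k * zstep ?b (?u k) n) + zstep ?b (\<lambda>n. t ^ n * poly P (real n)) n"
      by (simp only: zstep_def Suc.prems) (simp only: sum_distrib_left distrib_left right_diff_distrib sum_subtractf mult_ac sum.distrib; simp add: algebra_simps)
    moreover have "(\<Sum>k<Suc M. d k * zstep ?b (?u k) n) =
       (\<Sum>k<Suc M. d k * (real M - real k) * ?u k n) - (\<Sum>k<Suc M. d k * real k * toep_moment a t (int k - 1) n)
        + t ^ n * poly (\<Sum>k<Suc M. Polynomial.smult (d k) [: (a + 1 + real k) * ?h (int k + 1) + real k * ?h (int k), - ?h (int k) :]) (real n)"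
      unfolding zu poly_sum poly_smult sum_distrib_left sum_subtractf[symmetric] sum.distrib[symmetric]
      by (rule sum.cong[OF refl]) (simp add: algebra_simps del: poly_pCons)
    moreover have "(\<Sum>k<Suc M. d k * (real M - real k) * ?u k n) = (\<Sum>k<M. d k * (real M - real k) * ?u k n)" by simp
    moreover have "(\<Sum>k<Suc M. d k * real k * toep_moment a t (int k - 1) n) = (\<Sum>k<M. d (Suc k) * real (Suc k) * ?u k n)"
      by (subst sum.lessThan_Suc_shift) simp
    moreover have "(\<Sum>k<M. ((real M - real k) * d k - real (Suc k) * d (Suc k)) * ?u k n) =
      (\<Sum>k<M. d k * (real M - real k) * ?u k n) - (\<Sum>k<M. d (Suc k) * real (Suc k) * ?u k n)"
      by (subst sum_subtractf[symmetric]) (simp add: algebra_simps)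
    ultimately show ?thesis using zp[of n] by (simp add: distrib_left)
  qed
  from Suc.IH[of "zstep ?b v", OF this] show ?case by simp
qed auto

section \<open>Growth of the iterates and the degree of the polynomial\<close>

text \<open>The term n^2 v(n - 1) dominates: it gains two powers of n and, from the shift of index,
  the factor -1/t, while (b + n) v(n) gains only one power.\<close>

lemma zstep_growth:
  fixes t b e L :: real
  assumes t: "t > 0" and L: "(\<lambda>n. v n / t ^ n / real n powr e) \<longlonglongrightarrow> L"
  shows "(\<lambda>n. zstep b v n / t ^ n / real n powr (e + 2)) \<longlonglongrightarrow> - L / t"
proof -
  let ?r = "\<lambda>n. v n / t ^ n / real n powr e"
  have "(\<lambda>n. ?r n * ((b + real n) / (real n)\<^sup>2) - ?r (n - 1) * ((real (n - 1) / real n) powr e) / t)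
     \<longlonglongrightarrow> L * 0 - L * 1 / t"
  proof (intro tendsto_intros L)
    show "(\<lambda>n. (b + real n) / (real n)\<^sup>2) \<longlonglongrightarrow> 0" by real_asymp
    have "(\<lambda>n. ?r (Suc n - 1)) \<longlonglongrightarrow> L" using L by simp
    then show "(\<lambda>n. ?r (n - 1)) \<longlonglongrightarrow> L" by (rule LIMSEQ_imp_Suc)
    have "(\<lambda>n. (real n / (real n + 1)) powr e) \<longlonglongrightarrow> 1 powr e"
      by (intro tendsto_powr tendsto_const) (real_asymp, simp)
    then have "(\<lambda>n. (real (Suc n - 1) / real (Suc n)) powr e) \<longlonglongrightarrow> 1" by (simp add: add.commute)
    then show "(\<lambda>n. (real (n - 1) / real n) powr e) \<longlonglongrightarrow> 1" by (rule LIMSEQ_imp_Suc)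
  qed (use t in auto)
  moreover have "\<forall>\<^sub>F n in sequentially. ?r n * ((b + real n) / (real n)\<^sup>2) - ?r (n - 1) * ((real (n - 1) / real n) powr e) / t
      = zstep b v n / t ^ n / real n powr (e + 2)"
    using eventually_ge_at_top[of 2]
  proof eventually_elim
    case (elim n)
    then obtain m where m: "n = Suc m" "m > 0" by (cases n) auto
    have "real n powr (e + 2) = real n powr e * (real n)\<^sup>2" using m by (simp add: powr_add powr_numeral)
    moreover have "(real m / real n) powr e = real m powr e / real n powr e" by (simp add: powr_divide)
    ultimately show ?case using m t
      by (simp add: zstep_def diff_divide_distrib power2_eq_square del: of_nat_Suc) (simp add: field_simps del: of_nat_Suc)
  qed
  ultimately show ?thesis by (simp add: tendsto_cong)
qed

lemma zsteps_growth:
  fixes t a e L :: real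
  assumes t: "t > 0" and L: "(\<lambda>n. v n / t ^ n / real n powr e) \<longlonglongrightarrow> L"
  shows "(\<lambda>n. zsteps a M v n / t ^ n / real n powr (e + 2 * real M)) \<longlonglongrightarrow> (- 1 / t) ^ M * L"
  using L
proof (induction M arbitrary: v e L)
  case (Suc M)
  from Suc.IH[OF zstep_growth[OF t Suc.prems, of "a + 1 + real M"]]
  show ?case by (simp add: algebra_simps)
qed simp

text \<open>Along the integers a polynomial is asymptotic to its leading term, so a degree above M
  would make the leading coefficient a limit of a null sequence.\<close>

lemma poly_growth_coeff:
  fixes Q :: "real poly"
  assumes L: "(\<lambda>n. poly Q (real n) / real n ^ M) \<longlonglongrightarrow> L"
  shows "Polynomial.degree Q \<le> M" "Polynomial.coeff Q M = L"
proof -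
  let ?d = "Polynomial.degree Q"
  have at_inf: "filterlim real at_infinity sequentially"
    by (rule filterlim_at_top_imp_at_infinity[OF filterlim_real_sequentially])
  have lead: "(\<lambda>n. poly Q (real n) / real n ^ ?d) \<longlonglongrightarrow> lead_coeff Q"
    using filterlim_compose[OF poly_divide_tendsto_aux at_inf] .
  show deg: "?d \<le> M"
  proof (rule ccontr)
    assume "\<not> ?d \<le> M"
    then have dM: "M < ?d" by simp
    have "(\<lambda>n. poly Q (real n) / real n ^ M * (1 / real n ^ (?d - M))) \<longlonglongrightarrow> L * 0"
      using dM by (intro tendsto_mult L tendsto_divide_0[OF tendsto_const] filterlim_at_top_imp_at_infinity
          filterlim_pow_at_top filterlim_real_sequentially) auto
    moreover have "poly Q (real n) / real n ^ M * (1 / real n ^ (?d - M)) = poly Q (real n) / real n ^ ?d" for n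
      using dM by (simp flip: power_add)
    ultimately have "(\<lambda>n. poly Q (real n) / real n ^ ?d) \<longlonglongrightarrow> L * 0" by (simp only:)
    from LIMSEQ_unique[OF lead this] have "lead_coeff Q = 0" by simp
    then show False using dM by auto
  qed
  have "(\<lambda>n. poly Q (real n) / real n ^ M) \<longlonglongrightarrow> Polynomial.coeff Q M"
  proof (cases "?d = M")
    case False
    then have dM: "?d < M" using deg by simp
    have "(\<lambda>n. poly Q (real n) / real n ^ ?d * (1 / real n ^ (M - ?d))) \<longlonglongrightarrow> lead_coeff Q * 0"
      using dM by (intro tendsto_mult lead tendsto_divide_0[OF tendsto_const] filterlim_at_top_imp_at_infinity
          filterlim_pow_at_top filterlim_real_sequentially) auto
    moreover have "poly Q (real n) / real n ^ ?d * (1 / real n ^ (M - ?d)) = poly Q (real n) / real n ^ M" for n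
      using dM by (simp flip: power_add)
    ultimately have "(\<lambda>n. poly Q (real n) / real n ^ M) \<longlonglongrightarrow> lead_coeff Q * 0" by (simp only:)
    then show ?thesis using dM by (simp add: coeff_eq_0)
  qed (use lead in auto)
  then show "Polynomial.coeff Q M = L" using L LIMSEQ_unique by blast
qed

text \<open>Newton's basis: k! (p choose k) is monic of degree k in p, so the top coefficient
  carries over unchanged and subtracting its term lowers the degree.\<close>

lemma poly_binomial_basis:
  fixes Q :: "real poly"
  assumes "Polynomial.degree Q \<le> M"
  shows "\<exists>e. e M = Polynomial.coeff Q M \<and> (\<forall>p. poly Q (real p) = (\<Sum>k\<le>M. e k * (fact k * real (p choose k))))"
  using assms
proof (induction M arbitrary: Q)
  case 0
  then obtain c where "Q = [:c:]" by (auto elim: degree_eq_zeroE)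
  then show ?case by (intro exI[of _ "\<lambda>_. c"]) auto
next
  case (Suc M)
  define B where "B = (\<Prod>i\<le>M. [: - real i, 1 :])"
  have poly_B: "poly B (real p) = fact (Suc M) * real (p choose Suc M)" for p
  proof -
    have "poly B (real p) = (\<Prod>i\<le>M. real p - real i)" by (simp add: B_def poly_prod)
    also have "\<dots> = fact (Suc M) * (real p gchoose Suc M)"
      by (simp add: gbinomial_prod_rev lessThan_Suc_atMost atLeast0LessThan del: fact_Suc)
    finally show ?thesis by (simp add: binomial_gbinomial)
  qed
  have degB: "Polynomial.degree B = Suc M"
    unfolding B_def by (subst degree_prod_eq_sum_degree) auto
  have "lead_coeff B = 1" unfolding B_def by (simp add: lead_coeff_prod)
  then have cB: "Polynomial.coeff B (Suc M) = 1" using degB by simp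
  define c where "c = Polynomial.coeff Q (Suc M)"
  define R where "R = Q - Polynomial.smult c B"
  have "Polynomial.degree R \<le> Suc M" using Suc.prems degB unfolding R_def
    by (intro degree_diff_le) (auto intro: order.trans[OF degree_smult_le])
  moreover have "Polynomial.coeff R (Suc M) = 0" by (simp add: R_def c_def cB)
  ultimately have "Polynomial.degree R \<le> M"
    by (metis le_Suc_eq leading_coeff_0_iff degree_0 le0)
  then obtain e where e: "\<And>p. poly R (real p) = (\<Sum>k\<le>M. e k * (fact k * real (p choose k)))"
    using Suc.IH by blast
  have "poly Q (real p) = (\<Sum>k\<le>M. e k * (fact k * real (p choose k))) + c * (fact (Suc M) * real (p choose Suc M))" for p
    using e[of p] poly_B[of p] by (simp add: R_def algebra_simps)
  then show ?case
    by (intro exI[of _ "e(Suc M := c)"]) (auto simp: c_def simp del: fact_Suc intro!: sum.cong)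
qed

text \<open>Euler's beta integral by induction on m; the boundary term x^(n+1) (t - x)^(m+1) of the
  integration by parts vanishes at both ends.\<close>

lemma integral_power_mult_diff_power:
  fixes t :: real
  assumes t: "t \<ge> 0"
  shows "integral {0..t} (\<lambda>x. x ^ n * (t - x) ^ m) = fact n * fact m / fact (n + m + 1) * t ^ (n + m + 1)"
proof (induction m arbitrary: n)
  case 0
  have "((\<lambda>x. x ^ n) has_integral (t ^ Suc n / real (Suc n) - 0 ^ Suc n / real (Suc n))) {0..t}"
    using t by (intro fundamental_theorem_of_calculus)
       (auto intro!: derivative_eq_intros simp flip: has_real_derivative_iff_has_vector_derivative simp del: of_nat_Suc power_Suc)
  then have "integral {0..t} (\<lambda>x. x ^ n * (t - x) ^ 0) = t ^ Suc n / real (Suc n)"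
    by (simp add: integral_unique del: of_nat_Suc power_Suc)
  then show ?case by (simp add: fact_Suc del: of_nat_Suc power_Suc)
next
  case (Suc m)
  have "((\<lambda>x. real (Suc n) * (x ^ n * (t - x) ^ Suc m) - real (Suc m) * (x ^ Suc n * (t - x) ^ m)) has_integral
      (t ^ Suc n * (t - t) ^ Suc m - 0 ^ Suc n * (t - 0) ^ Suc m)) {0..t}"
    using t by (intro fundamental_theorem_of_calculus)
       (auto intro!: derivative_eq_intros simp flip: has_real_derivative_iff_has_vector_derivative
             simp del: of_nat_Suc power_Suc)
  then have "integral {0..t} (\<lambda>x. real (Suc n) * (x ^ n * (t - x) ^ Suc m) - real (Suc m) * (x ^ Suc n * (t - x) ^ m)) = 0"
    by (simp add: integral_unique)
  moreover have "integral {0..t} (\<lambda>x. real (Suc n) * (x ^ n * (t - x) ^ Suc m) - real (Suc m) * (x ^ Suc n * (t - x) ^ m))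
     = real (Suc n) * integral {0..t} (\<lambda>x. x ^ n * (t - x) ^ Suc m) - real (Suc m) * integral {0..t} (\<lambda>x. x ^ Suc n * (t - x) ^ m)"
    by (subst integral_diff; (intro integrable_continuous_interval continuous_intros)?) (simp del: of_nat_Suc power_Suc)
  ultimately have "real (Suc n) * integral {0..t} (\<lambda>x. x ^ n * (t - x) ^ Suc m) = real (Suc m) * integral {0..t} (\<lambda>x. x ^ Suc n * (t - x) ^ m)"
    by simp
  also have "\<dots> = real (Suc m) * (fact (Suc n) * fact m / fact (Suc n + m + 1) * t ^ (Suc n + m + 1))"
    by (simp only: Suc.IH)
  also have "\<dots> = real (Suc n) * (fact n * fact (Suc m) / fact (n + Suc m + 1) * t ^ (n + Suc m + 1))"
    by simp
  finally show ?case by (simp only: mult_cancel_left of_nat_eq_0_iff nat.distinct simp_thms)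
qed

text \<open>The normalised weights \<open>x ^ n * (t - x) ^ m\<close> concentrate at \<open>x = t\<close> as \<open>n\<close> grows.\<close>

lemma endpoint_moment_asymptotics:
  fixes F :: "real \<Rightarrow> real" and t C :: real
  assumes t: "t > 0" and cont: "continuous_on {0..t} F"
    and lip: "\<And>x. x \<in> {0..t} \<Longrightarrow> \<bar>F x - F t\<bar> \<le> C * (t - x)"
  shows "(\<lambda>n. integral {0..t} (\<lambda>x. x ^ n * (t - x) ^ m * F x) / t ^ n / real n powr (- real (Suc m)))
      \<longlonglongrightarrow> fact m * t ^ Suc m * F t"
proof -
  define J where "J n m = fact n * fact m / fact (n + m + 1) * t ^ (n + m + 1)" for n m :: nat
  have J: "integral {0..t} (\<lambda>x. x ^ n * (t - x) ^ m) = J n m" for n m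
    using t by (simp add: J_def integral_power_mult_diff_power)
  have Jpos: "J n m \<ge> 0" for n m using t by (simp add: J_def)
  have ratio: "(\<lambda>n. fact n * real n ^ Suc m / fact (n + m + 1)) \<longlonglongrightarrow> 1" for m
  proof (induction m)
    case 0
    have "(\<lambda>n. real n / real (Suc n)) \<longlonglongrightarrow> 1" by real_asymp
    moreover have "fact n * real n ^ Suc 0 / fact (n + 0 + 1) = real n / real (Suc n)" for n
      by (simp add: fact_Suc del: of_nat_Suc)
    ultimately show ?case by (simp only:)
  next
    case (Suc m)
    have "(\<lambda>n. real n / real (n + m + 2)) \<longlonglongrightarrow> 1" by real_asymp
    from tendsto_mult[OF Suc.IH this]
    have "(\<lambda>n. fact n * real n ^ Suc m / fact (n + m + 1) * (real n / real (n + m + 2))) \<longlonglongrightarrow> 1" by simp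
    moreover have "fact (n + Suc m + 1) = real (n + m + 2) * fact (n + m + 1)" for n
    proof -
      have "n + Suc m + 1 = Suc (n + m + 1)" by simp
      then show ?thesis by (simp only: fact_Suc) simp
    qed
    then have "fact n * real n ^ Suc m / fact (n + m + 1) * (real n / real (n + m + 2)) = fact n * real n ^ Suc (Suc m) / fact (n + Suc m + 1)" for n
      by (simp only: power_Suc times_divide_times_eq) (simp add: mult_ac)
    ultimately show ?case by (simp only:)
  qed
  have Jlim: "(\<lambda>n. J n m / t ^ n * real n ^ Suc m) \<longlonglongrightarrow> fact m * t ^ Suc m" for m
  proof -
    have "J n m / t ^ n * real n ^ Suc m = fact n * real n ^ Suc m / fact (n + m + 1) * (fact m * t ^ Suc m)" for n
      using t by (simp add: J_def power_add)
    then show ?thesis using tendsto_mult[OF ratio[of m] tendsto_const[of "fact m * t ^ Suc m"]] by simp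
  qed
  define I where "I n = integral {0..t} (\<lambda>x. x ^ n * (t - x) ^ m * F x)" for n
  \<comment> \<open>The Lipschitz bound trades the deviation of F from \<open>F t\<close> for one
    more factor t - x, which is worth one more factor 1/n.\<close>
  have bound: "\<bar>I n - J n m * F t\<bar> \<le> C * J n (Suc m)" for n
  proof -
    have i1: "(\<lambda>x. x ^ n * (t - x) ^ m * F x) integrable_on {0..t}"
      by (intro integrable_continuous_interval continuous_intros cont)
    have i2: "(\<lambda>x. x ^ n * (t - x) ^ m * F t) integrable_on {0..t}"
      by (intro integrable_continuous_interval continuous_intros)
    have "I n - J n m * F t = integral {0..t} (\<lambda>x. x ^ n * (t - x) ^ m * F x - x ^ n * (t - x) ^ m * F t)"
      unfolding integral_diff[OF i1 i2] I_def by (simp add: J)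
    also have "norm \<dots> \<le> integral {0..t} (\<lambda>x. C * (x ^ n * (t - x) ^ Suc m))"
    proof (rule integral_norm_bound_integral)
      show "(\<lambda>x. C * (x ^ n * (t - x) ^ Suc m)) integrable_on {0..t}"
        by (intro integrable_continuous_interval continuous_intros)
      fix x assume x: "x \<in> {0..t}"
      have "\<bar>x ^ n * (t - x) ^ m * F x - x ^ n * (t - x) ^ m * F t\<bar> = x ^ n * (t - x) ^ m * \<bar>F x - F t\<bar>"
        using x by (simp add: abs_mult flip: right_diff_distrib)
      also have "\<dots> \<le> x ^ n * (t - x) ^ m * (C * (t - x))"
        using x lip by (intro mult_left_mono) auto
      finally show "norm (x ^ n * (t - x) ^ m * F x - x ^ n * (t - x) ^ m * F t) \<le> C * (x ^ n * (t - x) ^ Suc m)"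
        by (simp add: mult_ac)
    qed (intro integrable_diff i1 i2)
    finally show ?thesis by (simp add: J del: power_Suc)
  qed
  have lim0: "(\<lambda>n. C * (J n (Suc m) / t ^ n * real n ^ Suc (Suc m)) * (1 / real n)) \<longlonglongrightarrow> C * (fact (Suc m) * t ^ Suc (Suc m)) * 0"
    by (intro tendsto_mult[OF tendsto_mult[OF tendsto_const Jlim]]) real_asymp
  have "(\<lambda>n. (I n - J n m * F t) / t ^ n * real n ^ Suc m) \<longlonglongrightarrow> 0"
  proof (rule Lim_null_comparison[OF _ lim0[unfolded mult_zero_right]])
    show "\<forall>\<^sub>F n in sequentially. norm ((I n - J n m * F t) / t ^ n * real n ^ Suc m)
       \<le> C * (J n (Suc m) / t ^ n * real n ^ Suc (Suc m)) * (1 / real n)"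
      using eventually_gt_at_top[of 0]
    proof eventually_elim
      case (elim n)
      have "norm ((I n - J n m * F t) / t ^ n * real n ^ Suc m) = \<bar>I n - J n m * F t\<bar> * (real n ^ Suc m / t ^ n)"
        using t by (simp add: abs_mult)
      also have "\<dots> \<le> (C * J n (Suc m)) * (real n ^ Suc m / t ^ n)"
        using bound t by (intro mult_right_mono) auto
      finally show ?case using elim by simp
    qed
  qed
  from tendsto_add[OF this tendsto_mult[OF Jlim[of m] tendsto_const[of "F t"]]]
  have "(\<lambda>n. I n / t ^ n * real n ^ Suc m) \<longlonglongrightarrow> fact m * t ^ Suc m * F t"
    by (simp add: diff_divide_distrib algebra_simps del: power_Suc)
  moreover have "\<forall>\<^sub>F n in sequentially. I n / t ^ n * real n ^ Suc m = I n / t ^ n / real n powr (- real (Suc m))"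
    using eventually_gt_at_top[of 0]
    by eventually_elim (simp add: powr_minus powr_realpow divide_inverse del: of_nat_Suc power_Suc)
  ultimately show ?thesis unfolding I_def by (rule Lim_transform_eventually)
qed

text \<open>Assumption \<open>K\<close> is the moment recursion in series form. Applying
  \<open>zsteps\<close> to the moments of F multiplies K by a multiple of (t - s)^M and leaves
  coefficients polynomial in n; in the falling factorial basis, Kummer's formula turns each of them
  back into a \<open>toep_entry\<close>.\<close>

lemma toep_entry_chain_step:
  fixes a t :: real and m :: nat
  defines "M \<equiv> Suc m"
  assumes a: "a > -1" and t: "t > 0" and cont: "continuous_on {0..t} F"
    and lip: "\<And>x. x \<in> {0..t} \<Longrightarrow> \<bar>F x - F t\<bar> \<le> C * (t - x)"
    and D: "\<And>x. x \<in> {0..t} \<Longrightarrow> (t - x) ^ m * F x = (\<Sum>k<M. d k * toep_entry a (int k) x)"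
    and K: "\<And>s. s \<in> {0..t} \<Longrightarrow>
      (\<lambda>n. (s / t) ^ n * (Gamma (a + 1 + real M + real n) / (fact n)\<^sup>2) * integral {0..t} (\<lambda>x. x ^ n * (t - x) ^ m * F x))
        sums (exp s * (fact m * t ^ M * K s))"
  shows "\<exists>e. e M = Gamma (a + real M + 1) * (- 1) ^ M * F t \<and>
     (\<forall>s\<in>{0..t}. (t - s) ^ M * K s = (\<Sum>k\<le>M. e k * toep_entry a (int k) s))"
proof -
  define v where "v n = integral {0..t} (\<lambda>x. x ^ n * (t - x) ^ m * F x)" for n
  have v: "v n = (\<Sum>k<M. d k * toep_moment a t (int k) n)" for n
  proof -
    have "v n = integral {0..t} (\<lambda>x. \<Sum>k<M. d k * (x ^ n * toep_entry a (int k) x))"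
      unfolding v_def
    proof (rule integral_cong)
      fix x assume "x \<in> {0..t}"
      then have "x ^ n * ((t - x) ^ m * F x) = x ^ n * (\<Sum>k<M. d k * toep_entry a (int k) x)" by (simp only: D)
      then show "x ^ n * (t - x) ^ m * F x = (\<Sum>k<M. d k * (x ^ n * toep_entry a (int k) x))"
        by (simp add: sum_distrib_left mult_ac)
    qed
    also have "\<dots> = (\<Sum>k<M. d k * toep_moment a t (int k) n)"
      unfolding toep_moment_def
      by (subst integral_sum) (auto intro!: integrable_continuous_interval continuous_intros)
    finally show ?thesis .
  qed
  obtain Q where Q: "\<And>n. zsteps a M v n = t ^ n * poly Q (real n)"
    using zsteps_toep_moment_poly[OF t, where a = a and M = M and v = v and d = d and P = 0] v by auto
  have series: "(\<lambda>n. Gamma (a + 1 + real n) / (fact n)\<^sup>2 * poly Q (real n) * s ^ n) sums (exp s * (fact m * ((t - s) ^ M * K s)))"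
    if "s \<in> {0..t}" for s
  proof -
    have "(\<lambda>n. (s / t) ^ n * (Gamma (a + 1 + real n) / (fact n)\<^sup>2) * zsteps a M v n) sums
       (((t - s) / t) ^ M * (exp s * (fact m * t ^ M * K s)))"
      using K[OF that] by (intro zsteps_series a t) (simp add: v_def)
    moreover have "(s / t) ^ n * (Gamma (a + 1 + real n) / (fact n)\<^sup>2) * zsteps a M v n
       = Gamma (a + 1 + real n) / (fact n)\<^sup>2 * poly Q (real n) * s ^ n" for n
      using t by (simp add: Q power_divide)
    moreover have "((t - s) / t) ^ M * (exp s * (fact m * t ^ M * K s)) = exp s * (fact m * ((t - s) ^ M * K s))"
      using t by (simp add: power_divide)
    ultimately show ?thesis by (simp only:)
  qed
  \<comment> \<open>The moments decay like n^(-M) and each of the M steps adds two powers of n,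
    which leaves growth of order n^M.\<close>
  have 1: "(\<lambda>n. zsteps a M v n / t ^ n / real n powr (- real M + 2 * real M)) \<longlonglongrightarrow> (- 1 / t) ^ M * (fact m * t ^ M * F t)"
    unfolding v_def M_def by (rule zsteps_growth[OF t endpoint_moment_asymptotics[OF t cont lip]])
  have 2: "\<forall>\<^sub>F n in sequentially. zsteps a M v n / t ^ n / real n powr (- real M + 2 * real M) = poly Q (real n) / real n ^ M"
    using eventually_gt_at_top[of 0] by eventually_elim (use t in \<open>simp add: Q powr_realpow\<close>)
  have 3: "(- 1 / t) ^ M * (fact m * t ^ M * F t) = fact m * (- 1) ^ M * F t"
    unfolding power_divide using t by simp
  have "(\<lambda>n. poly Q (real n) / real n ^ M) \<longlonglongrightarrow> fact m * (- 1) ^ M * F t"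
    using Lim_transform_eventually[OF 1 2] unfolding 3 .
  note Q' = poly_growth_coeff[OF this]
  obtain e where e: "e M = fact m * (- 1) ^ M * F t"
      "\<And>p. poly Q (real p) = (\<Sum>k\<le>M. e k * (fact k * real (p choose k)))"
    using poly_binomial_basis[OF Q'(1)] Q'(2) by auto
  \<comment> \<open>The Gamma factor is the one in Kummer's formula; \<open>fact m\<close> is the
    normalisation of K and cancels the one in the leading coefficient of Q.\<close>
  define e' where "e' k = e k * Gamma (a + real k + 1) / fact m" for k
  have "(t - s) ^ M * K s = (\<Sum>k\<le>M. e' k * toep_entry a (int k) s)" if s: "s \<in> {0..t}" for s
  proof -
    have "(\<lambda>p. \<Sum>k\<le>M. e k * (Gamma (a + 1 + real p) / (fact p)\<^sup>2 * (fact k * real (p choose k)) * s ^ p)) sums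
       (\<Sum>k\<le>M. e k * (Gamma (a + real k + 1) * exp s * toep_entry a (int k) s))"
      by (intro sums_sum sums_mult toep_entry_kummer a)
    moreover have "(\<Sum>k\<le>M. e k * (Gamma (a + 1 + real p) / (fact p)\<^sup>2 * (fact k * real (p choose k)) * s ^ p))
       = Gamma (a + 1 + real p) / (fact p)\<^sup>2 * poly Q (real p) * s ^ p" for p
      unfolding e(2) sum_distrib_left sum_distrib_right by (rule sum.cong) simp_all
    ultimately have "exp s * (fact m * ((t - s) ^ M * K s)) = (\<Sum>k\<le>M. e k * (Gamma (a + real k + 1) * exp s * toep_entry a (int k) s))"
      using sums_unique2[OF series[OF s]] by simp
    also have "\<dots> = exp s * (fact m * (\<Sum>k\<le>M. e' k * toep_entry a (int k) s))"
      unfolding e'_def sum_distrib_left by (rule sum.cong) simp_all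
    finally show ?thesis by simp
  qed
  moreover have "e' M = Gamma (a + real M + 1) * (- 1) ^ M * F t" by (simp add: e'_def e(1))
  ultimately show ?thesis by blast
qed

section \<open>Vanishing order at the end point and Cramer's rule\<close>

text \<open>The factor \<open>0 ^ (M - i)\<close> distinguishes \<open>i < M\<close> from \<open>i = M\<close>.\<close>

lemma taylor_coeff_of_zero:
  fixes f :: "nat \<Rightarrow> real \<Rightarrow> real" and t :: real
  assumes t: "t > 0" and der: "\<And>i x. (f i has_real_derivative f (Suc i) x) (at x)"
    and f: "\<And>x. x \<in> {0..t} \<Longrightarrow> (t - x) ^ M * K x = f 0 x"
    and cont: "continuous_on {0..t} K" and "i \<le> M"
  shows "f i t = fact i * (- 1) ^ i * (K t * 0 ^ (M - i))"
  using \<open>i \<le> M\<close>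
proof (induction i rule: less_induct)
  case (less i)
  show ?case
  proof (cases "i = 0")
    case True
    then show ?thesis using f[of t] t by (simp add: mult.commute)
  next
    case False
    \<comment> \<open>Points strictly below t that tend to t. Only continuity of K is available, so
      the i-th derivative at t is recovered as a limit of Lagrange remainders; the lower Taylor
      terms vanish by induction.\<close>
    define s where "s j = t - t / real (j + 2)" for j
    have s_less: "0 \<le> s j" "s j < t" for j using t by (auto simp: s_def field_simps)
    have slim: "s \<longlonglongrightarrow> t" unfolding s_def by real_asymp
    have "\<exists>x. s j < x \<and> x < t \<and> f i x = fact i * (- 1) ^ i * (K (s j) * (t - s j) ^ (M - i))" for j
    proof -
      obtain x where x: "s j < x" "x < t"
          "f 0 (s j) = (\<Sum>k<i. f k t / fact k * (s j - t) ^ k) + f i x / fact i * (s j - t) ^ i"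
        using Taylor_down[of i f "f 0" "s j" t t] False der s_less[of j] by auto
      have "(\<Sum>k<i. f k t / fact k * (s j - t) ^ k) = 0"
        using less by (intro sum.neutral) auto
      then have "(t - s j) ^ M * K (s j) = f i x / fact i * (s j - t) ^ i"
        using x f[of "s j"] s_less[of j] by auto
      moreover have "(s j - t) ^ i = (- 1) ^ i * (t - s j) ^ i"
        by (simp flip: power_mult_distrib)
      moreover have "(t - s j) ^ M = (t - s j) ^ i * (t - s j) ^ (M - i)"
        using less.prems by (simp flip: power_add)
      ultimately have "(t - s j) ^ i * ((t - s j) ^ (M - i) * K (s j)) = (t - s j) ^ i * (f i x / fact i * (- 1) ^ i)"
        by (simp only: mult_ac)
      then have "(t - s j) ^ (M - i) * K (s j) = f i x / fact i * (- 1) ^ i"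
        using s_less[of j] by (subst (asm) mult_left_cancel) auto
      then have "fact i * (- 1) ^ i * (K (s j) * (t - s j) ^ (M - i)) = f i x * ((- 1) ^ i * (- 1) ^ i)"
        by (simp add: mult_ac)
      then show ?thesis using x(1,2) by (metis mult.right_neutral power_mult_distrib mult_minus1 minus_minus power_one)
    qed
    then obtain x where x: "\<And>j. s j < x j" "\<And>j. x j < t"
        "\<And>j. f i (x j) = fact i * (- 1) ^ i * (K (s j) * (t - s j) ^ (M - i))" by metis
    have "x \<longlonglongrightarrow> t"
      by (rule tendsto_sandwich[OF _ _ slim tendsto_const]) (auto intro!: always_eventually less_imp_le x)
    then have "(\<lambda>j. f i (x j)) \<longlonglongrightarrow> f i t" by (rule isCont_tendsto_compose[OF DERIV_isCont[OF der]])
    moreover have "(\<lambda>j. K (s j)) \<longlonglongrightarrow> K t"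
      using cont slim s_less t unfolding continuous_on_sequentially comp_def by (auto simp: less_imp_le)
    then have "(\<lambda>j. fact i * (- 1) ^ i * (K (s j) * (t - s j) ^ (M - i))) \<longlonglongrightarrow> fact i * (- 1) ^ i * (K t * (t - t) ^ (M - i))"
      by (intro tendsto_intros slim)
    ultimately show ?thesis unfolding x(3) by (simp add: LIMSEQ_unique)
  qed
qed

definition toep_mat :: "real \<Rightarrow> nat \<Rightarrow> real \<Rightarrow> real mat" where
  "toep_mat a N t = mat N N (\<lambda>(i, k). toep_entry a (int k - int i) t)"

lemma toep_mat_carrier [simp]: "toep_mat a N t \<in> carrier_mat N N"
  by (simp add: toep_mat_def)

text \<open>Cramer's rule for the Wronskian of the functions \<open>toep_entry a (int k)\<close>, which is a Toeplitz matrix since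
  the derivative of \<open>toep_entry a k\<close> is \<open>toep_entry a (k - 1)\<close>.\<close>

lemma det_toep_mat_step:
  fixes a t :: real
  assumes t: "t > 0" and cont: "continuous_on {0..t} K"
    and K: "\<And>x. x \<in> {0..t} \<Longrightarrow> (t - x) ^ M * K x = (\<Sum>k\<le>M. e k * toep_entry a (int k) x)"
  shows "e M * det (toep_mat a (Suc M) t) = fact M * (- 1) ^ M * K t * det (toep_mat a M t)"
proof -
  define f where "f i x = (\<Sum>k\<le>M. e k * toep_entry a (int k - int i) x)" for i x
  have der: "(f i has_real_derivative f (Suc i) x) (at x)" for i x
  proof -
    have eq: "int k - int i - 1 = int k - int (Suc i)" for k by simp
    show ?thesis unfolding f_def by (auto intro!: derivative_eq_intros simp: eq mult.commute simp del: of_nat_Suc)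
  qed
  have f: "f i t = fact i * (- 1) ^ i * (K t * 0 ^ (M - i))" if "i \<le> M" for i
    by (rule taylor_coeff_of_zero[where M = M and K = K and f = f, OF t der _ cont that]) (simp add: f_def K)
  let ?T = "toep_mat a (Suc M) t"
  have T: "?T \<in> carrier_mat (Suc M) (Suc M)" by simp
  let ?d = "vec (Suc M) e" and ?c = "vec (Suc M) (\<lambda>i. f i t)"
  have Td: "?T *\<^sub>v ?d = ?c"
    by (intro eq_vecI) (auto simp: toep_mat_def f_def scalar_prod_def lessThan_Suc_atMost atLeast0LessThan mult.commute intro!: sum.cong)
  \<comment> \<open>The adjugate identity gives Cramer's rule for a possibly singular matrix;
    nonvanishing of determinants is settled later by positivity of moments.\<close>
  have "(adj_mat ?T * ?T) *\<^sub>v ?d = adj_mat ?T *\<^sub>v ?c"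
    using T adj_mat(1)[OF T] by (simp add: Td assoc_mult_mat_vec[of _ "Suc M" "Suc M" _ "Suc M"])
  then have *: "((det ?T \<cdot>\<^sub>m 1\<^sub>m (Suc M)) *\<^sub>v ?d) $ M = (adj_mat ?T *\<^sub>v ?c) $ M"
    by (simp add: adj_mat(3)[OF T])
  have "((det ?T \<cdot>\<^sub>m 1\<^sub>m (Suc M)) *\<^sub>v ?d) $ M = det ?T * e M"
    by (simp add: scalar_prod_def atLeast0LessThan if_distrib[of "\<lambda>x. _ * x"] if_distrib[of "\<lambda>x. x * _"] cong: if_cong)
  moreover have "(adj_mat ?T *\<^sub>v ?c) $ M = (\<Sum>i<Suc M. cofactor ?T i M * f i t)"
    using adj_mat(1)[OF T] by (simp add: scalar_prod_def adj_mat_def atLeast0LessThan toep_mat_def del: sum.lessThan_Suc)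
  \<comment> \<open>The right-hand side of the linear system is supported at i = M, and the corner
    minor of a Toeplitz matrix is the Toeplitz matrix of the next smaller size.\<close>
  moreover have "(\<Sum>i<Suc M. cofactor ?T i M * f i t) = cofactor ?T M M * f M t"
    by (simp add: f sum.neutral)
  moreover have "mat_delete ?T M M = toep_mat a M t"
    by (rule eq_matI) (auto simp: toep_mat_def mat_delete_def)
  then have "cofactor ?T M M = det (toep_mat a M t)" by (simp add: cofactor_def)
  ultimately show ?thesis using * f[of M] by (simp add: mult_ac)
qed

section \<open>Rotation invariance of complex Gaussian vectors\<close>

text \<open>The one-dimensional rule with Jacobian |r|^j is an assumption, so that one elimination
  serves the real plane (j = 1) and pairs of complex numbers (j = 2). A nonzero pivot
  \<open>a\<close> factors the map into two triangular ones, treated one variable at a time; a zero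
  pivot is handled by exchanging the variables.\<close>

lemma nn_integral_plane_linear:
  fixes F :: "'a::{real_normed_field,euclidean_space} \<times> 'a \<Rightarrow> ennreal" and a b c d :: 'a and j :: nat
  assumes aff: "\<And>(f::'a \<Rightarrow> ennreal) r s. f \<in> borel_measurable borel \<Longrightarrow> r \<noteq> 0 \<Longrightarrow>
      (\<integral>\<^sup>+x. f x \<partial>lborel) = ennreal (norm r ^ j) * (\<integral>\<^sup>+x. f (r * x + s) \<partial>lborel)"
  assumes F[measurable]: "F \<in> borel_measurable (borel \<Otimes>\<^sub>M borel)" and det: "a * d - b * c \<noteq> 0"
  shows "(\<integral>\<^sup>+x. \<integral>\<^sup>+y. F (x, y) \<partial>lborel \<partial>lborel) =
     ennreal (norm (a * d - b * c) ^ j) * (\<integral>\<^sup>+x. \<integral>\<^sup>+y. F (a * x + b * y, c * x + d * y) \<partial>lborel \<partial>lborel)"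
proof -
  have mult[measurable]: "(\<lambda>x. r * x) \<in> borel_measurable borel" for r :: 'a
    by (intro borel_measurable_continuous_onI continuous_intros)
  have Fub: "(\<integral>\<^sup>+x. \<integral>\<^sup>+y. G (x, y) \<partial>lborel \<partial>lborel) = (\<integral>\<^sup>+y. \<integral>\<^sup>+x. G (x, y) \<partial>lborel \<partial>lborel)"
    if "G \<in> borel_measurable (borel \<Otimes>\<^sub>M borel)" for G :: "'a \<times> 'a \<Rightarrow> ennreal"
    using lborel_pair.Fubini[of G] that by simp
  define D where "D = a * d - b * c"
  show ?thesis
  proof (cases "a = 0")
    case False
    have [measurable]: "(\<lambda>(x, y). F (x, (D / a) * y + (c / a) * x)) \<in> borel_measurable (borel \<Otimes>\<^sub>M borel)"
      by measurable
    have "(\<integral>\<^sup>+x. \<integral>\<^sup>+y. F (x, y) \<partial>lborel \<partial>lborel) = (\<integral>\<^sup>+x. ennreal (norm (D / a) ^ j) * (\<integral>\<^sup>+y. F (x, (D / a) * y + (c / a) * x) \<partial>lborel) \<partial>lborel)"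
      using det False by (intro nn_integral_cong aff) (auto simp: D_def)
    also have "\<dots> = ennreal (norm (D / a) ^ j) * (\<integral>\<^sup>+x. \<integral>\<^sup>+y. F (x, (D / a) * y + (c / a) * x) \<partial>lborel \<partial>lborel)"
      by (rule nn_integral_cmult) measurable
    also have "(\<integral>\<^sup>+x. \<integral>\<^sup>+y. F (x, (D / a) * y + (c / a) * x) \<partial>lborel \<partial>lborel) = (\<integral>\<^sup>+y. \<integral>\<^sup>+x. F (x, (D / a) * y + (c / a) * x) \<partial>lborel \<partial>lborel)"
      using Fub[of "\<lambda>(x, y). F (x, (D / a) * y + (c / a) * x)"] by simp
    also have "\<dots> = (\<integral>\<^sup>+y. ennreal (norm a ^ j) * (\<integral>\<^sup>+x. F (a * x + b * y, (D / a) * y + (c / a) * (a * x + b * y)) \<partial>lborel) \<partial>lborel)"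
      using False by (intro nn_integral_cong aff) auto
    also have "\<dots> = (\<integral>\<^sup>+y. ennreal (norm a ^ j) * (\<integral>\<^sup>+x. F (a * x + b * y, c * x + d * y) \<partial>lborel) \<partial>lborel)"
    proof -
      have "(D / a) * y + (c / a) * (a * x + b * y) = c * x + d * y" for x y
        using False by (simp add: D_def field_simps)
      then show ?thesis by simp
    qed
    also have "\<dots> = ennreal (norm a ^ j) * (\<integral>\<^sup>+y. \<integral>\<^sup>+x. F (a * x + b * y, c * x + d * y) \<partial>lborel \<partial>lborel)"
      by (rule nn_integral_cmult) measurable
    also have "(\<integral>\<^sup>+y. \<integral>\<^sup>+x. F (a * x + b * y, c * x + d * y) \<partial>lborel \<partial>lborel) = (\<integral>\<^sup>+x. \<integral>\<^sup>+y. F (a * x + b * y, c * x + d * y) \<partial>lborel \<partial>lborel)"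
      using Fub[of "\<lambda>(x, y). F (a * x + b * y, c * x + d * y)"] by simp
    also have "ennreal (norm (D / a) ^ j) * (ennreal (norm a ^ j) * X) = ennreal (norm D ^ j) * X" for X
      using False by (simp add: mult.assoc[symmetric] norm_divide power_divide flip: ennreal_mult)
    finally show ?thesis by (simp add: D_def)
  next
    case True
    then have bc: "b \<noteq> 0" "c \<noteq> 0" using det by auto
    have "(\<integral>\<^sup>+x. \<integral>\<^sup>+y. F (x, y) \<partial>lborel \<partial>lborel) = ennreal (norm b ^ j) * (\<integral>\<^sup>+y. \<integral>\<^sup>+x. F (b * y + 0, x) \<partial>lborel \<partial>lborel)"
      using bc by (intro aff) auto
    also have "\<dots> = ennreal (norm b ^ j) * (\<integral>\<^sup>+y. ennreal (norm c ^ j) * (\<integral>\<^sup>+x. F (b * y + 0, c * x + d * y) \<partial>lborel) \<partial>lborel)"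
      using bc by (intro arg_cong2[where f = "(*)"] refl nn_integral_cong aff) auto
    also have "\<dots> = ennreal (norm b ^ j) * (ennreal (norm c ^ j) * (\<integral>\<^sup>+y. \<integral>\<^sup>+x. F (b * y, c * x + d * y) \<partial>lborel \<partial>lborel))"
      by (subst nn_integral_cmult) auto
    also have "(\<integral>\<^sup>+y. \<integral>\<^sup>+x. F (b * y, c * x + d * y) \<partial>lborel \<partial>lborel) = (\<integral>\<^sup>+x. \<integral>\<^sup>+y. F (b * y, c * x + d * y) \<partial>lborel \<partial>lborel)"
      using Fub[of "\<lambda>(x, y). F (b * y, c * x + d * y)"] by simp
    finally show ?thesis using True
      by (simp add: mult.assoc[symmetric] norm_mult power_mult_distrib flip: ennreal_mult)
  qed
qed

lemma lborel_complex_eq: "(lborel :: complex measure) = distr (lborel \<Otimes>\<^sub>M lborel) borel (\<lambda>(x, y). Complex x y)"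
proof (rule lborel_eqI)
  have [measurable]: "(\<lambda>(x, y). Complex x y) \<in> borel_measurable (borel \<Otimes>\<^sub>M borel)"
    unfolding borel_prod by (intro borel_measurable_continuous_onI) (auto simp: case_prod_beta Complex_eq intro!: continuous_intros)
  fix l u :: complex assume le: "\<And>b. b \<in> Basis \<Longrightarrow> l \<bullet> b \<le> u \<bullet> b"
  have "(\<lambda>(x, y). Complex x y) -` box l u \<inter> space (lborel \<Otimes>\<^sub>M lborel) = {Re l <..< Re u} \<times> {Im l <..< Im u}"
    by (auto simp: box_def Basis_complex_def space_pair_measure)
  then have "emeasure (distr (lborel \<Otimes>\<^sub>M lborel) borel (\<lambda>(x, y). Complex x y)) (box l u) =
     emeasure lborel {Re l <..< Re u} * emeasure lborel {Im l <..< Im u}"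
    by (simp add: emeasure_distr lborel.emeasure_pair_measure_Times)
  also have "\<dots> = ennreal (\<Prod>b\<in>Basis. (u - l) \<bullet> b)"
    using le[of 1] le[of \<i>] by (simp add: Basis_complex_def ennreal_mult)
  finally show "emeasure (distr (lborel \<Otimes>\<^sub>M lborel) borel (\<lambda>(x, y). Complex x y)) (box l u) = (\<Prod>b\<in>Basis. (u - l) \<bullet> b)" .
qed simp

lemma nn_integral_complex:
  fixes f :: "complex \<Rightarrow> ennreal"
  assumes [measurable]: "f \<in> borel_measurable borel"
  shows "(\<integral>\<^sup>+z. f z \<partial>lborel) = (\<integral>\<^sup>+x. \<integral>\<^sup>+y. f (Complex x y) \<partial>lborel \<partial>lborel)"
proof -
  have m[measurable]: "(\<lambda>(x, y). Complex x y) \<in> borel_measurable (borel \<Otimes>\<^sub>M borel)"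
    unfolding borel_prod by (intro borel_measurable_continuous_onI) (auto simp: case_prod_beta Complex_eq intro!: continuous_intros)
  have "(\<integral>\<^sup>+z. f z \<partial>lborel) = (\<integral>\<^sup>+p. f (case p of (x, y) \<Rightarrow> Complex x y) \<partial>(lborel \<Otimes>\<^sub>M lborel))"
    by (subst lborel_complex_eq, subst nn_integral_distr) auto
  also have "\<dots> = (\<integral>\<^sup>+x. \<integral>\<^sup>+y. f (Complex x y) \<partial>lborel \<partial>lborel)"
    by (subst lborel.nn_integral_fst[symmetric]) (auto simp: case_prod_beta)
  finally show ?thesis .
qed

text \<open>As a real map, multiplication by r has rows (Re r, -Im r) and (Im r, Re r), hence
  determinant |r|^2.\<close>

lemma nn_integral_complex_affine:
  fixes f :: "complex \<Rightarrow> ennreal" and r s :: complex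
  assumes f[measurable]: "f \<in> borel_measurable borel" and r: "r \<noteq> 0"
  shows "(\<integral>\<^sup>+x. f x \<partial>lborel) = ennreal (norm r ^ 2) * (\<integral>\<^sup>+x. f (r * x + s) \<partial>lborel)"
proof -
  have m[measurable]: "(\<lambda>(x, y). Complex x y) \<in> borel_measurable (borel \<Otimes>\<^sub>M borel)"
    unfolding borel_prod by (intro borel_measurable_continuous_onI) (auto simp: case_prod_beta Complex_eq intro!: continuous_intros)
  have "(\<integral>\<^sup>+x. f x \<partial>lborel) = (\<integral>\<^sup>+x. f (s + x) \<partial>lborel)"
    by (subst lborel_distr_plus[of s, symmetric], subst nn_integral_distr) auto
  also have "\<dots> = (\<integral>\<^sup>+x. \<integral>\<^sup>+y. (case (x, y) of (x, y) \<Rightarrow> f (s + Complex x y)) \<partial>lborel \<partial>lborel)"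
    by (subst nn_integral_complex) auto
  also have "\<dots> = ennreal (norm (Re r * Re r - (- Im r) * Im r) ^ 1) *
      (\<integral>\<^sup>+x. \<integral>\<^sup>+y. (case (Re r * x + (- Im r) * y, Im r * x + Re r * y) of (x, y) \<Rightarrow> f (s + Complex x y)) \<partial>lborel \<partial>lborel)"
  proof (rule nn_integral_plane_linear)
    show "Re r * Re r - (- Im r) * Im r \<noteq> 0"
      using r by (simp add: complex_eq_iff sum_squares_eq_zero_iff)
    show "(\<integral>\<^sup>+x. g x \<partial>lborel) = ennreal (norm c ^ 1) * (\<integral>\<^sup>+x. g (c * x + t) \<partial>lborel)"
      if "g \<in> borel_measurable borel" "c \<noteq> 0" for g :: "real \<Rightarrow> ennreal" and c t
      using nn_integral_real_affine[OF that, of t] by (simp add: add.commute)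
  qed measurable
  also have "\<dots> = ennreal (norm r ^ 2) * (\<integral>\<^sup>+x. \<integral>\<^sup>+y. f (r * Complex x y + s) \<partial>lborel \<partial>lborel)"
  proof -
    have "Complex (Re r * x + (- Im r) * y) (Im r * x + Re r * y) = r * Complex x y" for x y
      by (simp add: complex_eq_iff)
    moreover have "norm (Re r * Re r - (- Im r) * Im r) ^ 1 = norm r ^ 2"
      using cmod_power2[of r] by (simp add: power2_eq_square)
    ultimately show ?thesis by (simp only: prod.case add.commute)
  qed
  also have "(\<integral>\<^sup>+x. \<integral>\<^sup>+y. f (r * Complex x y + s) \<partial>lborel \<partial>lborel) = (\<integral>\<^sup>+x. f (r * x + s) \<partial>lborel)"
    by (subst nn_integral_complex) auto
  finally show ?thesis .
qed

text \<open>The disc of squared radius x has area pi x, and the half-lines up to x generate the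
  Borel sets.\<close>

lemma distr_norm_squared_complex:
  "distr (lborel :: complex measure) borel (\<lambda>z. (norm z)\<^sup>2) = density lborel (\<lambda>p. ennreal pi * indicator {0..} p)"
proof (rule measure_eqI_generator_eq[where E = "range (\<lambda>x::real. {..x})" and \<Omega> = UNIV and A = "\<lambda>n. {..real n}"])
  show "Int_stable (range (\<lambda>x::real. {..x}))"
    by (auto simp: Int_stable_def)
  have em: "emeasure (distr (lborel :: complex measure) borel (\<lambda>z. (norm z)\<^sup>2)) {..x} = ennreal (pi * max 0 x)" for x
  proof -
    have "emeasure (distr (lborel :: complex measure) borel (\<lambda>z. (norm z)\<^sup>2)) {..x} = emeasure lborel {z :: complex. (norm z)\<^sup>2 \<le> x}"
      by (subst emeasure_distr) (auto simp: vimage_def)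
    also have "\<dots> = ennreal (pi * max 0 x)"
    proof (cases "x \<ge> 0")
      case True
      then have "{z :: complex. (norm z)\<^sup>2 \<le> x} = cball 0 (sqrt x)"
        by (auto simp: real_le_rsqrt) (metis norm_ge_zero power_mono real_sqrt_pow2)
      then show ?thesis using True by (simp add: emeasure_cball eval_unit_ball_vol)
    next
      case False
      then have "{z :: complex. (norm z)\<^sup>2 \<le> x} = {}"
        by (auto simp: not_le intro: less_le_trans)
      then show ?thesis using False by simp
    qed
    finally show ?thesis .
  qed
  show "emeasure (distr (lborel :: complex measure) borel (\<lambda>z. (norm z)\<^sup>2)) X = emeasure (density lborel (\<lambda>p. ennreal pi * indicator {0..} p)) X"
    if "X \<in> range (\<lambda>x::real. {..x})" for X
  proof -
    obtain x where X: "X = {..x}" using \<open>X \<in> _\<close> by auto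
    have "emeasure (density lborel (\<lambda>p. ennreal pi * indicator {0..} p)) X = (\<integral>\<^sup>+p. ennreal pi * indicator {0..x} p \<partial>lborel)"
      unfolding X by (subst emeasure_density) (auto intro!: nn_integral_cong simp: indicator_def)
    also have "\<dots> = ennreal (pi * max 0 x)"
      by (subst nn_integral_cmult) (auto simp: emeasure_lborel_Icc_eq ennreal_mult'' max_def)
    finally show ?thesis using em[of x] by (simp add: X)
  qed
  show "sets (distr (lborel :: complex measure) borel (\<lambda>z. (norm z)\<^sup>2)) = sigma_sets UNIV (range (\<lambda>x::real. {..x}))"
    by (subst borel_eq_atMost) (simp add: )
  show "sets (density lborel (\<lambda>p. ennreal pi * indicator {0..} p)) = sigma_sets UNIV (range (\<lambda>x::real. {..x}))"
    by (simp, subst borel_eq_atMost) simp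
  show "(\<Union>i. {..real i}) = UNIV" by (auto intro: real_arch_simple)
  show "emeasure (distr (lborel :: complex measure) borel (\<lambda>z. (norm z)\<^sup>2)) {..real i} \<noteq> \<infinity>" for i
    by (simp add: em)
qed auto

lemma nn_integral_complex_radial:
  assumes [measurable]: "F \<in> borel_measurable borel"
  shows "(\<integral>\<^sup>+z. F ((norm (z::complex))\<^sup>2) \<partial>lborel) = ennreal pi * (\<integral>\<^sup>+p. F p * indicator {0..} p \<partial>lborel)"
proof -
  have "(\<integral>\<^sup>+z. F ((norm (z::complex))\<^sup>2) \<partial>lborel) = (\<integral>\<^sup>+p. F p \<partial>distr (lborel :: complex measure) borel (\<lambda>z. (norm z)\<^sup>2))"
    by (subst nn_integral_distr) auto
  also have "\<dots> = (\<integral>\<^sup>+p. ennreal pi * (F p * indicator {0..} p) \<partial>lborel)"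
    unfolding distr_norm_squared_complex by (subst nn_integral_density) (auto intro!: nn_integral_cong simp: mult_ac)
  finally show ?thesis by (simp add: nn_integral_cmult)
qed

section \<open>The complex Gaussian law and its unitary invariance\<close>

lemma sets_complex_gauss [measurable_cong, simp]: "sets complex_gauss = sets borel"
  and space_complex_gauss [simp]: "space complex_gauss = UNIV"
  by (simp_all add: complex_gauss_def)

lemma nn_integral_complex_gauss:
  assumes [measurable]: "f \<in> borel_measurable borel"
  shows "(\<integral>\<^sup>+w. f w \<partial>complex_gauss) = (\<integral>\<^sup>+w. ennreal (exp (- (cmod w)\<^sup>2) / pi) * f w \<partial>lborel)"
  unfolding complex_gauss_def by (rule nn_integral_density) auto

lemma prob_space_complex_gauss: "prob_space complex_gauss"
proof
  have "emeasure complex_gauss UNIV = (\<integral>\<^sup>+w. 1 \<partial>complex_gauss)" by simp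
  also have "\<dots> = ennreal pi * (\<integral>\<^sup>+p. ennreal (exp (- p) / pi) * indicator {0..} p \<partial>lborel)"
    using nn_integral_complex_radial[of "\<lambda>p. ennreal (exp (- p) / pi)"] nn_integral_complex_gauss[of "\<lambda>_. 1"]
    by (simp del: nn_integral_const)
  also have "\<dots> = (\<integral>\<^sup>+p. ennreal pi * (ennreal (exp (- p) / pi) * indicator {0..} p) \<partial>lborel)"
    by (rule nn_integral_cmult[symmetric]) auto
  also have "\<dots> = (\<integral>\<^sup>+p. ennreal (erlang_density 0 1 p * p ^ 0) \<partial>lborel)"
    by (intro nn_integral_cong) (auto simp: erlang_density_def indicator_def simp flip: ennreal_mult)
  also have "\<dots> = 1" by (subst nn_integral_erlang_ith_moment) auto
  finally show "emeasure complex_gauss (space complex_gauss) = 1" by simp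
qed

interpretation gauss_prod: product_prob_space "\<lambda>_. complex_gauss" I for I
  by (intro product_prob_spaceI prob_space_complex_gauss)

abbreviation gauss_PiM :: "'i set \<Rightarrow> ('i \<Rightarrow> complex) measure" where
  "gauss_PiM I \<equiv> PiM I (\<lambda>_. complex_gauss)"

text \<open>Orthonormality of the rows and of the columns is listed separately, so that products
  with the adjoint on either side can be read off.\<close>

definition unitary2 :: "complex \<Rightarrow> complex \<Rightarrow> complex \<Rightarrow> complex \<Rightarrow> bool" where
  "unitary2 a b c d \<longleftrightarrow> a * cnj a + b * cnj b = 1 \<and> c * cnj c + d * cnj d = 1 \<and> a * cnj c + b * cnj d = 0 \<and>
     a * cnj a + c * cnj c = 1 \<and> b * cnj b + d * cnj d = 1 \<and> a * cnj b + c * cnj d = 0"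

lemma unitary2_norm:
  assumes "unitary2 a b c d"
  shows "(cmod (a * x + b * y))\<^sup>2 + (cmod (c * x + d * y))\<^sup>2 = (cmod x)\<^sup>2 + (cmod y)\<^sup>2"
proof -
  note u = assms[unfolded unitary2_def]
  have u': "cnj a * b + cnj c * d = 0" using arg_cong[of _ _ cnj, OF u[THEN conjunct2, THEN conjunct2, THEN conjunct2, THEN conjunct2, THEN conjunct2]] by simp
  have "complex_of_real ((cmod (a * x + b * y))\<^sup>2 + (cmod (c * x + d * y))\<^sup>2) =
     (a * x + b * y) * cnj (a * x + b * y) + (c * x + d * y) * cnj (c * x + d * y)"
    by (simp add: complex_norm_square del: complex_cnj_add complex_cnj_mult of_real_power)
  also have "\<dots> = (a * cnj a + c * cnj c) * (x * cnj x) + (b * cnj b + d * cnj d) * (y * cnj y)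
      + (a * cnj b + c * cnj d) * (x * cnj y) + (cnj a * b + cnj c * d) * (cnj x * y)"
    by (simp add: algebra_simps)
  also have "\<dots> = x * cnj x + y * cnj y" unfolding u' using u by simp
  also have "\<dots> = complex_of_real ((cmod x)\<^sup>2 + (cmod y)\<^sup>2)" by (simp add: complex_norm_square del: of_real_power)
  finally show ?thesis by (simp only: of_real_eq_iff)
qed

text \<open>Lagrange's identity: |ad - bc|^2 is the Gram determinant of the two rows.\<close>

lemma unitary2_det:
  assumes "unitary2 a b c d"
  shows "cmod (a * d - b * c) = 1"
proof -
  note u = assms[unfolded unitary2_def]
  have "complex_of_real ((cmod (a * d - b * c))\<^sup>2) = (a * d - b * c) * cnj (a * d - b * c)"
    by (simp add: complex_norm_square del: complex_cnj_diff complex_cnj_mult of_real_power)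
  also have "\<dots> = (a * cnj a + b * cnj b) * (c * cnj c + d * cnj d) - (a * cnj c + b * cnj d) * (c * cnj a + d * cnj b)"
    by (simp add: algebra_simps)
  also have "\<dots> = complex_of_real 1" using u by simp
  finally have "(cmod (a * d - b * c))\<^sup>2 = 1" by (simp only: of_real_eq_iff)
  then show ?thesis using norm_ge_zero[of "a * d - b * c"] unfolding power2_eq_1_iff by linarith
qed

text \<open>The joint density depends only on |x|^2 + |y|^2, which the map preserves, and its
  Jacobian |ad - bc|^2 is 1.\<close>

lemma nn_integral_gauss_unitary2:
  fixes F :: "complex \<times> complex \<Rightarrow> ennreal"
  assumes u: "unitary2 a b c d" and F[measurable]: "F \<in> borel_measurable (borel \<Otimes>\<^sub>M borel)"
  shows "(\<integral>\<^sup>+x. \<integral>\<^sup>+y. F (a * x + b * y, c * x + d * y) \<partial>complex_gauss \<partial>complex_gauss) =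
    (\<integral>\<^sup>+x. \<integral>\<^sup>+y. F (x, y) \<partial>complex_gauss \<partial>complex_gauss)"
proof -
  interpret prob_space complex_gauss by (rule prob_space_complex_gauss)
  have gg: "(\<integral>\<^sup>+x. \<integral>\<^sup>+y. G (x, y) \<partial>complex_gauss \<partial>complex_gauss) =
     (\<integral>\<^sup>+x. \<integral>\<^sup>+y. ennreal (exp (- ((cmod x)\<^sup>2 + (cmod y)\<^sup>2)) / pi\<^sup>2) * G (x, y) \<partial>lborel \<partial>lborel)"
    if [measurable]: "G \<in> borel_measurable (borel \<Otimes>\<^sub>M borel)" for G
  proof -
    have dens: "ennreal (exp (- A) / pi) * (ennreal (exp (- B) / pi) * X) = ennreal (exp (- (A + B)) / pi\<^sup>2) * X" for A B X
    proof -
      have "exp (- (A + B)) / pi\<^sup>2 = (exp (- A) / pi) * (exp (- B) / pi)"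
        by (simp add: mult_exp_exp power2_eq_square)
      then show ?thesis by (simp only:) (subst ennreal_mult, auto simp: mult.assoc)
    qed
    have "(\<integral>\<^sup>+x. \<integral>\<^sup>+y. G (x, y) \<partial>complex_gauss \<partial>complex_gauss) =
       (\<integral>\<^sup>+x. ennreal (exp (- (cmod x)\<^sup>2) / pi) * (\<integral>\<^sup>+y. ennreal (exp (- (cmod y)\<^sup>2) / pi) * G (x, y) \<partial>lborel) \<partial>lborel)"
      by (simp add: nn_integral_complex_gauss)
    also have "\<dots> = (\<integral>\<^sup>+x. (\<integral>\<^sup>+y. ennreal (exp (- (cmod x)\<^sup>2) / pi) * (ennreal (exp (- (cmod y)\<^sup>2) / pi) * G (x, y)) \<partial>lborel) \<partial>lborel)"
      by (intro nn_integral_cong nn_integral_cmult[symmetric]) auto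
    finally show ?thesis unfolding dens .
  qed
  define H where "H = (\<lambda>(x, y). ennreal (exp (- ((cmod x)\<^sup>2 + (cmod y)\<^sup>2)) / pi\<^sup>2) * F (x, y))"
  have [measurable]: "H \<in> borel_measurable (borel \<Otimes>\<^sub>M borel)" unfolding H_def by measurable
  have "(\<integral>\<^sup>+x. \<integral>\<^sup>+y. H (x, y) \<partial>lborel \<partial>lborel) = ennreal (norm (a * d - b * c) ^ 2) * (\<integral>\<^sup>+x. \<integral>\<^sup>+y. H (a * x + b * y, c * x + d * y) \<partial>lborel \<partial>lborel)"
    using unitary2_det[OF u] by (intro nn_integral_plane_linear nn_integral_complex_affine) auto
  also have "\<dots> = (\<integral>\<^sup>+x. \<integral>\<^sup>+y. ennreal (exp (- ((cmod x)\<^sup>2 + (cmod y)\<^sup>2)) / pi\<^sup>2) * F (a * x + b * y, c * x + d * y) \<partial>lborel \<partial>lborel)"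
    by (simp add: H_def unitary2_det[OF u] unitary2_norm[OF u] del: minus_add_distrib)
  finally show ?thesis
    using gg[of F] gg[of "\<lambda>(x, y). F (a * x + b * y, c * x + d * y)"] by (simp add: H_def)
qed

text \<open>Both new values are computed from the old \<open>x p\<close> and \<open>x q\<close>; the
  second update does not see the first.\<close>

definition givens :: "complex \<Rightarrow> complex \<Rightarrow> complex \<Rightarrow> complex \<Rightarrow> 'i \<Rightarrow> 'i \<Rightarrow> ('i \<Rightarrow> complex) \<Rightarrow> 'i \<Rightarrow> complex" where
  "givens a b c d p q x = x(p := a * x p + b * x q, q := c * x p + d * x q)"

lemma measurable_givens:
  assumes "p \<in> I" "q \<in> I"
  shows "givens a b c d p q \<in> measurable (gauss_PiM I) (gauss_PiM I)"
proof -
  have [measurable]: "(\<lambda>x. x p) \<in> borel_measurable (gauss_PiM I)" "(\<lambda>x. x q) \<in> borel_measurable (gauss_PiM I)"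
    using measurable_component_singleton[of p I "\<lambda>_. complex_gauss"] measurable_component_singleton[of q I "\<lambda>_. complex_gauss"] assms
    by (simp_all cong: measurable_cong_sets)
  have 1: "I = I \<union> {p}" "I = I \<union> {q}" using assms by auto
  show ?thesis unfolding givens_def
    by (rule measurable_fun_upd[OF 1(2)], rule measurable_fun_upd[OF 1(1)]) measurable
qed

text \<open>Coordinates p and q are split off as the two innermost integrals, where the two-variable
  invariance applies with all other coordinates frozen.\<close>

lemma nn_integral_givens:
  assumes u: "unitary2 a b c d" and I: "finite I" "p \<in> I" "q \<in> I" "p \<noteq> q"
    and F[measurable]: "F \<in> borel_measurable (gauss_PiM I)"
  shows "(\<integral>\<^sup>+x. F (givens a b c d p q x) \<partial>gauss_PiM I) = (\<integral>\<^sup>+x. F x \<partial>gauss_PiM I)"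
proof -
  define J where "J = I - {p, q}"
  have I_eq: "I = insert q (insert p J)" and J: "finite J" "q \<notin> insert p J" "p \<notin> J"
    using I by (auto simp: J_def)
  have fold: "(\<integral>\<^sup>+x. G x \<partial>gauss_PiM I) = (\<integral>\<^sup>+x. \<integral>\<^sup>+y. \<integral>\<^sup>+z. G (x(p := y, q := z)) \<partial>complex_gauss \<partial>complex_gauss \<partial>gauss_PiM J)"
    if [measurable]: "G \<in> borel_measurable (gauss_PiM I)" for G
  proof -
    have G[measurable]: "G \<in> borel_measurable (gauss_PiM (insert q (insert p J)))" using that I_eq by simp
    have "(\<integral>\<^sup>+x. G x \<partial>gauss_PiM I) = (\<integral>\<^sup>+x. \<integral>\<^sup>+z. G (x(q := z)) \<partial>complex_gauss \<partial>gauss_PiM (insert p J))"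
      unfolding I_eq using J by (intro gauss_prod.product_nn_integral_insert) auto
    also have "\<dots> = (\<integral>\<^sup>+x. \<integral>\<^sup>+y. \<integral>\<^sup>+z. G (x(p := y, q := z)) \<partial>complex_gauss \<partial>complex_gauss \<partial>gauss_PiM J)"
    proof (rule gauss_prod.product_nn_integral_insert)
      have "(\<lambda>(x, z). G (x(q := z))) \<in> borel_measurable (gauss_PiM (insert p J) \<Otimes>\<^sub>M complex_gauss)"
        using measurable_compose[OF measurable_add_dim G] by (simp add: case_prod_beta)
      then show "(\<lambda>x. \<integral>\<^sup>+z. G (x(q := z)) \<partial>complex_gauss) \<in> borel_measurable (gauss_PiM (insert p J))"
        by (rule sigma_finite_measure.borel_measurable_nn_integral[OF prob_space_imp_sigma_finite[OF prob_space_complex_gauss]])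
    qed (use J in auto)
    finally show ?thesis .
  qed
  have m: "(\<lambda>x. F (givens a b c d p q x)) \<in> borel_measurable (gauss_PiM I)"
    using measurable_compose[OF measurable_givens F] I by blast
  show ?thesis unfolding fold[OF m] fold[OF F]
  proof (rule nn_integral_cong)
    fix x assume x: "x \<in> space (gauss_PiM J)"
    have F': "F \<in> borel_measurable (gauss_PiM (insert q (insert p J)))" using F I_eq by simp
    have "(\<lambda>w. x(p := w)) \<in> measurable complex_gauss (gauss_PiM (insert p J))"
      using x J by (intro measurable_component_update) auto
    then have "(\<lambda>(y, z). (x(p := y), z)) \<in> measurable (complex_gauss \<Otimes>\<^sub>M complex_gauss) (gauss_PiM (insert p J) \<Otimes>\<^sub>M complex_gauss)"
      by measurable
    from measurable_compose[OF measurable_compose[OF this measurable_add_dim] F']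
    have "(\<lambda>(y, z). F (x(p := y, q := z))) \<in> borel_measurable (complex_gauss \<Otimes>\<^sub>M complex_gauss)"
      by (simp add: case_prod_beta)
    moreover have "sets (complex_gauss \<Otimes>\<^sub>M complex_gauss) = sets (borel \<Otimes>\<^sub>M borel)"
      by (intro sets_pair_measure_cong) auto
    ultimately have "(\<lambda>(y, z). F (x(p := y, q := z))) \<in> borel_measurable (borel \<Otimes>\<^sub>M borel)"
      by (simp cong: measurable_cong_sets)
    from nn_integral_gauss_unitary2[OF u this]
    show "(\<integral>\<^sup>+y. \<integral>\<^sup>+z. F (givens a b c d p q (x(p := y, q := z))) \<partial>complex_gauss \<partial>complex_gauss) =
       (\<integral>\<^sup>+y. \<integral>\<^sup>+z. F (x(p := y, q := z)) \<partial>complex_gauss \<partial>complex_gauss)"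
      using I by (simp add: givens_def fun_upd_twist)
  qed
qed

text \<open>One 2 x 2 unitary applied to n pairs of coordinates in turn. The pairs (p, l), (q, l)
  give an operation on two matrix rows, the pairs (i, p), (i, q) one on two columns.\<close>

fun multi_givens where
  "multi_givens a b c d e1 e2 0 x = x"
| "multi_givens a b c d e1 e2 (Suc n) x = givens a b c d (e1 n) (e2 n) (multi_givens a b c d e1 e2 n x)"

lemma measurable_multi_givens:
  assumes "\<And>j. j < n \<Longrightarrow> e1 j \<in> I" "\<And>j. j < n \<Longrightarrow> e2 j \<in> I"
  shows "multi_givens a b c d e1 e2 n \<in> measurable (gauss_PiM I) (gauss_PiM I)"
  using assms
proof (induction n)
  case (Suc n)
  have "multi_givens a b c d e1 e2 n \<in> measurable (gauss_PiM I) (gauss_PiM I)" using Suc by simp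
  from measurable_compose[OF this measurable_givens] Suc.prems show ?case by simp
next
  case 0
  have "multi_givens a b c d e1 e2 0 = (\<lambda>x. x)" by auto
  then show ?case by simp
qed

lemma nn_integral_multi_givens:
  assumes u: "unitary2 a b c d" and I: "finite I" "\<And>j. j < n \<Longrightarrow> e1 j \<in> I" "\<And>j. j < n \<Longrightarrow> e2 j \<in> I"
      "\<And>j. j < n \<Longrightarrow> e1 j \<noteq> e2 j"
    and F: "F \<in> borel_measurable (gauss_PiM I)"
  shows "(\<integral>\<^sup>+x. F (multi_givens a b c d e1 e2 n x) \<partial>gauss_PiM I) = (\<integral>\<^sup>+x. F x \<partial>gauss_PiM I)"
  using I F
proof (induction n arbitrary: F)
  case (Suc n)
  have "(\<integral>\<^sup>+x. F (multi_givens a b c d e1 e2 (Suc n) x) \<partial>gauss_PiM I) = (\<integral>\<^sup>+x. F (givens a b c d (e1 n) (e2 n) x) \<partial>gauss_PiM I)"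
    unfolding multi_givens.simps
    by (rule Suc.IH) (use Suc.prems in \<open>auto intro!: measurable_compose[OF measurable_givens]\<close>)
  also have "\<dots> = (\<integral>\<^sup>+x. F x \<partial>gauss_PiM I)"
    using Suc.prems by (intro nn_integral_givens u) auto
  finally show ?case .
qed simp

section \<open>Removing the last column of a shifted Gaussian matrix\<close>

lemma borel_measurable_det:
  fixes f :: "'a \<Rightarrow> nat \<Rightarrow> nat \<Rightarrow> complex"
  assumes f: "\<And>i j. i < n \<Longrightarrow> j < n \<Longrightarrow> (\<lambda>x. f x i j) \<in> borel_measurable M"
  shows "(\<lambda>x. det (mat n n (\<lambda>(i, j). f x i j))) \<in> borel_measurable M"
proof -
  have "(\<lambda>x. \<Sum>p\<in>{p. p permutes {0..<n}}. signof p * (\<Prod>i=0..<n. f x i (p i))) \<in> borel_measurable M"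
    by (intro borel_measurable_sum borel_measurable_times borel_measurable_const borel_measurable_prod f)
       (auto dest: permutes_in_image)
  moreover have "det (mat n n (\<lambda>(i, j). f x i j)) = (\<Sum>p\<in>{p. p permutes {0..<n}}. signof p * (\<Prod>i=0..<n. f x i (p i)))" for x
    by (subst det_def'[of _ n]) (auto intro!: sum.cong prod.cong arg_cong2[where f = "(*)"] dest: permutes_in_image)
  ultimately show ?thesis by simp
qed

lemma sum_two_points:
  fixes f :: "nat \<Rightarrow> 'a::comm_ring_1"
  assumes "p < N" "q < N" "p \<noteq> q"
  shows "(\<Sum>k\<in>{0..<N}. (if k = p then x else if k = q then y else 0) * f k) = x * f p + y * f q"
proof -
  have "(\<Sum>k\<in>{0..<N}. (if k = p then x else if k = q then y else 0) * f k) = (\<Sum>k\<in>{p, q}. (if k = p then x else if k = q then y else 0) * f k)"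
    by (rule sum.mono_neutral_right) (use assms in auto)
  then show ?thesis using assms by simp
qed

text \<open>The row operation is left multiplication by a unitary matrix that is the identity
  outside rows p and q, and such a matrix has determinant of modulus 1.\<close>

lemma cmod_det_row_givens:
  fixes A :: "nat \<Rightarrow> nat \<Rightarrow> complex"
  assumes u: "unitary2 a b c d" and pq: "p < N" "q < N" "p \<noteq> q"
  shows "cmod (det (mat N N (\<lambda>(i, j). if i = p then a * A p j + b * A q j else if i = q then c * A p j + d * A q j else A i j)))
    = cmod (det (mat N N (\<lambda>(i, j). A i j)))"
proof -
  define r where "r i j = (if i = p then (if j = p then a else if j = q then b else 0)
      else if i = q then (if j = p then c else if j = q then d else 0) else if j = i then 1 else 0)" for i j
  define U where "U = mat N N (\<lambda>(i, j). r i j)"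
  have U: "U \<in> carrier_mat N N" by (simp add: U_def)
  have row: "(\<Sum>k\<in>{0..<N}. r i k * f k) = (if i = p then a * f p + b * f q else if i = q then c * f p + d * f q else f i)"
    if "i < N" for i and f :: "nat \<Rightarrow> complex"
  proof -
    consider "i = p" | "i = q" "i \<noteq> p" | "i \<noteq> p" "i \<noteq> q" by blast
    then show ?thesis
    proof cases
      case 3
      have "(\<Sum>k\<in>{0..<N}. r i k * f k) = (\<Sum>k\<in>{0..<N}. if k = i then f k else 0)"
        by (rule sum.cong) (use 3 in \<open>auto simp: r_def\<close>)
      then show ?thesis using 3 that by simp
    qed (use sum_two_points[OF pq, of _ _ f] pq in \<open>auto simp: r_def\<close>)
  qed
  interpret cn: comm_ring_hom cnj by unfold_locales auto
  have "U * transpose_mat (map_mat cnj U) = 1\<^sub>m N"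
  proof (rule eq_matI)
    fix i j assume "i < dim_row (1\<^sub>m N :: complex mat)" "j < dim_col (1\<^sub>m N :: complex mat)"
    then have ij: "i < N" "j < N" by auto
    then have "(U * transpose_mat (map_mat cnj U)) $$ (i, j) = (\<Sum>k\<in>{0..<N}. r i k * cnj (r j k))"
      by (simp add: U_def scalar_prod_def)
    also have "\<dots> = (if i = j then 1 else 0)"
      using u pq unfolding row[OF ij(1), of "\<lambda>k. cnj (r j k)"] unfolding unitary2_def r_def
      by (auto simp: algebra_simps dest: arg_cong[where f = cnj])
    finally show "(U * transpose_mat (map_mat cnj U)) $$ (i, j) = 1\<^sub>m N $$ (i, j)" using ij by simp
  qed (auto simp: U_def)
  then have "det U * cnj (det U) = 1"
    using det_mult[OF U, of "transpose_mat (map_mat cnj U)"] U det_transpose[of "map_mat cnj U" N] by simp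
  then have "cmod (det U * cnj (det U)) = 1" by simp
  then have detU: "cmod (det U) = 1" by (simp add: norm_mult) (metis abs_norm_cancel abs_square_eq_1 power2_eq_square)
  have "mat N N (\<lambda>(i, j). if i = p then a * A p j + b * A q j else if i = q then c * A p j + d * A q j else A i j)
     = U * mat N N (\<lambda>(i, j). A i j)"
    by (rule eq_matI) (auto simp: U_def scalar_prod_def row)
  then show ?thesis using det_mult[OF U, of "mat N N (\<lambda>(i, j). A i j)"] detU by (simp add: norm_mult)
qed

lemma cmod_det_col_givens:
  fixes A :: "nat \<Rightarrow> nat \<Rightarrow> complex"
  assumes u: "unitary2 a b c d" and pq: "p < N" "q < N" "p \<noteq> q"
  shows "cmod (det (mat N N (\<lambda>(i, j). if j = p then a * A i p + b * A i q else if j = q then c * A i p + d * A i q else A i j)))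
    = cmod (det (mat N N (\<lambda>(i, j). A i j)))"
proof -
  have tr: "det (mat N N (\<lambda>(i, j). f i j)) = det (mat N N (\<lambda>(i, j). f j i))" for f :: "nat \<Rightarrow> nat \<Rightarrow> complex"
  proof -
    have "transpose_mat (mat N N (\<lambda>(i, j). f j i)) = mat N N (\<lambda>(i, j). f i j)" by (rule eq_matI) auto
    then show ?thesis using det_transpose[of "mat N N (\<lambda>(i, j). f j i)" N] by simp
  qed
  show ?thesis
    using cmod_det_row_givens[OF u pq, of "\<lambda>i j. A j i"] tr[of A]
      tr[of "\<lambda>i j. if j = p then a * A i p + b * A i q else if j = q then c * A i p + d * A i q else A i j"] by simp
qed

lemma multi_givens_rows:
  assumes "p \<noteq> q"
  shows "multi_givens a b c d (\<lambda>l. (p, l)) (\<lambda>l. (q, l)) n Y (i, l) =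
    (if l < n then (if i = p then a * Y (p, l) + b * Y (q, l) else if i = q then c * Y (p, l) + d * Y (q, l) else Y (i, l)) else Y (i, l))"
  by (induction n arbitrary: i l) (use assms in \<open>auto simp: givens_def less_Suc_eq\<close>)

lemma multi_givens_cols:
  assumes "p \<noteq> q"
  shows "multi_givens a b c d (\<lambda>i. (i, p)) (\<lambda>i. (i, q)) n Y (i, l) =
    (if i < n then (if l = p then a * Y (i, p) + b * Y (i, q) else if l = q then c * Y (i, p) + d * Y (i, q) else Y (i, l)) else Y (i, l))"
  by (induction n arbitrary: i l) (use assms in \<open>auto simp: givens_def less_Suc_eq\<close>)

section \<open>Moments of determinants with a frozen last column\<close>

text \<open>The last column is the fixed vector \<open>c\<close>, any shift of its diagonal entry
  included; the first M columns are random and shifted by w.\<close>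

definition bordered :: "nat \<Rightarrow> complex \<Rightarrow> (nat \<Rightarrow> complex) \<Rightarrow> (nat \<times> nat \<Rightarrow> complex) \<Rightarrow> complex mat" where
  "bordered M w c Y = mat (Suc M) (Suc M) (\<lambda>(i, j). if j = M then c i else Y (i, j) - (if i = j then w else 0))"

text \<open>Note the size M + 1: the exceptional diagonal entry has index M, and v = 1 is the scalar
  shift.\<close>

definition shifted :: "nat \<Rightarrow> complex \<Rightarrow> real \<Rightarrow> (nat \<times> nat \<Rightarrow> complex) \<Rightarrow> complex mat" where
  "shifted M w v G = mat (Suc M) (Suc M) (\<lambda>(i, j). G (i, j) - (if i = j then (if i = M then w * of_real v else w) else 0))"

text \<open>The exponent 2 a is \<gamma>. Working in \<open>ennreal\<close> postpones integrability
  until finiteness comes out of the recursion.\<close>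

definition bordered_moment :: "nat \<Rightarrow> complex \<Rightarrow> real \<Rightarrow> (nat \<Rightarrow> complex) \<Rightarrow> ennreal" where
  "bordered_moment M w a c = (\<integral>\<^sup>+Y. ennreal (cmod (det (bordered M w c Y)) powr (2 * a)) \<partial>gauss_PiM ({..<Suc M} \<times> {..<M}))"

definition shifted_moment :: "nat \<Rightarrow> complex \<Rightarrow> real \<Rightarrow> real \<Rightarrow> ennreal" where
  "shifted_moment M w a v = (\<integral>\<^sup>+G. ennreal (cmod (det (shifted M w v G)) powr (2 * a)) \<partial>gauss_PiM ({..<Suc M} \<times> {..<Suc M}))"

lemma borel_measurable_gauss_component:
  "k \<in> I \<Longrightarrow> (\<lambda>x. x k) \<in> borel_measurable (gauss_PiM I)"
  using measurable_component_singleton[of k I "\<lambda>_. complex_gauss"] by (simp cong: measurable_cong_sets)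

lemma borel_measurable_bordered:
  "(\<lambda>Y. ennreal (cmod (det (bordered M w c Y)) powr (2 * a))) \<in> borel_measurable (gauss_PiM ({..<Suc M} \<times> {..<M}))"
proof -
  have "(\<lambda>Y. det (bordered M w c Y)) \<in> borel_measurable (gauss_PiM ({..<Suc M} \<times> {..<M}))"
    unfolding bordered_def
  proof (rule borel_measurable_det)
    fix i j assume "i < Suc M" "j < Suc M"
    then show "(\<lambda>Y. if j = M then c i else Y (i, j) - (if i = j then w else 0)) \<in> borel_measurable (gauss_PiM ({..<Suc M} \<times> {..<M}))"
      by (cases "j = M") (auto intro!: borel_measurable_diff borel_measurable_gauss_component)
  qed
  then show ?thesis by measurable
qed

lemma borel_measurable_shifted:
  "(\<lambda>(v, G). ennreal (cmod (det (shifted M w v G)) powr (2 * a))) \<in> borel_measurable (borel \<Otimes>\<^sub>M gauss_PiM ({..<Suc M} \<times> {..<Suc M}))"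
proof -
  have "(\<lambda>p. det (shifted M w (fst p) (snd p))) \<in> borel_measurable (borel \<Otimes>\<^sub>M gauss_PiM ({..<Suc M} \<times> {..<Suc M}))"
    unfolding shifted_def
    by (rule borel_measurable_det)
       (auto intro!: borel_measurable_diff measurable_compose[OF measurable_snd borel_measurable_gauss_component])
  then show ?thesis unfolding case_prod_beta by measurable
qed

lemma borel_measurable_shifted_moment [measurable]: "shifted_moment M w a \<in> borel_measurable borel"
  unfolding shifted_moment_def [abs_def]
  by (intro sigma_finite_measure.borel_measurable_nn_integral borel_measurable_shifted prob_space_imp_sigma_finite gauss_prod.P.prob_space_axioms)

lemma unitary2_cnj: "unitary2 a b c d \<Longrightarrow> unitary2 (cnj a) (cnj b) (cnj c) (cnj d)"
  unfolding unitary2_def by (metis complex_cnj_add complex_cnj_cnj complex_cnj_mult complex_cnj_one complex_cnj_zero)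

text \<open>Conjugating by a unitary of the first \<open>M\<close> coordinates fixes the scalar shift and the law of \<open>Y\<close>,
  but rotates the last column.\<close>

lemma bordered_moment_conj:
  assumes u: "unitary2 a b c d" and pq: "p < M" "q < M" "p \<noteq> q"
  shows "bordered_moment M w \<alpha> (givens a b c d p q x) = bordered_moment M w \<alpha> x"
proof -
  let ?I = "{..<Suc M} \<times> {..<M}"
  define R where "R = multi_givens a b c d (\<lambda>l. (p, l)) (\<lambda>l. (q, l)) M"
  define C where "C = multi_givens (cnj a) (cnj b) (cnj c) (cnj d) (\<lambda>i. (i, p)) (\<lambda>i. (i, q)) (Suc M)"
  define f where "f x' Y = ennreal (cmod (det (bordered M w x' Y)) powr (2 * \<alpha>))" for x' Y
  have f: "f x' \<in> borel_measurable (gauss_PiM ?I)" for x' unfolding f_def by (rule borel_measurable_bordered)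
  have C: "C \<in> measurable (gauss_PiM ?I) (gauss_PiM ?I)" unfolding C_def
    by (rule measurable_multi_givens) (use pq in auto)
  have "f (givens a b c d p q x) (R (C Y)) = f x Y" for Y
  proof -
    define A where "A i j = (if j = M then x i else Y (i, j) - (if i = j then w else 0))" for i j
    define A1 where "A1 i j = (if j = p then cnj a * A i p + cnj b * A i q else if j = q then cnj c * A i p + cnj d * A i q else A i j)" for i j
    define A2 where "A2 i j = (if i = p then a * A1 p j + b * A1 q j else if i = q then c * A1 p j + d * A1 q j else A1 i j)" for i j
    have 1: "cmod (det (mat (Suc M) (Suc M) (\<lambda>(i, j). A1 i j))) = cmod (det (mat (Suc M) (Suc M) (\<lambda>(i, j). A i j)))"
      unfolding A1_def using pq by (intro cmod_det_col_givens unitary2_cnj u) auto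
    have 2: "cmod (det (mat (Suc M) (Suc M) (\<lambda>(i, j). A2 i j))) = cmod (det (mat (Suc M) (Suc M) (\<lambda>(i, j). A1 i j)))"
      unfolding A2_def using pq by (intro cmod_det_row_givens u) auto
    note u' = u[unfolded unitary2_def]
    have uc: "c * cnj a + d * cnj b = 0"
      using arg_cong[OF u'[THEN conjunct2, THEN conjunct2, THEN conjunct1], of cnj] by (simp add: mult.commute)
    \<comment> \<open>The entries of w U U^H in the rotated plane: the scalar shift is
      restored.\<close>
    have w1: "w * (a * cnj a + b * cnj b) = w" "w * (c * cnj c + d * cnj d) = w" "w * (a * cnj c + b * cnj d) = 0"
        "w * (c * cnj a + d * cnj b) = 0"
      using u' uc by auto
    have "A2 i j = (if j = M then givens a b c d p q x i else R (C Y) (i, j) - (if i = j then w else 0))" if "i < Suc M" "j < Suc M" for i j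
      using pq that w1
      unfolding A2_def A1_def A_def R_def C_def multi_givens_rows[OF pq(3)] multi_givens_cols[OF pq(3)] givens_def
      by (auto simp: algebra_simps)
    then have "bordered M w (givens a b c d p q x) (R (C Y)) = mat (Suc M) (Suc M) (\<lambda>(i, j). A2 i j)"
      unfolding bordered_def by (intro eq_matI) auto
    moreover have "bordered M w x Y = mat (Suc M) (Suc M) (\<lambda>(i, j). A i j)"
      unfolding bordered_def by (intro eq_matI) (auto simp: A_def)
    ultimately show ?thesis using 1 2 by (simp add: f_def)
  qed
  then have "bordered_moment M w \<alpha> x = (\<integral>\<^sup>+Y. f (givens a b c d p q x) (R (C Y)) \<partial>gauss_PiM ?I)"
    by (simp add: bordered_moment_def f_def)
  also have "\<dots> = (\<integral>\<^sup>+Y. f (givens a b c d p q x) (R Y) \<partial>gauss_PiM ?I)"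
    unfolding C_def
  proof (rule nn_integral_multi_givens[OF unitary2_cnj[OF u], where F = "\<lambda>Y. f (givens a b c d p q x) (R Y)"])
    have "R \<in> measurable (gauss_PiM ?I) (gauss_PiM ?I)" unfolding R_def
      by (rule measurable_multi_givens) (use pq in auto)
    from measurable_compose[OF this f]
    show "(\<lambda>Y. f (givens a b c d p q x) (R Y)) \<in> borel_measurable (gauss_PiM ?I)" .
  qed (use pq in auto)
  also have "\<dots> = (\<integral>\<^sup>+Y. f (givens a b c d p q x) Y \<partial>gauss_PiM ?I)"
    unfolding R_def by (rule nn_integral_multi_givens[OF u _ _ _ _ f]) (use pq in auto)
  finally show ?thesis by (simp add: bordered_moment_def f_def)
qed

lemma unitary2_divide:
  fixes r :: real
  assumes "r \<noteq> 0"
    and "a * cnj a + b * cnj b = complex_of_real (r\<^sup>2)" "c * cnj c + d * cnj d = complex_of_real (r\<^sup>2)" "a * cnj c + b * cnj d = 0"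
    and "a * cnj a + c * cnj c = complex_of_real (r\<^sup>2)" "b * cnj b + d * cnj d = complex_of_real (r\<^sup>2)" "a * cnj b + c * cnj d = 0"
  shows "unitary2 (a / of_real r) (b / of_real r) (c / of_real r) (d / of_real r)"
proof -
  have *: "x / of_real r * cnj (y / of_real r) + z / of_real r * cnj (u / of_real r) = (x * cnj y + z * cnj u) / of_real (r\<^sup>2)" for x y z u
    by (simp add: power2_eq_square add_divide_distrib)
  show ?thesis unfolding unitary2_def * using assms by simp
qed

text \<open>Rotations in the planes (j, m), j < k, push the weight of these entries into entry m.
  They conjugate only among the first m + 1 indices, so the moment, the last entry and the norm of
  the rest are unchanged.\<close>

lemma bordered_moment_elim:
  assumes "k \<le> m"
  shows "\<exists>c'. bordered_moment (Suc m) w \<alpha> c = bordered_moment (Suc m) w \<alpha> c' \<and> c' (Suc m) = c (Suc m) \<and>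
     (\<forall>j<k. c' j = 0) \<and> (\<Sum>j<Suc m. (cmod (c' j))\<^sup>2) = (\<Sum>j<Suc m. (cmod (c j))\<^sup>2)"
  using assms
proof (induction k)
  case 0
  then show ?case by blast
next
  case (Suc k)
  then obtain x where x: "bordered_moment (Suc m) w \<alpha> c = bordered_moment (Suc m) w \<alpha> x" "x (Suc m) = c (Suc m)"
     "\<And>j. j < k \<Longrightarrow> x j = 0" "(\<Sum>j<Suc m. (cmod (x j))\<^sup>2) = (\<Sum>j<Suc m. (cmod (c j))\<^sup>2)" by auto
  define r where "r = sqrt ((cmod (x k))\<^sup>2 + (cmod (x m))\<^sup>2)"
  show ?case
  proof (cases "r = 0")
    case True
    then have "x k = 0" by (simp add: r_def sum_power2_eq_zero_iff)
    then show ?thesis using x by (intro exI[of _ x]) (auto simp: less_Suc_eq)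
  next
    case False
    \<comment> \<open>Chosen so that \<open>a * x k + b * x m = 0\<close>; entry m becomes
      r.\<close>
    define a b c' d where "a = x m / of_real r" and "b = - x k / of_real r"
      and "c' = cnj (x k) / of_real r" and "d = cnj (x m) / of_real r"
    have r2: "complex_of_real (r\<^sup>2) = x k * cnj (x k) + x m * cnj (x m)"
      unfolding r_def by (simp add: complex_norm_square del: of_real_power)
    have u: "unitary2 a b c' d"
      unfolding a_def b_def c'_def d_def
      by (rule unitary2_divide[OF False]) (simp_all add: r2 mult_ac add_ac del: of_real_power)
    define y where "y = givens a b c' d k m x"
    have "bordered_moment (Suc m) w \<alpha> y = bordered_moment (Suc m) w \<alpha> x"
      unfolding y_def using Suc.prems by (intro bordered_moment_conj u) auto
    moreover have "y k = 0" using Suc.prems by (simp add: y_def givens_def a_def b_def)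
    moreover have "y j = x j" if "j \<noteq> k" "j \<noteq> m" for j using that by (simp add: y_def givens_def)
    moreover have "(\<Sum>j<Suc m. (cmod (y j))\<^sup>2) = (\<Sum>j<Suc m. (cmod (x j))\<^sup>2)"
    proof -
      have split: "(\<Sum>j<Suc m. f j) = f k + f m + (\<Sum>j\<in>{..<m} - {k}. f j)" for f :: "nat \<Rightarrow> real"
        using Suc.prems by (simp add: sum.remove[of "{..<m}" k])
      have "y k = a * x k + b * x m" "y m = c' * x k + d * x m"
        using Suc.prems by (auto simp: y_def givens_def)
      then show ?thesis unfolding split using unitary2_norm[OF u, of "x k" "x m"]
        by (simp add: y_def givens_def)
    qed
    ultimately show ?thesis using x Suc.prems by (intro exI[of _ y]) (auto simp: less_Suc_eq)
  qed
qed

lemma det_last_column: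
  fixes A :: "nat \<Rightarrow> nat \<Rightarrow> complex"
  assumes "\<And>i. i < M \<Longrightarrow> A i M = 0"
  shows "det (mat (Suc M) (Suc M) (\<lambda>(i, j). A i j)) = A M M * det (mat M M (\<lambda>(i, j). A i j))"
proof -
  let ?B = "mat (Suc M) (Suc M) (\<lambda>(i, j). A i j)"
  have "det ?B = (\<Sum>i<Suc M. ?B $$ (i, M) * cofactor ?B i M)"
    by (rule laplace_expansion_column) auto
  also have "\<dots> = A M M * cofactor ?B M M" using assms by simp
  also have "mat_delete ?B M M = mat M M (\<lambda>(i, j). A i j)"
    by (rule eq_matI) (auto simp: mat_delete_def)
  then have "cofactor ?B M M = det (mat M M (\<lambda>(i, j). A i j))" by (simp add: cofactor_def)
  finally show ?thesis .
qed

text \<open>The last rotation mixes rows m and m + 1 and has no compensating column rotation, as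
  column m + 1 is frozen. The shift in entry (m, m) is therefore multiplied by the cosine |c (Suc
  m)| / \<rho>, which is the origin of v. Expansion along the last column, now a single entry
  \<rho>, removes one dimension.\<close>

lemma bordered_moment_reduced:
  assumes c0: "\<And>j. j < m \<Longrightarrow> c j = 0"
  defines "\<rho> \<equiv> sqrt ((cmod (c m))\<^sup>2 + (cmod (c (Suc m)))\<^sup>2)"
  shows "bordered_moment (Suc m) w \<alpha> c = ennreal (\<rho> powr (2 * \<alpha>)) * shifted_moment m w \<alpha> (cmod (c (Suc m)) / \<rho>)"
proof (cases "\<rho> = 0")
  case True
  \<comment> \<open>The whole column vanishes; both sides are 0, since \<open>0 powr x = 0\<close>
    for every exponent.\<close>
  then have "c m = 0" "c (Suc m) = 0" by (auto simp: \<rho>_def sum_power2_eq_zero_iff)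
  then have "c i = 0" if "i < Suc (Suc m)" for i using that c0 by (auto simp: less_Suc_eq)
  then have "det (bordered (Suc m) w c Y) = 0" for Y
    unfolding bordered_def by (subst det_last_column) auto
  then show ?thesis using True by (simp add: bordered_moment_def)
next
  case False
  let ?M = "Suc m"
  let ?I = "{..<Suc ?M} \<times> {..<?M}" and ?J = "{..<?M} \<times> {..<?M}"
  have \<rho>: "\<rho> > 0" using False by (simp add: \<rho>_def order_less_le)
  \<comment> \<open>The phase \<open>e\<close> turns the last entry into its modulus, so that the
    pivot \<open>a\<close>, hence the new v, is real.\<close>
  define e where "e = (if c ?M = 0 then 1 else cnj (c ?M) / of_real (cmod (c ?M)))"
  have e: "e * cnj e = 1" "e * c ?M = of_real (cmod (c ?M))"
  proof -
    have "c ?M * cnj (c ?M) = of_real (cmod (c ?M)) * of_real (cmod (c ?M))"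
      using complex_norm_square[of "c ?M"] by (simp add: power2_eq_square)
    then show "e * cnj e = 1" "e * c ?M = of_real (cmod (c ?M))" by (auto simp: e_def field_simps)
  qed
  define v where "v = cmod (c ?M) / \<rho>"
  define z where "z = complex_of_real (cmod (c ?M))"
  have z: "cnj z = z" by (simp add: z_def)
  define a b c' d where "a = z / of_real \<rho>" and "b = - (c m * e) / of_real \<rho>"
      and "c' = cnj (c m) / of_real \<rho>" and "d = e * z / of_real \<rho>"
  have "\<rho>\<^sup>2 = (cmod (c m))\<^sup>2 + (cmod (c ?M))\<^sup>2" by (simp add: \<rho>_def)
  then have "complex_of_real (\<rho>\<^sup>2) = complex_of_real ((cmod (c m))\<^sup>2) + complex_of_real ((cmod (c ?M))\<^sup>2)"
    by (simp only: of_real_add)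
  moreover have "complex_of_real ((cmod (c ?M))\<^sup>2) = z * z" by (simp add: z_def power2_eq_square)
  ultimately have r2: "complex_of_real (\<rho>\<^sup>2) = c m * cnj (c m) + z * z" by (simp only: complex_norm_square)
  have u: "unitary2 a b c' d"
  proof -
    have alg: "z * z + (x * y) * (x' * y') = x * x' + z * z" "x' * x + (y * z) * (y' * z) = x * x' + z * z"
      "z * x - (x * y) * (y' * z) = 0" "z * z + x' * x = x * x' + z * z" "(x * y) * (x' * y') + (y * z) * (y' * z) = x * x' + z * z"
      "x' * (y' * z) - z * (x' * y') = 0" if "y * y' = 1" for x x' y y' :: complex
    proof -
      have "(x * y) * (x' * y') = (y * y') * (x * x')" "(y * z) * (y' * z) = (y * y') * (z * z)"
        "(x * y) * (y' * z) = (y * y') * (z * x)" by (simp_all only: mult_ac)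
      then have *: "(x * y) * (x' * y') = x * x'" "(y * z) * (y' * z) = z * z" "(x * y) * (y' * z) = z * x"
        using that by simp_all
      show "z * z + (x * y) * (x' * y') = x * x' + z * z" "x' * x + (y * z) * (y' * z) = x * x' + z * z"
        "z * x - (x * y) * (y' * z) = 0" "z * z + x' * x = x * x' + z * z" "(x * y) * (x' * y') + (y * z) * (y' * z) = x * x' + z * z"
        "x' * (y' * z) - z * (x' * y') = 0"
        unfolding * by (simp_all only: mult_ac add_ac diff_self)
    qed
    show ?thesis
      unfolding a_def b_def c'_def d_def
      by (rule unitary2_divide[OF False]) (use alg(1-2,4-5)[OF e(1), where x = "c m" and x' = "cnj (c m)"] alg(3)[OF e(1), where x = "c m"]
          alg(6)[OF e(1), where x' = "cnj (c m)"] in \<open>simp_all add: r2 z del: of_real_power\<close>)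
  qed
  define R where "R = multi_givens a b c' d (\<lambda>l. (m, l)) (\<lambda>l. (?M, l)) ?M"
  have key: "cmod (det (bordered ?M w c Y)) = \<rho> * cmod (det (shifted m w v (R Y)))" for Y
  proof -
    define A where "A i j = (if j = ?M then c i else Y (i, j) - (if i = j then w else 0))" for i j
    define A2 where "A2 i j = (if i = m then a * A m j + b * A ?M j else if i = ?M then c' * A m j + d * A ?M j else A i j)" for i j
    have "bordered ?M w c Y = mat (Suc ?M) (Suc ?M) (\<lambda>(i, j). A i j)"
      unfolding bordered_def by (intro eq_matI) (auto simp: A_def)
    moreover have "cmod (det (mat (Suc ?M) (Suc ?M) (\<lambda>(i, j). A2 i j))) = cmod (det (mat (Suc ?M) (Suc ?M) (\<lambda>(i, j). A i j)))"
      unfolding A2_def by (intro cmod_det_row_givens u) auto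
    moreover have "det (mat (Suc ?M) (Suc ?M) (\<lambda>(i, j). A2 i j)) = A2 ?M ?M * det (mat ?M ?M (\<lambda>(i, j). A2 i j))"
    proof (rule det_last_column)
      fix i assume "i < ?M"
      then consider "i < m" | "i = m" by linarith
      then show "A2 i ?M = 0"
      proof cases
        case 2
        have "z * c m = c m * (e * c ?M)" by (simp add: e(2) z_def)
        then show ?thesis using 2 by (simp add: A2_def A_def a_def b_def mult_ac)
      qed (simp add: A2_def A_def c0)
    qed
    moreover have "A2 ?M ?M = of_real \<rho>"
    proof -
      have "A2 ?M ?M = (c m * cnj (c m) + (e * c ?M) * z) / of_real \<rho>"
        by (simp add: A2_def A_def c'_def d_def add_divide_distrib mult_ac)
      also have "\<dots> = complex_of_real (\<rho>\<^sup>2) / of_real \<rho>" unfolding e(2) r2 z_def ..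
      finally show ?thesis using False by (simp add: power2_eq_square)
    qed
    moreover have "mat ?M ?M (\<lambda>(i, j). A2 i j) = shifted m w v (R Y)"
      unfolding shifted_def
    proof (rule eq_matI)
      fix i j assume "i < dim_row (mat ?M ?M (\<lambda>(i, j). R Y (i, j) - (if i = j then if i = m then w * of_real v else w else 0)))"
        "j < dim_col (mat ?M ?M (\<lambda>(i, j). R Y (i, j) - (if i = j then if i = m then w * of_real v else w else 0)))"
      then have ij: "i < ?M" "j < ?M" by auto
      moreover have "a = of_real v" by (simp add: a_def v_def z_def)
      ultimately show "mat ?M ?M (\<lambda>(i, j). A2 i j) $$ (i, j) =
          mat ?M ?M (\<lambda>(i, j). R Y (i, j) - (if i = j then if i = m then w * of_real v else w else 0)) $$ (i, j)"
        using multi_givens_rows[of m ?M a b c' d ?M Y i j] by (auto simp: A2_def A_def R_def algebra_simps simp del: multi_givens.simps)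
    qed auto
    ultimately show ?thesis using \<rho> by (simp add: norm_mult)
  qed
  define g where "g G = ennreal (cmod (det (shifted m w v G)) powr (2 * \<alpha>))" for G
  have gJ: "g \<in> borel_measurable (gauss_PiM ?J)"
    using measurable_Pair2[OF borel_measurable_shifted, of v m w \<alpha>] by (simp add: g_def [abs_def])
  \<comment> \<open>After the expansion only the rows up to m occur, so the law may be replaced by
    its marginal on the square block.\<close>
  have res: "(\<lambda>Y. restrict Y ?J) \<in> measurable (gauss_PiM ?I) (gauss_PiM ?J)"
    by (rule measurable_restrict_subset) auto
  have g_res: "g (restrict Y ?J) = g Y" for Y
    unfolding g_def shifted_def by (intro arg_cong[where f = "\<lambda>A. ennreal (cmod (det A) powr (2 * \<alpha>))"] eq_matI) auto
  have gI: "g \<in> borel_measurable (gauss_PiM ?I)"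
    using measurable_compose[OF res gJ] by (simp add: g_res)
  have "bordered_moment ?M w \<alpha> c = (\<integral>\<^sup>+Y. ennreal (\<rho> powr (2 * \<alpha>)) * g (R Y) \<partial>gauss_PiM ?I)"
    unfolding bordered_moment_def key g_def using \<rho> by (simp add: powr_mult ennreal_mult)
  also have "\<dots> = (\<integral>\<^sup>+Y. ennreal (\<rho> powr (2 * \<alpha>)) * g Y \<partial>gauss_PiM ?I)"
    unfolding R_def by (rule nn_integral_multi_givens[OF u, where F = "\<lambda>Y. ennreal (\<rho> powr (2 * \<alpha>)) * g Y"]) (use gI in auto)
  also have "\<dots> = ennreal (\<rho> powr (2 * \<alpha>)) * (\<integral>\<^sup>+Y. g (restrict Y ?J) \<partial>gauss_PiM ?I)"
    unfolding g_res by (rule nn_integral_cmult[OF gI])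
  also have "(\<integral>\<^sup>+Y. g (restrict Y ?J) \<partial>gauss_PiM ?I) = (\<integral>\<^sup>+Y. g Y \<partial>distr (gauss_PiM ?I) (gauss_PiM ?J) (\<lambda>Y. restrict Y ?J))"
    by (rule nn_integral_distr[OF res, symmetric]) (use gJ in simp)
  also have "distr (gauss_PiM ?I) (gauss_PiM ?J) (\<lambda>Y. restrict Y ?J) = gauss_PiM ?J"
    by (rule gauss_prod.distr_PiM_restrict_finite) auto
  finally show ?thesis by (simp add: shifted_moment_def g_def v_def)
qed

text \<open>p is the squared modulus of the last entry of the column, \<beta> the squared norm of
  the others. At p + \<beta> = 0 the first factor is 0, in agreement with a vanishing
  determinant.\<close>

definition chain_kernel :: "nat \<Rightarrow> complex \<Rightarrow> real \<Rightarrow> real \<Rightarrow> real \<Rightarrow> ennreal" where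
  "chain_kernel m w \<alpha> p \<beta> = ennreal ((p + \<beta>) powr \<alpha>) * shifted_moment m w \<alpha> (sqrt (p / (p + \<beta>)))"

lemma borel_measurable_chain_kernel [measurable]:
  "(\<lambda>(p, \<beta>). chain_kernel m w \<alpha> p \<beta>) \<in> borel_measurable (borel \<Otimes>\<^sub>M borel)"
  unfolding chain_kernel_def by measurable

lemma bordered_moment_eq:
  "bordered_moment (Suc m) w \<alpha> c = chain_kernel m w \<alpha> ((cmod (c (Suc m)))\<^sup>2) (\<Sum>i<Suc m. (cmod (c i))\<^sup>2)"
proof -
  obtain x where x: "bordered_moment (Suc m) w \<alpha> c = bordered_moment (Suc m) w \<alpha> x" "x (Suc m) = c (Suc m)"
     "\<And>j. j < m \<Longrightarrow> x j = 0" "(\<Sum>j<Suc m. (cmod (x j))\<^sup>2) = (\<Sum>j<Suc m. (cmod (c j))\<^sup>2)"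
    using bordered_moment_elim[of m m w \<alpha> c] by auto
  let ?p = "(cmod (c (Suc m)))\<^sup>2" and ?\<beta> = "\<Sum>i<Suc m. (cmod (c i))\<^sup>2"
  have \<beta>: "?\<beta> = (cmod (x m))\<^sup>2" using x(3,4) by simp
  have nn: "?p + ?\<beta> \<ge> 0" by (intro add_nonneg_nonneg sum_nonneg) auto
  have "sqrt (?p + ?\<beta>) powr (2 * \<alpha>) = (?p + ?\<beta>) powr \<alpha>"
    using nn by (cases "?p + ?\<beta> = 0") (simp_all add: powr_half_sqrt[symmetric] powr_powr)
  moreover have "cmod (c (Suc m)) / sqrt (?p + ?\<beta>) = sqrt (?p / (?p + ?\<beta>))"
    by (simp add: real_sqrt_divide)
  ultimately show ?thesis
    using bordered_moment_reduced[of m x w \<alpha>] x(3) unfolding x(1) chain_kernel_def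
    by (simp add: x(2) \<beta>[symmetric] add.commute[of ?\<beta>] del: sum.lessThan_Suc)
qed

text \<open>The last column is independent of the others, so it can be integrated last. Its diagonal
  entry absorbs the shift w v; the M other entries are centred Gaussians.\<close>

lemma shifted_moment_Suc:
  fixes m :: nat
  defines "M \<equiv> Suc m"
  shows "shifted_moment M w \<alpha> v =
    (\<integral>\<^sup>+x. \<integral>\<^sup>+y. chain_kernel m w \<alpha> ((cmod (y - w * of_real v))\<^sup>2) (\<Sum>k\<in>{..<M} \<times> {M}. (cmod (x k))\<^sup>2) \<partial>complex_gauss \<partial>gauss_PiM ({..<M} \<times> {M}))"
proof -
  let ?I = "{..<Suc M} \<times> {M}" and ?J = "{..<Suc M} \<times> {..<M}" and ?K = "{..<M} \<times> {M}"
  have IJ: "{..<Suc M} \<times> {..<Suc M} = ?I \<union> ?J" by auto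
  have IK: "?I = insert (M, M) ?K" by auto
  define f where "f G = ennreal (cmod (det (shifted M w v G)) powr (2 * \<alpha>))" for G
  have "f \<in> borel_measurable (gauss_PiM ({..<Suc M} \<times> {..<Suc M}))"
    using measurable_Pair2[OF borel_measurable_shifted, of v M w \<alpha>] by (simp add: f_def [abs_def])
  then have f: "f \<in> borel_measurable (gauss_PiM (?I \<union> ?J))" unfolding IJ .
  define H where "H x = chain_kernel m w \<alpha> ((cmod (x (M, M) - w * of_real v))\<^sup>2) (\<Sum>k\<in>?K. (cmod (x k))\<^sup>2)" for x
  have H: "H \<in> borel_measurable (gauss_PiM (insert (M, M) ?K))"
  proof -
    have [measurable]: "(\<lambda>x. x k) \<in> borel_measurable (gauss_PiM (insert (M, M) ?K))" if "k \<in> insert (M, M) ?K" for k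
      using that by (rule borel_measurable_gauss_component)
    have "(\<lambda>x. ((cmod (x (M, M) - w * of_real v))\<^sup>2, \<Sum>k\<in>?K. (cmod (x k))\<^sup>2)) \<in> measurable (gauss_PiM (insert (M, M) ?K)) (borel \<Otimes>\<^sub>M borel)"
      by measurable
    from measurable_compose[OF this borel_measurable_chain_kernel] show ?thesis by (simp add: H_def [abs_def])
  qed
  have "shifted_moment M w \<alpha> v = (\<integral>\<^sup>+x. \<integral>\<^sup>+y. f (merge ?I ?J (x, y)) \<partial>gauss_PiM ?J \<partial>gauss_PiM ?I)"
    unfolding shifted_moment_def f_def[symmetric] IJ
    by (rule gauss_prod.product_nn_integral_fold) (use f in auto)
  also have "\<dots> = (\<integral>\<^sup>+x. H x \<partial>gauss_PiM ?I)"
  proof (rule nn_integral_cong)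
    fix x
    define c where "c i = x (i, M) - (if i = M then w * of_real v else 0)" for i
    have "shifted M w v (merge ?I ?J (x, y)) = bordered M w c y" for y
      unfolding shifted_def bordered_def by (intro eq_matI) (auto simp: c_def merge_def)
    then have "(\<integral>\<^sup>+y. f (merge ?I ?J (x, y)) \<partial>gauss_PiM ?J) = bordered_moment M w \<alpha> c"
      by (simp add: f_def bordered_moment_def)
    also have "\<dots> = chain_kernel m w \<alpha> ((cmod (c M))\<^sup>2) (\<Sum>i<M. (cmod (c i))\<^sup>2)"
      unfolding M_def by (rule bordered_moment_eq)
    also have "(\<Sum>i<M. (cmod (c i))\<^sup>2) = (\<Sum>k\<in>?K. (cmod (x k))\<^sup>2)"
      by (rule sum.reindex_bij_witness[of _ fst "\<lambda>i. (i, M)"]) (auto simp: c_def)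
    finally show "(\<integral>\<^sup>+y. f (merge ?I ?J (x, y)) \<partial>gauss_PiM ?J) = H x" by (simp add: H_def c_def)
  qed
  also have "\<dots> = (\<integral>\<^sup>+x. \<integral>\<^sup>+y. H (x((M, M) := y)) \<partial>complex_gauss \<partial>gauss_PiM ?K)"
    unfolding IK by (rule gauss_prod.product_nn_integral_insert) (use H in auto)
  also have "\<dots> = (\<integral>\<^sup>+x. \<integral>\<^sup>+y. chain_kernel m w \<alpha> ((cmod (y - w * of_real v))\<^sup>2) (\<Sum>k\<in>?K. (cmod (x k))\<^sup>2) \<partial>complex_gauss \<partial>gauss_PiM ?K)"
    unfolding H_def by (intro nn_integral_cong arg_cong2[where f = "chain_kernel m w \<alpha>"] sum.cong) auto
  finally show ?thesis .
qed

section \<open>Radial laws\<close>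

lemma continuous_on_cis [continuous_intros]: "continuous_on S f \<Longrightarrow> continuous_on S (\<lambda>x. cis (f x))"
  unfolding cis_conv_exp by (intro continuous_intros)

text \<open>Termwise integration of the exponential series. Since \<open>cis\<close> has modulus 1,
  integrability of c suffices, which covers the symbol with its possible singularities at the end
  points.\<close>

lemma exp_cis_integral_series:
  fixes c :: "real \<Rightarrow> complex" and z :: complex
  assumes c: "set_integrable lborel {-pi..pi} c"
  shows "(\<lambda>n. z ^ n / fact n * (LINT x:{-pi..pi}|lborel. c x * cis (real n * x))) sums
     (LINT x:{-pi..pi}|lborel. c x * exp (z * cis x))"
proof -
  define g where "g x = indicator {-pi..pi} x *\<^sub>R c x" for x
  define f where "f n x = g x * (z ^ n / fact n * cis (real n * x))" for n x
  have g: "integrable lborel g" using c by (simp add: g_def [abs_def] set_integrable_def)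
  have [measurable]: "(\<lambda>x. cis (real n * x)) \<in> borel_measurable borel" for n
    by (intro borel_measurable_continuous_onI continuous_intros)
  have g_meas[measurable]: "g \<in> borel_measurable lborel" using g by auto
  have bnd: "norm (f n x) = norm (z ^ n / fact n) * norm (g x)" for n x by (simp add: f_def norm_mult norm_divide)
  have int: "integrable lborel (f n)" for n
  proof (rule Bochner_Integration.integrable_bound)
    show "integrable lborel (\<lambda>x. norm (z ^ n / fact n) * norm (g x))" using g by (intro integrable_mult_right integrable_norm)
    show "f n \<in> borel_measurable lborel" unfolding f_def [abs_def] by measurable
  qed (simp add: bnd)
  have norm_z: "summable (\<lambda>n. norm (z ^ n / fact n))"
    using summable_norm_exp[of z] by (simp add: norm_mult norm_divide norm_inverse norm_power divide_inverse mult.commute)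
  have "(\<lambda>n. integral\<^sup>L lborel (f n)) sums (\<integral>x. (\<Sum>n. f n x) \<partial>lborel)"
  proof (rule sums_integral[OF int])
    show "AE x in lborel. summable (\<lambda>n. norm (f n x))"
      unfolding bnd by (intro AE_I2 summable_mult2 norm_z)
    show "summable (\<lambda>n. \<integral>x. norm (f n x) \<partial>lborel)"
      unfolding bnd by (simp add: summable_mult2[OF norm_z] del: norm_divide norm_power)
  qed
  moreover have "(\<Sum>n. f n x) = indicator {-pi..pi} x *\<^sub>R (c x * exp (z * cis x))" for x
  proof -
    have "(\<lambda>n. (z * cis x) ^ n /\<^sub>R fact n) sums exp (z * cis x)" by (rule exp_converges)
    moreover have "f n x = g x * ((z * cis x) ^ n /\<^sub>R fact n)" for n
      unfolding f_def Complex.DeMoivre[symmetric] by (simp add: power_mult_distrib scaleR_conv_of_real divide_inverse mult_ac)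
    ultimately have "(\<lambda>n. f n x) sums (g x * exp (z * cis x))" by (simp only: sums_mult)
    then show ?thesis by (simp add: sums_iff g_def)
  qed
  moreover have "integral\<^sup>L lborel (f n) = z ^ n / fact n * (LINT x:{-pi..pi}|lborel. c x * cis (real n * x))" for n
  proof -
    have "f n = (\<lambda>x. z ^ n / fact n * (indicator {-pi..pi} x *\<^sub>R (c x * cis (real n * x))))"
      by (auto simp: f_def g_def fun_eq_iff scaleR_conv_of_real)
    then show ?thesis by (simp only: set_lebesgue_integral_def Bochner_Integration.integral_mult_right_zero)
  qed
  ultimately show ?thesis by (simp add: set_lebesgue_integral_def)
qed

lemma set_integrable_continuous_Icc:
  fixes f :: "real \<Rightarrow> complex"
  shows "continuous_on {-pi..pi} f \<Longrightarrow> set_integrable lborel {-pi..pi} f"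
  unfolding set_integrable_def using borel_integrable_atLeastAtMost'[of "-pi" pi f] by (simp add: set_integrable_def)

lemma integral_cis_int:
  fixes k :: int
  shows "(LINT x:{-pi..pi}|lborel. cis (of_int k * x)) = (if k = 0 then of_real (2 * pi) else 0)"
proof (cases "k = 0")
  case True
  then show ?thesis by (simp add: set_lebesgue_integral_def scaleR_conv_of_real)
next
  case False
  define F where "F x = cis (of_int k * x) / (\<i> * of_int k)" for x
  have "(F has_vector_derivative cis (of_int k * x)) (at x within {-pi..pi})" for x
  proof -
    have "((\<lambda>w. exp (\<i> * of_int k * w) / (\<i> * of_int k)) has_field_derivative exp (\<i> * of_int k * of_real x)) (at (of_real x))"
      using False by (auto intro!: derivative_eq_intros)
    from has_vector_derivative_real_field[OF this]
    have "((\<lambda>x. exp (\<i> * of_int k * of_real x) / (\<i> * of_int k)) has_vector_derivative exp (\<i> * of_int k * of_real x)) (at x within {-pi..pi})" .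
    then show ?thesis by (simp add: F_def [abs_def] cis_conv_exp mult.assoc)
  qed
  then have "integral\<^sup>L lborel (\<lambda>x. indicator {-pi..pi} x *\<^sub>R cis (of_int k * x)) = F pi - F (- pi)"
    by (intro integral_FTC_atLeastAtMost continuous_intros) auto
  moreover have "cis (of_int k * pi) = cis (of_int k * (- pi))"
  proof -
    have "cis (of_int k * pi) = cis (of_int k * (- pi)) * cis (of_int k * (2 * pi))" by (simp add: cis_mult mult.commute)
    moreover have "cis (of_int k * (2 * pi)) = 1" by (metis Ints_of_int cis_multiple_2pi mult.commute)
    ultimately show ?thesis by simp
  qed
  ultimately show ?thesis using False by (simp add: set_lebesgue_integral_def F_def)
qed

text \<open>exp(2 Re u) is exp(u) times its conjugate, and orthogonality of the characters keeps the
  diagonal of the double series. The sum is 2 pi I_0(2 |z|).\<close>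

lemma integral_exp_two_Re_cis:
  fixes z :: complex
  shows "(\<lambda>n. 2 * pi * ((cmod z)\<^sup>2) ^ n / (fact n)\<^sup>2) sums (LINT x:{-pi..pi}|lborel. exp (2 * Re (z * cis x)))"
proof -
  have coeff: "(LINT x:{-pi..pi}|lborel. exp (cnj z * cis (- x)) * cis (real n * x)) = 2 * pi * cnj z ^ n / fact n" for n
  proof -
    have "(\<lambda>j. z ^ j / fact j * (LINT x:{-pi..pi}|lborel. cis (- real n * x) * cis (real j * x))) sums
       (LINT x:{-pi..pi}|lborel. cis (- real n * x) * exp (z * cis x))"
      by (intro exp_cis_integral_series set_integrable_continuous_Icc continuous_intros)
    moreover have "(LINT x:{-pi..pi}|lborel. cis (- real n * x) * cis (real j * x)) = (if j = n then of_real (2 * pi) else 0)" for j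
      using integral_cis_int[of "int j - int n"] by (simp add: cis_mult algebra_simps)
    ultimately have "(\<lambda>j. z ^ j / fact j * (if j = n then of_real (2 * pi) else 0)) sums
       (LINT x:{-pi..pi}|lborel. cis (- real n * x) * exp (z * cis x))" by simp
    moreover have "(\<lambda>j. z ^ j / fact j * (if j = n then of_real (2 * pi) else 0)) sums (z ^ n / fact n * of_real (2 * pi))"
      using sums_single[of n "\<lambda>j. z ^ j / fact j * of_real (2 * pi)"] by (simp add: if_distrib cong: if_cong)
    ultimately have "(LINT x:{-pi..pi}|lborel. cis (- real n * x) * exp (z * cis x)) = z ^ n / fact n * of_real (2 * pi)"
      by (rule sums_unique2)
    then have "cnj (LINT x:{-pi..pi}|lborel. cis (- real n * x) * exp (z * cis x)) = cnj (z ^ n / fact n * of_real (2 * pi))" by simp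
    moreover have "cnj (LINT x:{-pi..pi}|lborel. cis (- real n * x) * exp (z * cis x)) = (LINT x:{-pi..pi}|lborel. exp (cnj z * cis (- x)) * cis (real n * x))"
      unfolding set_lebesgue_integral_def by (subst Bochner_Integration.integral_cnj[symmetric]) (simp add: exp_cnj cis_cnj mult.commute)
    ultimately show ?thesis by (simp add: mult_ac)
  qed
  have "(\<lambda>n. z ^ n / fact n * (2 * pi * cnj z ^ n / fact n)) sums
     (LINT x:{-pi..pi}|lborel. exp (cnj z * cis (- x)) * exp (z * cis x))"
    unfolding coeff[symmetric]
    by (intro exp_cis_integral_series set_integrable_continuous_Icc continuous_intros)
  moreover have "exp (cnj z * cis (- x)) * exp (z * cis x) = complex_of_real (exp (2 * Re (z * cis x)))" for x
  proof -
    have "cnj z * cis (- x) + z * cis x = complex_of_real (2 * Re (z * cis x))"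
      by (simp add: complex_eq_iff)
    then show ?thesis by (simp only: mult_exp_exp exp_of_real)
  qed
  moreover have "(LINT x:{-pi..pi}|lborel. complex_of_real (exp (2 * Re (z * cis x)))) = of_real (LINT x:{-pi..pi}|lborel. exp (2 * Re (z * cis x)))"
    by (rule set_integral_complex_of_real)
  moreover have "z ^ n / fact n * (2 * pi * cnj z ^ n / fact n) = complex_of_real (2 * pi * ((cmod z)\<^sup>2) ^ n / (fact n)\<^sup>2)" for n
  proof -
    have "z ^ n * cnj z ^ n = complex_of_real (((cmod z)\<^sup>2) ^ n)"
      by (simp only: power_mult_distrib[symmetric] complex_norm_square[symmetric] of_real_power)
    then have "2 * pi * (z ^ n * cnj z ^ n) / (fact n)\<^sup>2 = complex_of_real (2 * pi * ((cmod z)\<^sup>2) ^ n / (fact n)\<^sup>2)"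
      by simp
    then show ?thesis by (simp add: power2_eq_square mult_ac)
  qed
  ultimately show ?thesis by (simp only: sums_of_real_iff)
qed

text \<open>The angular average of the density is a Bessel function.\<close>

lemma nn_integral_gauss_shift_radial:
  fixes \<omega> :: complex
  assumes [measurable]: "F \<in> borel_measurable borel"
  defines "s \<equiv> (cmod \<omega>)\<^sup>2"
  shows "(\<integral>\<^sup>+g. F ((cmod (g - \<omega>))\<^sup>2) \<partial>complex_gauss) =
    (\<Sum>n. ennreal (exp (- s) * s ^ n / (fact n)\<^sup>2) * (\<integral>\<^sup>+p. ennreal (p ^ n * exp (- p)) * F p * indicator {0..} p \<partial>lborel))"
proof -
  let ?I = "(\<integral>\<^sup>+g. F ((cmod (g - \<omega>))\<^sup>2) \<partial>complex_gauss)"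
  have [measurable]: "(\<lambda>x. cis x) \<in> borel_measurable borel"
    by (intro borel_measurable_continuous_onI continuous_intros)
  \<comment> \<open>Substituting g = cis x * c + \<omega> leaves |g - \<omega>| independent of the
    angle x, so that only the density is averaged below.\<close>
  have rot: "?I = (\<integral>\<^sup>+c. ennreal (exp (- (cmod (cis x * c + \<omega>))\<^sup>2) / pi) * F ((cmod c)\<^sup>2) \<partial>lborel)" for x
  proof -
    have "?I = (\<integral>\<^sup>+g. ennreal (exp (- (cmod g)\<^sup>2) / pi) * F ((cmod (g - \<omega>))\<^sup>2) \<partial>lborel)"
      by (subst nn_integral_complex_gauss) auto
    also have "\<dots> = ennreal (norm (cis x) ^ 2) * (\<integral>\<^sup>+c. ennreal (exp (- (cmod (cis x * c + \<omega>))\<^sup>2) / pi) * F ((cmod ((cis x * c + \<omega>) - \<omega>))\<^sup>2) \<partial>lborel)"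
      by (rule nn_integral_complex_affine) auto
    finally show ?thesis by (simp add: norm_mult)
  qed
  have angular: "(\<integral>\<^sup>+x. ennreal (exp (- (cmod (cis x * c + \<omega>))\<^sup>2) / pi) * indicator {-pi..pi} x \<partial>lborel)
      = (\<Sum>n. ennreal (2 * (exp (- s) * s ^ n / (fact n)\<^sup>2)) * ennreal (((cmod c)\<^sup>2) ^ n * exp (- (cmod c)\<^sup>2)))" for c
  proof -
    define z where "z = - c * cnj \<omega>"
    have zz: "(cmod z)\<^sup>2 = (cmod c)\<^sup>2 * s" by (simp add: z_def s_def norm_mult power_mult_distrib)
    have ex: "exp (- (cmod (cis x * c + \<omega>))\<^sup>2) / pi = exp (- (cmod c)\<^sup>2 - s) / pi * exp (2 * Re (z * cis x))" for x
    proof -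
      have "(cmod (cis x * c + \<omega>))\<^sup>2 = (cmod (cis x * c))\<^sup>2 + s + 2 * Re (cis x * c * cnj \<omega>)"
        unfolding s_def cmod_power2 by (simp add: power2_eq_square algebra_simps)
      also have "(cmod (cis x * c))\<^sup>2 = (cmod c)\<^sup>2" by (simp add: norm_mult)
      finally have "- (cmod (cis x * c + \<omega>))\<^sup>2 = (- (cmod c)\<^sup>2 - s) + 2 * Re (z * cis x)" by (simp add: z_def algebra_simps)
      then show ?thesis by (simp add: mult_exp_exp)
    qed
    let ?J = "LINT x:{-pi..pi}|lborel. exp (2 * Re (z * cis x))"
    have J: "(\<lambda>n. 2 * pi * ((cmod z)\<^sup>2) ^ n / (fact n)\<^sup>2) sums ?J" by (rule integral_exp_two_Re_cis)
    have int: "set_integrable lborel {-pi..pi} (\<lambda>x. exp (2 * Re (z * cis x)))"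
      unfolding set_integrable_def using borel_integrable_atLeastAtMost'[of "-pi" pi "\<lambda>x. exp (2 * Re (z * cis x))"]
      by (simp add: set_integrable_def continuous_intros)
    have "(\<integral>\<^sup>+x. ennreal (exp (- (cmod (cis x * c + \<omega>))\<^sup>2) / pi) * indicator {-pi..pi} x \<partial>lborel)
       = (\<integral>\<^sup>+x. ennreal (exp (- (cmod c)\<^sup>2 - s) / pi) * ennreal (indicator {-pi..pi} x *\<^sub>R exp (2 * Re (z * cis x))) \<partial>lborel)"
      unfolding ex by (intro nn_integral_cong) (auto simp: indicator_def simp flip: ennreal_mult)
    also have "\<dots> = ennreal (exp (- (cmod c)\<^sup>2 - s) / pi) * ennreal ?J"
      using int unfolding set_integrable_def set_lebesgue_integral_def
      by (subst nn_integral_cmult) (auto simp: nn_integral_eq_integral)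
    also have "\<dots> = ennreal (exp (- (cmod c)\<^sup>2 - s) / pi * ?J)"
      by (rule ennreal_mult'[symmetric]) simp
    also have "exp (- (cmod c)\<^sup>2 - s) / pi * ?J = (\<Sum>n. exp (- (cmod c)\<^sup>2 - s) / pi * (2 * pi * ((cmod z)\<^sup>2) ^ n / (fact n)\<^sup>2))"
      by (rule sums_unique[OF sums_mult[OF J]])
    also have "ennreal \<dots> = (\<Sum>n. ennreal (exp (- (cmod c)\<^sup>2 - s) / pi * (2 * pi * ((cmod z)\<^sup>2) ^ n / (fact n)\<^sup>2)))"
      using sums_mult[OF J, of "exp (- (cmod c)\<^sup>2 - s) / pi"] by (intro suminf_ennreal2[symmetric]) (auto simp: sums_iff)
    also have "\<dots> = (\<Sum>n. ennreal (2 * (exp (- s) * s ^ n / (fact n)\<^sup>2)) * ennreal (((cmod c)\<^sup>2) ^ n * exp (- (cmod c)\<^sup>2)))"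
    proof (intro suminf_cong)
      fix n
      have "exp (- (cmod c)\<^sup>2 - s) / pi * (2 * pi * ((cmod z)\<^sup>2) ^ n / (fact n)\<^sup>2) = (2 * (exp (- s) * s ^ n / (fact n)\<^sup>2)) * (((cmod c)\<^sup>2) ^ n * exp (- (cmod c)\<^sup>2))"
        unfolding zz by (simp add: power_mult_distrib exp_diff exp_minus field_simps)
      then show "ennreal (exp (- (cmod c)\<^sup>2 - s) / pi * (2 * pi * ((cmod z)\<^sup>2) ^ n / (fact n)\<^sup>2)) = ennreal (2 * (exp (- s) * s ^ n / (fact n)\<^sup>2)) * ennreal (((cmod c)\<^sup>2) ^ n * exp (- (cmod c)\<^sup>2))"
        by (simp add: ennreal_mult[symmetric] s_def)
    qed
    finally show ?thesis .
  qed
  \<comment> \<open>Integrating over a full turn multiplies by 2 pi. After exchange of integrals,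
    the law of |g - \<omega>|^2 appears as a Poisson(s) mixture of Gamma(n + 1) laws.\<close>
  have "ennreal (2 * pi) * ?I = (\<integral>\<^sup>+x. ?I * indicator {-pi..pi} x \<partial>lborel)"
    by (subst nn_integral_cmult) (auto simp: mult.commute)
  also have "\<dots> = (\<integral>\<^sup>+x. (\<integral>\<^sup>+c. ennreal (exp (- (cmod (cis x * c + \<omega>))\<^sup>2) / pi) * F ((cmod c)\<^sup>2) * indicator {-pi..pi} x \<partial>lborel) \<partial>lborel)"
  proof (rule nn_integral_cong)
    fix x :: real
    show "?I * indicator {-pi..pi} x = (\<integral>\<^sup>+c. ennreal (exp (- (cmod (cis x * c + \<omega>))\<^sup>2) / pi) * F ((cmod c)\<^sup>2) * indicator {-pi..pi} x \<partial>lborel)"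
      unfolding rot[of x] by (rule nn_integral_multc[symmetric]) measurable
  qed
  also have "\<dots> = (\<integral>\<^sup>+c. (\<integral>\<^sup>+x. ennreal (exp (- (cmod (cis x * c + \<omega>))\<^sup>2) / pi) * F ((cmod c)\<^sup>2) * indicator {-pi..pi} x \<partial>lborel) \<partial>lborel)"
    by (rule lborel_pair.Fubini') measurable
  also have "\<dots> = (\<integral>\<^sup>+c. (\<Sum>n. ennreal (2 * (exp (- s) * s ^ n / (fact n)\<^sup>2)) * (ennreal (((cmod c)\<^sup>2) ^ n * exp (- (cmod c)\<^sup>2)) * F ((cmod c)\<^sup>2))) \<partial>lborel)"
  proof (rule nn_integral_cong)
    fix c :: complex
    have "(\<integral>\<^sup>+x. ennreal (exp (- (cmod (cis x * c + \<omega>))\<^sup>2) / pi) * F ((cmod c)\<^sup>2) * indicator {-pi..pi} x \<partial>lborel)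
       = (\<integral>\<^sup>+x. ennreal (exp (- (cmod (cis x * c + \<omega>))\<^sup>2) / pi) * indicator {-pi..pi} x \<partial>lborel) * F ((cmod c)\<^sup>2)"
      by (subst nn_integral_multc[symmetric]) (auto intro!: nn_integral_cong simp: mult_ac)
    then show "(\<integral>\<^sup>+x. ennreal (exp (- (cmod (cis x * c + \<omega>))\<^sup>2) / pi) * F ((cmod c)\<^sup>2) * indicator {-pi..pi} x \<partial>lborel)
       = (\<Sum>n. ennreal (2 * (exp (- s) * s ^ n / (fact n)\<^sup>2)) * (ennreal (((cmod c)\<^sup>2) ^ n * exp (- (cmod c)\<^sup>2)) * F ((cmod c)\<^sup>2)))"
      unfolding angular ennreal_suminf_multc[symmetric] mult.assoc .
  qed
  also have "\<dots> = (\<Sum>n. ennreal (2 * (exp (- s) * s ^ n / (fact n)\<^sup>2)) * (\<integral>\<^sup>+c. ennreal (((cmod c)\<^sup>2) ^ n * exp (- (cmod (c::complex))\<^sup>2)) * F ((cmod c)\<^sup>2) \<partial>lborel))"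
    by (subst nn_integral_suminf) (auto intro!: suminf_cong nn_integral_cmult)
  also have "\<dots> = (\<Sum>n. ennreal (2 * pi) * (ennreal (exp (- s) * s ^ n / (fact n)\<^sup>2) * (\<integral>\<^sup>+p. ennreal (p ^ n * exp (- p)) * F p * indicator {0..} p \<partial>lborel)))"
  proof (rule suminf_cong)
    fix n
    have "(\<integral>\<^sup>+c. ennreal (((cmod c)\<^sup>2) ^ n * exp (- (cmod (c::complex))\<^sup>2)) * F ((cmod c)\<^sup>2) \<partial>lborel) =
       ennreal pi * (\<integral>\<^sup>+p. ennreal (p ^ n * exp (- p)) * F p * indicator {0..} p \<partial>lborel)"
      using nn_integral_complex_radial[of "\<lambda>p. ennreal (p ^ n * exp (- p)) * F p"] by simp
    moreover have "ennreal (2 * (exp (- s) * s ^ n / (fact n)\<^sup>2)) * ennreal pi = ennreal (2 * pi) * ennreal (exp (- s) * s ^ n / (fact n)\<^sup>2)"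
      by (simp add: s_def mult_ac flip: ennreal_mult)
    ultimately show "ennreal (2 * (exp (- s) * s ^ n / (fact n)\<^sup>2)) * (\<integral>\<^sup>+c. ennreal (((cmod c)\<^sup>2) ^ n * exp (- (cmod (c::complex))\<^sup>2)) * F ((cmod c)\<^sup>2) \<partial>lborel)
       = ennreal (2 * pi) * (ennreal (exp (- s) * s ^ n / (fact n)\<^sup>2) * (\<integral>\<^sup>+p. ennreal (p ^ n * exp (- p)) * F p * indicator {0..} p \<partial>lborel))"
      by (simp only: mult.assoc[symmetric])
  qed
  also have "\<dots> = ennreal (2 * pi) * (\<Sum>n. ennreal (exp (- s) * s ^ n / (fact n)\<^sup>2) * (\<integral>\<^sup>+p. ennreal (p ^ n * exp (- p)) * F p * indicator {0..} p \<partial>lborel))"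
    by (rule ennreal_suminf_cmult)
  finally show ?thesis by (simp add: ennreal_mult_cancel_left)
qed

text \<open>Substitution x = r u, y = r (1 - u) with Jacobian r, carried out one variable at a time:
  y = r - x for fixed x, and x = r u for fixed r.\<close>

lemma nn_integral_simplex:
  fixes G :: "real \<times> real \<Rightarrow> ennreal"
  assumes [measurable]: "G \<in> borel_measurable (borel \<Otimes>\<^sub>M borel)"
  shows "(\<integral>\<^sup>+y. (\<integral>\<^sup>+x. G (x, y) * indicator {0..} x \<partial>lborel) * indicator {0..} y \<partial>lborel) =
    (\<integral>\<^sup>+r. (\<integral>\<^sup>+u. ennreal r * G (r * u, r * (1 - u)) * indicator {0..1} u \<partial>lborel) * indicator {0..} r \<partial>lborel)"
proof -
  have "(\<integral>\<^sup>+y. (\<integral>\<^sup>+x. G (x, y) * indicator {0..} x \<partial>lborel) * indicator {0..} y \<partial>lborel) =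
     (\<integral>\<^sup>+y. (\<integral>\<^sup>+x. G (x, y) * indicator {0..} x * indicator {0..} y \<partial>lborel) \<partial>lborel)"
    by (intro nn_integral_cong nn_integral_multc[symmetric]) measurable
  also have "\<dots> = (\<integral>\<^sup>+x. (\<integral>\<^sup>+y. G (x, y) * indicator {0..} x * indicator {0..} y \<partial>lborel) \<partial>lborel)"
    by (rule lborel_pair.Fubini') measurable
  also have "\<dots> = (\<integral>\<^sup>+x. (\<integral>\<^sup>+r. G (x, r - x) * indicator {0..} x * indicator {0..} (r - x) \<partial>lborel) \<partial>lborel)"
  proof (rule nn_integral_cong)
    fix x :: real
    have "(\<integral>\<^sup>+y. G (x, y) * indicator {0..} x * indicator {0..} y \<partial>lborel) =
       ennreal \<bar>1\<bar> * (\<integral>\<^sup>+r. G (x, - x + 1 * r) * indicator {0..} x * indicator {0..} (- x + 1 * r) \<partial>lborel)"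
      by (rule nn_integral_real_affine) auto
    then show "(\<integral>\<^sup>+y. G (x, y) * indicator {0..} x * indicator {0..} y \<partial>lborel) =
      (\<integral>\<^sup>+r. G (x, r - x) * indicator {0..} x * indicator {0..} (r - x) \<partial>lborel)" by simp
  qed
  also have "\<dots> = (\<integral>\<^sup>+r. (\<integral>\<^sup>+x. G (x, r - x) * indicator {0..} x * indicator {0..} (r - x) \<partial>lborel) \<partial>lborel)"
    by (rule lborel_pair.Fubini'[symmetric]) measurable
  also have "\<dots> = (\<integral>\<^sup>+r. (\<integral>\<^sup>+u. ennreal r * G (r * u, r * (1 - u)) * indicator {0..1} u \<partial>lborel) * indicator {0..} r \<partial>lborel)"
  proof (rule nn_integral_cong_AE)
    have "AE r in lborel. r \<noteq> (0::real)" by (rule AE_lborel_singleton)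
    then show "AE r in lborel. (\<integral>\<^sup>+x. G (x, r - x) * indicator {0..} x * indicator {0..} (r - x) \<partial>lborel) =
       (\<integral>\<^sup>+u. ennreal r * G (r * u, r * (1 - u)) * indicator {0..1} u \<partial>lborel) * indicator {0..} r"
    proof eventually_elim
      case (elim r)
      show ?case
      proof (cases "r > 0")
        case True
        have "(\<integral>\<^sup>+x. G (x, r - x) * indicator {0..} x * indicator {0..} (r - x) \<partial>lborel) =
          ennreal \<bar>r\<bar> * (\<integral>\<^sup>+u. G (0 + r * u, r - (0 + r * u)) * indicator {0..} (0 + r * u) * indicator {0..} (r - (0 + r * u)) \<partial>lborel)"
          using elim by (intro nn_integral_real_affine) auto
        also have "\<dots> = (\<integral>\<^sup>+u. ennreal r * (G (0 + r * u, r - (0 + r * u)) * indicator {0..} (0 + r * u) * indicator {0..} (r - (0 + r * u))) \<partial>lborel)"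
          using True by (subst nn_integral_cmult) auto
        also have "\<dots> = (\<integral>\<^sup>+u. ennreal r * G (r * u, r * (1 - u)) * indicator {0..1} u \<partial>lborel)"
          using True by (intro nn_integral_cong) (auto simp: indicator_def zero_le_mult_iff right_diff_distrib mult_le_cancel_left1)
        finally show ?thesis using True by simp
      next
        case False
        then have "r < 0" using elim by simp
        then have "(\<integral>\<^sup>+x. G (x, r - x) * indicator {0..} x * indicator {0..} (r - x) \<partial>lborel) = (\<integral>\<^sup>+(x::real). 0 \<partial>lborel)"
          by - (rule nn_integral_cong, auto simp: indicator_def)
        then show ?thesis using \<open>r < 0\<close> by simp
      qed
    qed
  qed
  finally show ?thesis .
qed

text \<open>Convolution of an exponential law with Gamma(m + 1): in total and ratio, the
  exponentials depend on the total only, and integrating u^m over the ratio supplies the 1 / (m + 1)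
  of the next factorial.\<close>

lemma nn_integral_gauss_PiM_norm_squared:
  fixes K :: "'i set"
  assumes K: "finite K" "card K = Suc m" and F[measurable]: "F \<in> borel_measurable borel"
  shows "(\<integral>\<^sup>+x. F (\<Sum>k\<in>K. (cmod (x k))\<^sup>2) \<partial>gauss_PiM K) =
    (\<integral>\<^sup>+\<beta>. ennreal (\<beta> ^ m * exp (- \<beta>) / fact m) * F \<beta> * indicator {0..} \<beta> \<partial>lborel)"
  using K F
proof (induction m arbitrary: K F)
  have radial: "(\<integral>\<^sup>+y. H ((cmod y)\<^sup>2) \<partial>complex_gauss) = (\<integral>\<^sup>+p. ennreal (exp (- p)) * H p * indicator {0..} p \<partial>lborel)"
    if [measurable]: "H \<in> borel_measurable borel" for H
  proof -
    \<comment> \<open>For shift 0 the mixture reduces to its term n = 0, since 0^0 = 1.\<close>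
    have "(\<lambda>n. ennreal ((if n = 0 then 1 else 0)) * (\<integral>\<^sup>+p. ennreal (p ^ n * exp (- p)) * H p * indicator {0..} p \<partial>lborel)) sums
       (\<integral>\<^sup>+p. ennreal (exp (- p)) * H p * indicator {0..} p \<partial>lborel)"
      using sums_single[of 0 "\<lambda>n. \<integral>\<^sup>+p. ennreal (p ^ n * exp (- p)) * H p * indicator {0..} p \<partial>lborel"]
      by (simp add: if_distrib if_distribR cong: if_cong)
    moreover have "exp (- (cmod 0)\<^sup>2) * ((cmod 0)\<^sup>2) ^ n / (fact n)\<^sup>2 = (if n = 0 then 1 else 0 :: real)" for n by simp
    ultimately show ?thesis using nn_integral_gauss_shift_radial[of H 0] by (simp add: sums_iff)
  qed
  {
    case 0
    then obtain k where k: "K = {k}" by (auto simp: card_Suc_eq)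
    have "(\<integral>\<^sup>+x. F (\<Sum>k\<in>K. (cmod (x k))\<^sup>2) \<partial>gauss_PiM K) = (\<integral>\<^sup>+y. F ((cmod y)\<^sup>2) \<partial>complex_gauss)"
      unfolding k using gauss_prod.product_nn_integral_singleton[of "\<lambda>y. F ((cmod y)\<^sup>2)" k] 0 by simp
    then show ?case using radial[of F] 0 by simp
  next
    case (Suc m)
    note [measurable] = Suc.prems(3)
    obtain k J where K: "K = insert k J" "k \<notin> J" "card J = Suc m" "finite J"
      using Suc.prems by (metis card_Suc_eq finite_insert)
    have comp: "(\<lambda>x. x i) \<in> borel_measurable (gauss_PiM (insert k J))" if "i \<in> insert k J" for i
      using that by (rule borel_measurable_gauss_component)
    have "(\<lambda>x. \<Sum>k\<in>K. (cmod (x k))\<^sup>2) \<in> borel_measurable (gauss_PiM (insert k J))"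
      unfolding K(1) using comp by (intro borel_measurable_sum borel_measurable_power measurable_compose[OF _ borel_measurable_norm]) auto
    then have meas: "(\<lambda>x. F (\<Sum>k\<in>K. (cmod (x k))\<^sup>2)) \<in> borel_measurable (gauss_PiM (insert k J))" by measurable
    have "(\<integral>\<^sup>+x. F (\<Sum>k\<in>K. (cmod (x k))\<^sup>2) \<partial>gauss_PiM K) =
       (\<integral>\<^sup>+y. \<integral>\<^sup>+x. F (\<Sum>i\<in>K. (cmod ((x(k := y)) i))\<^sup>2) \<partial>gauss_PiM J \<partial>complex_gauss)"
      using gauss_prod.product_nn_integral_insert_rev[OF K(4,2) meas] K(1) by simp
    also have "\<dots> = (\<integral>\<^sup>+y. \<integral>\<^sup>+x. F ((cmod y)\<^sup>2 + (\<Sum>i\<in>J. (cmod (x i))\<^sup>2)) \<partial>gauss_PiM J \<partial>complex_gauss)"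
    proof -
      have "(\<Sum>i\<in>J. (cmod ((x(k := y)) i))\<^sup>2) = (\<Sum>i\<in>J. (cmod (x i))\<^sup>2)" for x y
        using K by (intro sum.cong) auto
      then show ?thesis using K by simp
    qed
    also have "\<dots> = (\<integral>\<^sup>+y. (\<integral>\<^sup>+\<beta>. ennreal (\<beta> ^ m * exp (- \<beta>) / fact m) * F ((cmod y)\<^sup>2 + \<beta>) * indicator {0..} \<beta> \<partial>lborel) \<partial>complex_gauss)"
      by (intro nn_integral_cong Suc.IH[OF K(4,3)]) measurable
    also have "\<dots> = (\<integral>\<^sup>+p. ennreal (exp (- p)) * (\<integral>\<^sup>+\<beta>. ennreal (\<beta> ^ m * exp (- \<beta>) / fact m) * F (p + \<beta>) * indicator {0..} \<beta> \<partial>lborel) * indicator {0..} p \<partial>lborel)"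
      by (rule radial) measurable
    also have "\<dots> = (\<integral>\<^sup>+p. (\<integral>\<^sup>+\<beta>. ennreal (exp (- p)) * (ennreal (\<beta> ^ m * exp (- \<beta>) / fact m) * F (p + \<beta>)) * indicator {0..} \<beta> \<partial>lborel) * indicator {0..} p \<partial>lborel)"
      by (intro nn_integral_cong arg_cong2[where f = "(*)"] refl, subst nn_integral_cmult[symmetric]) (auto simp: mult.assoc)
    also have "\<dots> = (\<integral>\<^sup>+r. (\<integral>\<^sup>+u. ennreal r * (ennreal (exp (- (r * (1 - u)))) * (ennreal ((r * u) ^ m * exp (- (r * u)) / fact m) * F (r * (1 - u) + r * u)))
         * indicator {0..1} u \<partial>lborel) * indicator {0..} r \<partial>lborel)"
      using nn_integral_simplex[of "\<lambda>(\<beta>, p). ennreal (exp (- p)) * (ennreal (\<beta> ^ m * exp (- \<beta>) / fact m) * F (p + \<beta>))"] by simp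
    also have "\<dots> = (\<integral>\<^sup>+r. ennreal (r ^ Suc m * exp (- r) / fact (Suc m)) * F r * indicator {0..} r \<partial>lborel)"
    proof (intro nn_integral_cong)
      fix r :: real
      show "(\<integral>\<^sup>+u. ennreal r * (ennreal (exp (- (r * (1 - u)))) * (ennreal ((r * u) ^ m * exp (- (r * u)) / fact m) * F (r * (1 - u) + r * u)))
         * indicator {0..1} u \<partial>lborel) * indicator {0..} r = ennreal (r ^ Suc m * exp (- r) / fact (Suc m)) * F r * indicator {0..} r"
      proof (cases "r \<ge> 0")
        case True
        have "(\<integral>\<^sup>+u. ennreal r * (ennreal (exp (- (r * (1 - u)))) * (ennreal ((r * u) ^ m * exp (- (r * u)) / fact m) * F (r * (1 - u) + r * u))) * indicator {0..1} u \<partial>lborel)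
          = (\<integral>\<^sup>+u. (ennreal (r ^ Suc m * exp (- r) / fact m) * F r) * (ennreal (u ^ m) * indicator {0..1} u) \<partial>lborel)"
        proof (intro nn_integral_cong)
          fix u :: real
          show "ennreal r * (ennreal (exp (- (r * (1 - u)))) * (ennreal ((r * u) ^ m * exp (- (r * u)) / fact m) * F (r * (1 - u) + r * u))) * indicator {0..1} u
            = (ennreal (r ^ Suc m * exp (- r) / fact m) * F r) * (ennreal (u ^ m) * indicator {0..1} u)"
          proof (cases "u \<in> {0..1}")
            case u: True
            have "r * (exp (- (r * (1 - u))) * ((r * u) ^ m * exp (- (r * u)) / fact m)) = (r ^ Suc m * (exp (- (r * (1 - u))) * exp (- (r * u))) / fact m) * u ^ m"
              by (simp add: power_mult_distrib)
            also have "exp (- (r * (1 - u))) * exp (- (r * u)) = exp (- r)" by (simp add: mult_exp_exp algebra_simps)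
            finally have eq: "r * (exp (- (r * (1 - u))) * ((r * u) ^ m * exp (- (r * u)) / fact m)) = r ^ Suc m * exp (- r) / fact m * u ^ m" .
            have "ennreal r * (ennreal (exp (- (r * (1 - u)))) * ennreal ((r * u) ^ m * exp (- (r * u)) / fact m)) = ennreal (r ^ Suc m * exp (- r) / fact m) * ennreal (u ^ m)"
            proof -
              have e2: "ennreal A * ennreal B = ennreal (A * B)" if "0 \<le> A" "0 \<le> B" for A B :: real
                using that by (simp add: ennreal_mult)
              from eq show ?thesis using u True by (subst e2; (subst e2)?; (subst e2)?) auto
            qed
            then have "ennreal r * (ennreal (exp (- (r * (1 - u)))) * (ennreal ((r * u) ^ m * exp (- (r * u)) / fact m) * F r)) =
                ennreal (r ^ Suc m * exp (- r) / fact m) * ennreal (u ^ m) * F r" by (simp only: mult.assoc[symmetric])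
            moreover have "r * (1 - u) + r * u = r" by (simp add: algebra_simps)
            ultimately show ?thesis using u by (simp add: mult_ac del: power_Suc)
          qed simp
        qed
        also have "\<dots> = (ennreal (r ^ Suc m * exp (- r) / fact m) * F r) * (\<integral>\<^sup>+u. ennreal (u ^ m) * indicator {0..1} u \<partial>lborel)"
          by (rule nn_integral_cmult) measurable
        also have "(\<integral>\<^sup>+u. ennreal (u ^ m) * indicator {0..1} u \<partial>lborel) = ennreal (1 ^ Suc m / real (Suc m) - 0 ^ Suc m / real (Suc m))"
          by (rule nn_integral_FTC_Icc) (auto intro!: derivative_eq_intros simp del: of_nat_Suc power_Suc)
        finally have "(\<integral>\<^sup>+u. ennreal r * (ennreal (exp (- (r * (1 - u)))) * (ennreal ((r * u) ^ m * exp (- (r * u)) / fact m) * F (r * (1 - u) + r * u))) * indicator {0..1} u \<partial>lborel)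
           = (ennreal (r ^ Suc m * exp (- r) / fact m) * ennreal (1 / real (Suc m))) * F r" by (simp add: mult_ac)
        also have "ennreal (r ^ Suc m * exp (- r) / fact m) * ennreal (1 / real (Suc m)) = ennreal (r ^ Suc m * exp (- r) / fact (Suc m))"
          using True by (simp add: ennreal_mult[symmetric] mult_ac del: of_nat_Suc power_Suc)
        finally show ?thesis using True by simp
      qed simp
    qed
    finally show ?case .
  }
qed

lemma nn_integral_Gamma:
  fixes \<alpha> :: real
  assumes "\<alpha> > -1"
  shows "(\<integral>\<^sup>+p. ennreal (p ^ n * exp (- p)) * ennreal (p powr \<alpha>) * indicator {0..} p \<partial>lborel) = ennreal (Gamma (\<alpha> + 1 + real n))"
proof -
  have "ennreal (Gamma (\<alpha> + 1 + real n)) = (\<integral>\<^sup>+t. ennreal (indicator {0..} t * t powr (\<alpha> + 1 + real n - 1) / exp t) \<partial>lborel)"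
    using assms by (intro Gamma_conv_nn_integral_real) auto
  also have "\<dots> = (\<integral>\<^sup>+p. ennreal (p ^ n * exp (- p)) * ennreal (p powr \<alpha>) * indicator {0..} p \<partial>lborel)"
  proof (rule nn_integral_cong)
    fix p :: real
    consider "p < 0" | "p = 0" | "p > 0" by linarith
    then show "ennreal (indicator {0..} p * p powr (\<alpha> + 1 + real n - 1) / exp p) = ennreal (p ^ n * exp (- p)) * ennreal (p powr \<alpha>) * indicator {0..} p"
    proof cases
      case 3
      then have "p powr (\<alpha> + 1 + real n - 1) / exp p = (p ^ n * exp (- p)) * p powr \<alpha>"
        by (simp add: powr_add powr_realpow exp_minus divide_inverse)
      then show ?thesis using 3 by (simp add: ennreal_mult)
    qed auto
  qed
  finally show ?thesis by simp
qed

section \<open>The moment recursion in series form\<close>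

lemma shifted_moment_0:
  fixes w :: complex and v :: real
  assumes "\<alpha> > -1"
  defines "s \<equiv> (cmod w * v)\<^sup>2"
  shows "shifted_moment 0 w \<alpha> v = (\<Sum>n. ennreal (exp (- s) * s ^ n / (fact n)\<^sup>2 * Gamma (\<alpha> + 1 + real n)))"
proof -
  have pw: "cmod x powr (2 * \<alpha>) = ((cmod x)\<^sup>2) powr \<alpha>" for x :: complex
    by (cases "x = 0") (simp_all add: powr_powr flip: powr_numeral)
  have "det (shifted 0 w v G) = G (0, 0) - w * of_real v" for G
    by (subst det_single) (auto simp: shifted_def)
  then have "shifted_moment 0 w \<alpha> v = (\<integral>\<^sup>+G. ennreal (((cmod (G (0, 0) - w * of_real v))\<^sup>2) powr \<alpha>) \<partial>gauss_PiM {(0::nat, 0::nat)})"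
    unfolding shifted_moment_def pw by (simp add: lessThan_Suc)
  also have "\<dots> = (\<integral>\<^sup>+g. ennreal (((cmod (g - w * of_real v))\<^sup>2) powr \<alpha>) \<partial>complex_gauss)"
    by (rule gauss_prod.product_nn_integral_singleton) simp
  also have "\<dots> = (\<Sum>n. ennreal (exp (- s) * s ^ n / (fact n)\<^sup>2) * (\<integral>\<^sup>+p. ennreal (p ^ n * exp (- p)) * ennreal (p powr \<alpha>) * indicator {0..} p \<partial>lborel))"
    using nn_integral_gauss_shift_radial[of "\<lambda>p. ennreal (p powr \<alpha>)" "w * of_real v"]
    by (simp add: s_def norm_mult power_mult_distrib)
  also have "\<dots> = (\<Sum>n. ennreal (exp (- s) * s ^ n / (fact n)\<^sup>2 * Gamma (\<alpha> + 1 + real n)))"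
  proof (rule suminf_cong)
    fix n
    have "Gamma (\<alpha> + 1 + real n) > 0" using assms by (intro Gamma_real_pos) auto
    then show "ennreal (exp (- s) * s ^ n / (fact n)\<^sup>2) * (\<integral>\<^sup>+p. ennreal (p ^ n * exp (- p)) * ennreal (p powr \<alpha>) * indicator {0..} p \<partial>lborel)
       = ennreal (exp (- s) * s ^ n / (fact n)\<^sup>2 * Gamma (\<alpha> + 1 + real n))"
      unfolding nn_integral_Gamma[OF assms(1)] by (intro ennreal_mult[symmetric]) (auto simp: s_def)
  qed
  finally show ?thesis .
qed

text \<open>In the n-th mixture term p and \<beta> have Gamma densities of shapes n + 1 and m + 1.
  In the variables r = p + \<beta> and u = p / r the kernel is r^\<alpha> times a function of u, so
  the integral factors: r produces the Gamma value, u a moment of the previous function.\<close>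

lemma shifted_moment_recursion:
  fixes w :: complex and v :: real
  assumes \<alpha>: "\<alpha> > -1"
  defines "s \<equiv> (cmod w * v)\<^sup>2"
  shows "shifted_moment (Suc m) w \<alpha> v =
    (\<Sum>n. ennreal (exp (- s) * s ^ n / (fact n)\<^sup>2 * Gamma (\<alpha> + 1 + real (Suc m) + real n) / fact m) *
       (\<integral>\<^sup>+u. ennreal (u ^ n * (1 - u) ^ m) * shifted_moment m w \<alpha> (sqrt u) * indicator {0..1} u \<partial>lborel))"
proof -
  let ?K = "{..<Suc m} \<times> {Suc m}"
  let ?ck = "chain_kernel m w \<alpha>"
  define c where "c n = ennreal (exp (- s) * s ^ n / (fact n)\<^sup>2)" for n
  define T where "T n \<beta> = (\<integral>\<^sup>+p. ennreal (p ^ n * exp (- p)) * ?ck p \<beta> * indicator {0..} p \<partial>lborel)" for n \<beta>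
  have T[measurable]: "T n \<in> borel_measurable borel" for n unfolding T_def [abs_def] by measurable
  have [measurable]: "(\<lambda>x. \<Sum>k\<in>?K. (cmod (x k))\<^sup>2) \<in> borel_measurable (gauss_PiM ?K)"
    by (intro borel_measurable_sum borel_measurable_power measurable_compose[OF borel_measurable_gauss_component borel_measurable_norm])
  have "shifted_moment (Suc m) w \<alpha> v = (\<integral>\<^sup>+x. (\<Sum>n. c n * T n (\<Sum>k\<in>?K. (cmod (x k))\<^sup>2)) \<partial>gauss_PiM ?K)"
    unfolding shifted_moment_Suc c_def T_def
    by (intro nn_integral_cong, subst nn_integral_gauss_shift_radial) (auto simp: s_def norm_mult power_mult_distrib)
  also have "\<dots> = (\<Sum>n. c n * (\<integral>\<^sup>+x. T n (\<Sum>k\<in>?K. (cmod (x k))\<^sup>2) \<partial>gauss_PiM ?K))"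
    by (subst nn_integral_suminf) (auto intro!: suminf_cong nn_integral_cmult)
  also have "\<dots> = (\<Sum>n. c n * (\<integral>\<^sup>+\<beta>. ennreal (\<beta> ^ m * exp (- \<beta>) / fact m) * T n \<beta> * indicator {0..} \<beta> \<partial>lborel))"
    by (subst nn_integral_gauss_PiM_norm_squared) (auto simp: card_cartesian_product)
  also have "\<dots> = (\<Sum>n. ennreal (exp (- s) * s ^ n / (fact n)\<^sup>2 * Gamma (\<alpha> + 1 + real (Suc m) + real n) / fact m) *
       (\<integral>\<^sup>+u. ennreal (u ^ n * (1 - u) ^ m) * shifted_moment m w \<alpha> (sqrt u) * indicator {0..1} u \<partial>lborel))"
  proof (rule suminf_cong)
    fix n
    define G where "G = (\<lambda>(p, \<beta>). ennreal (\<beta> ^ m * exp (- \<beta>) / fact m) * (ennreal (p ^ n * exp (- p)) * ?ck p \<beta>))"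
    have G[measurable]: "G \<in> borel_measurable (borel \<Otimes>\<^sub>M borel)" unfolding G_def by measurable
    define g where "g u = ennreal (u ^ n * (1 - u) ^ m) * shifted_moment m w \<alpha> (sqrt u) * indicator {0..1} u" for u
    have g[measurable]: "g \<in> borel_measurable borel" unfolding g_def [abs_def] by measurable
    have Gpos: "Gamma (\<alpha> + 1 + real (Suc m) + real n) > 0" using \<alpha> by (intro Gamma_real_pos) auto
    have "(\<integral>\<^sup>+\<beta>. ennreal (\<beta> ^ m * exp (- \<beta>) / fact m) * T n \<beta> * indicator {0..} \<beta> \<partial>lborel) =
       (\<integral>\<^sup>+\<beta>. (\<integral>\<^sup>+p. G (p, \<beta>) * indicator {0..} p \<partial>lborel) * indicator {0..} \<beta> \<partial>lborel)"
      unfolding T_def G_def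
      by (intro nn_integral_cong arg_cong2[where f = "(*)"] refl, subst nn_integral_cmult[symmetric]) (auto simp: mult.assoc)
    also have "\<dots> = (\<integral>\<^sup>+r. (\<integral>\<^sup>+u. ennreal r * G (r * u, r * (1 - u)) * indicator {0..1} u \<partial>lborel) * indicator {0..} r \<partial>lborel)"
      by (rule nn_integral_simplex) (rule G)
    also have "\<dots> = (\<integral>\<^sup>+r. (\<integral>\<^sup>+u. (ennreal (r ^ (n + m + 1) * exp (- r)) * ennreal (r powr \<alpha>) * ennreal (1 / fact m)) * g u \<partial>lborel) * indicator {0..} r \<partial>lborel)"
    proof (intro nn_integral_cong)
      fix r :: real
      have "(\<integral>\<^sup>+u. ennreal r * G (r * u, r * (1 - u)) * indicator {0..1} u \<partial>lborel) =
         (\<integral>\<^sup>+u. (ennreal (r ^ (n + m + 1) * exp (- r)) * ennreal (r powr \<alpha>) * ennreal (1 / fact m)) * g u \<partial>lborel)" if r: "r \<ge> 0"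
      proof (intro nn_integral_cong)
        fix u :: real
        show "ennreal r * G (r * u, r * (1 - u)) * indicator {0..1} u = (ennreal (r ^ (n + m + 1) * exp (- r)) * ennreal (r powr \<alpha>) * ennreal (1 / fact m)) * g u"
        proof (cases "u \<in> {0..1} \<and> r > 0")
          case True
          have sum_r: "r * u + r * (1 - u) = r" by (simp add: algebra_simps)
          have ck: "?ck (r * u) (r * (1 - u)) = ennreal (r powr \<alpha>) * shifted_moment m w \<alpha> (sqrt u)"
            unfolding chain_kernel_def sum_r using True by simp
          have e2: "ennreal A * ennreal B = ennreal (A * B)" if "0 \<le> A" "0 \<le> B" for A B :: real
            using that by (simp add: ennreal_mult)
          have "exp (- (r * (1 - u))) * exp (- (r * u)) = exp (- r)" by (simp add: mult_exp_exp algebra_simps)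
          moreover have "r * ((r * (1 - u)) ^ m * exp (- (r * (1 - u))) / fact m * ((r * u) ^ n * exp (- (r * u)))) =
              r ^ (n + m + 1) * (exp (- (r * (1 - u))) * exp (- (r * u))) * (1 / fact m) * (u ^ n * (1 - u) ^ m)"
            by (simp add: power_mult_distrib power_add)
          ultimately have eq: "r * ((r * (1 - u)) ^ m * exp (- (r * (1 - u))) / fact m * ((r * u) ^ n * exp (- (r * u)))) =
              r ^ (n + m + 1) * exp (- r) * (1 / fact m) * (u ^ n * (1 - u) ^ m)" by simp
          have "ennreal r * (ennreal ((r * (1 - u)) ^ m * exp (- (r * (1 - u))) / fact m) * ennreal ((r * u) ^ n * exp (- (r * u)))) =
             ennreal (r ^ (n + m + 1) * exp (- r)) * ennreal (1 / fact m) * ennreal (u ^ n * (1 - u) ^ m)" (is "?L = ?R")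
          proof -
            have "?L = ennreal (r * ((r * (1 - u)) ^ m * exp (- (r * (1 - u))) / fact m * ((r * u) ^ n * exp (- (r * u)))))"
              using True by (subst e2; (subst e2)?; (subst e2)?) auto
            also have "\<dots> = ?R" unfolding eq using True by (subst ennreal_mult; (subst ennreal_mult)?) auto
            finally show ?thesis .
          qed
          then have "?L * (ennreal (r powr \<alpha>) * shifted_moment m w \<alpha> (sqrt u)) = ?R * (ennreal (r powr \<alpha>) * shifted_moment m w \<alpha> (sqrt u))"
            by (rule arg_cong)
          moreover have "ennreal r * G (r * u, r * (1 - u)) * indicator {0..1} u = ?L * (ennreal (r powr \<alpha>) * shifted_moment m w \<alpha> (sqrt u))"
            using True unfolding G_def prod.case ck by (simp only: mult.assoc indicator_simps mult_1_right)
          moreover have "(ennreal (r ^ (n + m + 1) * exp (- r)) * ennreal (r powr \<alpha>) * ennreal (1 / fact m)) * g u = ?R * (ennreal (r powr \<alpha>) * shifted_moment m w \<alpha> (sqrt u))"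
            using True unfolding g_def by (simp only: mult_ac indicator_simps mult_1_right mult_1_left)
          ultimately show ?thesis by (simp only:)
        next
          case False
          then show ?thesis using r by (auto simp: g_def)
        qed
      qed
      then show "(\<integral>\<^sup>+u. ennreal r * G (r * u, r * (1 - u)) * indicator {0..1} u \<partial>lborel) * indicator {0..} r =
         (\<integral>\<^sup>+u. (ennreal (r ^ (n + m + 1) * exp (- r)) * ennreal (r powr \<alpha>) * ennreal (1 / fact m)) * g u \<partial>lborel) * indicator {0..} r"
        by (cases "r \<ge> 0") auto
    qed
    also have "\<dots> = (\<integral>\<^sup>+r. (ennreal (r ^ (n + m + 1) * exp (- r)) * ennreal (r powr \<alpha>) * indicator {0..} r) * (ennreal (1 / fact m) * integral\<^sup>N lborel g) \<partial>lborel)"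
      by (intro nn_integral_cong, subst nn_integral_cmult) (auto simp: mult_ac)
    also have "\<dots> = ennreal (Gamma (\<alpha> + 1 + real (n + m + 1))) * (ennreal (1 / fact m) * integral\<^sup>N lborel g)"
      unfolding nn_integral_Gamma[OF \<alpha>, symmetric] by (rule nn_integral_multc) measurable
    finally have 1: "(\<integral>\<^sup>+\<beta>. ennreal (\<beta> ^ m * exp (- \<beta>) / fact m) * T n \<beta> * indicator {0..} \<beta> \<partial>lborel) =
       ennreal (Gamma (\<alpha> + 1 + real (Suc m) + real n)) * ennreal (1 / fact m) * integral\<^sup>N lborel g"
      by (simp add: mult.assoc add_ac)
    have "c n * (ennreal (Gamma (\<alpha> + 1 + real (Suc m) + real n)) * ennreal (1 / fact m)) =
        ennreal (exp (- s) * s ^ n / (fact n)\<^sup>2 * Gamma (\<alpha> + 1 + real (Suc m) + real n) / fact m)"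
      unfolding c_def using Gpos by (simp add: s_def ennreal_mult[symmetric])
    then show "c n * (\<integral>\<^sup>+\<beta>. ennreal (\<beta> ^ m * exp (- \<beta>) / fact m) * T n \<beta> * indicator {0..} \<beta> \<partial>lborel) =
      ennreal (exp (- s) * s ^ n / (fact n)\<^sup>2 * Gamma (\<alpha> + 1 + real (Suc m) + real n) / fact m) *
       (\<integral>\<^sup>+u. ennreal (u ^ n * (1 - u) ^ m) * shifted_moment m w \<alpha> (sqrt u) * indicator {0..1} u \<partial>lborel)"
      unfolding 1 g_def[symmetric] by (simp only: mult.assoc[symmetric])
  qed
  finally show ?thesis .
qed

section \<open>Fourier coefficients of the symbol\<close>

text \<open>The boundary values of \<open>(1 + 1 / \<zeta>) powr a\<close> on the unit circle, \<open>\<zeta> = cis \<theta>\<close>.\<close>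

definition fh_symbol :: "real \<Rightarrow> real \<Rightarrow> complex" where
  "fh_symbol a \<theta> = cis (- (a * \<theta> / 2)) * of_real (cmod (1 + cis \<theta>) powr a)"

lemma one_plus_cis: "1 + cis \<theta> = of_real (2 * cos (\<theta> / 2)) * cis (\<theta> / 2)"
proof -
  have "cos \<theta> = 2 * (cos (\<theta> / 2))\<^sup>2 - 1" "sin \<theta> = 2 * sin (\<theta> / 2) * cos (\<theta> / 2)"
    using cos_double_cos[of "\<theta> / 2"] sin_double[of "\<theta> / 2"] by simp_all
  then show ?thesis by (simp add: complex_eq_iff power2_eq_square)
qed

lemma cmod_one_plus_cis:
  assumes "\<theta> \<in> {-pi..pi}" shows "cmod (1 + cis \<theta>) = 2 * cos (\<theta> / 2)"
proof -
  have "cos (\<theta> / 2) \<ge> 0" using assms by (intro cos_ge_zero) auto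
  then show ?thesis by (simp add: one_plus_cis norm_mult)
qed

text \<open>A linear lower bound with an unimportant constant; it controls the singularity of the
  symbol at \<plusminus>pi when a < 0.\<close>

lemma sin_ge_quarter:
  assumes "0 \<le> y" "y \<le> pi / 2" shows "y / 4 \<le> sin y"
proof (cases "y \<le> pi / 3")
  case True
  have y: "y < pi / 2" using True pi_gt_zero by linarith
  have c: "cos y \<ge> 1 / 2" using cos_monotone_0_pi_le[of y "pi / 3"] assms True by (simp add: cos_60)
  have "y \<le> tan y" using abs_tan_ge[of y] assms y tan_gt_zero[of y] by (cases "y = 0") auto
  then have "y * cos y \<le> sin y" using c by (simp add: tan_def field_simps)
  moreover have "y * (1 / 2) \<le> y * cos y" using assms c by (intro mult_left_mono) auto
  ultimately show ?thesis using assms by linarith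
next
  case False
  have "sin (pi / 3) \<le> sin y" using assms False by (intro sin_monotone_2pi_le) auto
  moreover have "sin (pi / 3) \<ge> 1 / 2"
  proof -
    have "1 \<le> sqrt 3" by simp
    then show ?thesis by (simp add: sin_60)
  qed
  moreover have "y / 4 \<le> 1 / 2" using assms pi_less_4 by linarith
  ultimately show ?thesis by linarith
qed

lemma borel_measurable_fh_symbol [measurable]: "fh_symbol a \<in> borel_measurable borel"
proof -
  have [measurable]: "(\<lambda>x. cis (f x)) \<in> borel_measurable borel" if "f \<in> borel_measurable borel" for f :: "real \<Rightarrow> real"
    using that by (intro measurable_compose[OF that] borel_measurable_continuous_onI continuous_intros)
  show ?thesis unfolding fh_symbol_def [abs_def] by measurable
qed

text \<open>For a \<ge> 0 the modulus is at most 2^a. For a < 0 it is bounded by a constant times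
  d^a, d the distance to the nearer end point, which is integrable as a > -1. The dominating
  function is a sum covering both cases.\<close>

lemma set_integrable_fh_symbol:
  assumes a: "a > -1"
  shows "set_integrable lborel {-pi..pi} (fh_symbol a)"
proof -
  define p where "p x = indicator {0..pi} x * x powr a" for x :: real
  have p_nonneg: "p x \<ge> 0" for x by (simp add: p_def)
  have [measurable]: "p \<in> borel_measurable borel" unfolding p_def [abs_def] by measurable
  have "integrable lborel p"
  proof (rule integrableI_nonneg)
    have "(\<integral>\<^sup>+x. ennreal (x powr a) * indicator {0..pi} x \<partial>lborel) = ennreal (pi powr (a + 1) / (a + 1))"
      using a by (intro nn_integral_has_integral_lebesgue' has_integral_powr_from_0) auto
    moreover have "(\<integral>\<^sup>+x. ennreal (p x) \<partial>lborel) = (\<integral>\<^sup>+x. ennreal (x powr a) * indicator {0..pi} x \<partial>lborel)"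
      by (intro nn_integral_cong) (auto simp: p_def indicator_def)
    ultimately show "(\<integral>\<^sup>+x. ennreal (p x) \<partial>lborel) < \<infinity>" by simp
  qed (auto simp: p_def)
  have intp: "integrable lborel (\<lambda>x. (1 / 4) powr a * (p (pi - x) + p (pi + x)) + indicator {-pi..pi} x * 2 powr a)"
    using \<open>integrable lborel p\<close>[THEN lborel_integrable_real_affine, of "-1" pi] \<open>integrable lborel p\<close>[THEN lborel_integrable_real_affine, of 1 pi]
    by (intro Bochner_Integration.integrable_add integrable_mult_right) (auto intro!: integrable_real_mult_indicator)
  show ?thesis unfolding set_integrable_def
  proof (rule Bochner_Integration.integrable_bound[OF intp])
    show "AE x in lborel. norm (indicator {-pi..pi} x *\<^sub>R fh_symbol a x) \<le> norm ((1 / 4) powr a * (p (pi - x) + p (pi + x)) + indicator {-pi..pi} x * 2 powr a)"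
    proof (rule AE_I2)
      fix x :: real
      let ?R = "(1 / 4) powr a * (p (pi - x) + p (pi + x)) + indicator {-pi..pi} x * 2 powr a"
      have R: "?R \<ge> 0" using p_nonneg by simp
      show "norm (indicator {-pi..pi} x *\<^sub>R fh_symbol a x) \<le> norm ?R"
      proof (cases "x \<in> {-pi..pi}")
        case True
        have c: "cmod (1 + cis x) \<le> 2" using norm_triangle_ineq[of 1 "cis x"] by simp
        have "cmod (1 + cis x) powr a \<le> ?R"
        proof (cases "a \<ge> 0")
          case a0: True
          have "cmod (1 + cis x) powr a \<le> 2 powr a" using c a0 by (intro powr_mono2) auto
          also have "\<dots> \<le> ?R" using p_nonneg True by simp
          finally show ?thesis .
        next
          case a0: False
          show ?thesis
          proof (cases "\<bar>x\<bar> = pi")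
            case False
            then have y: "0 < pi - \<bar>x\<bar>" using True by auto
            have "cmod (1 + cis x) = 2 * cos (\<bar>x\<bar> / 2)" using cmod_one_plus_cis[OF True] by (simp add: abs_if)
            also have "cos (\<bar>x\<bar> / 2) = sin ((pi - \<bar>x\<bar>) / 2)" by (simp add: cos_sin_eq diff_divide_distrib)
            finally have "cmod (1 + cis x) \<ge> (pi - \<bar>x\<bar>) / 4"
              using sin_ge_quarter[of "(pi - \<bar>x\<bar>) / 2"] y by simp
            then have "cmod (1 + cis x) powr a \<le> ((pi - \<bar>x\<bar>) / 4) powr a"
              using y a0 by (intro powr_mono2') auto
            also have "\<dots> = (1 / 4) powr a * (pi - \<bar>x\<bar>) powr a" using y by (simp add: powr_divide)
            also have "(pi - \<bar>x\<bar>) powr a \<le> p (pi - x) + p (pi + x)"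
              using True p_nonneg[of "pi - x"] p_nonneg[of "pi + x"] by (cases "x \<ge> 0") (auto simp: p_def)
            finally show ?thesis using p_nonneg True by (simp add: mult_left_mono add_increasing2)
          next
            case True
            have "cos (x / 2) = cos (\<bar>x\<bar> / 2)" by (simp add: abs_if)
            then have "cmod (1 + cis x) = 0" using cmod_one_plus_cis[OF \<open>x \<in> _\<close>] True by simp
            then show ?thesis using R by simp
          qed
        qed
        then show ?thesis using True R by (simp add: fh_symbol_def norm_mult)
      qed simp
    qed
  qed measurable
qed

lemma fh_symbol_Suc:
  assumes "\<theta> \<in> {-pi..pi}"
  shows "fh_symbol (a + 1) \<theta> = fh_symbol a \<theta> * (1 + cis (- \<theta>))"
proof -
  let ?c = "cmod (1 + cis \<theta>)"
  have "1 + cis (- \<theta>) = of_real ?c * cis (- \<theta> / 2)"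
    using one_plus_cis[of "- \<theta>"] cmod_one_plus_cis[OF assms] by simp
  moreover have "?c powr (a + 1) = ?c powr a * ?c" by (cases "?c = 0") (simp_all add: powr_add)
  moreover have "cis (- ((a + 1) * \<theta> / 2)) = cis (- (a * \<theta> / 2)) * cis (- \<theta> / 2)"
    by (simp add: cis_mult algebra_simps add_divide_distrib)
  ultimately show ?thesis by (simp only: fh_symbol_def of_real_mult mult_ac)
qed

definition fh_coeff :: "real \<Rightarrow> int \<Rightarrow> complex" where
  "fh_coeff a j = (LINT x:{-pi..pi}|lborel. fh_symbol a x * cis (of_int j * x))"

lemma set_integrable_mult_cis:
  fixes f :: "real \<Rightarrow> complex"
  assumes "set_integrable lborel {-pi..pi} f"
  shows "set_integrable lborel {-pi..pi} (\<lambda>x. f x * cis (r * x))"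
  unfolding set_integrable_def
proof (rule Bochner_Integration.integrable_bound[OF assms[unfolded set_integrable_def]])
  have [measurable]: "(\<lambda>x. cis (r * x)) \<in> borel_measurable borel"
    by (intro borel_measurable_continuous_onI continuous_intros)
  have [measurable]: "(\<lambda>x. indicator {-pi..pi} x *\<^sub>R f x) \<in> borel_measurable lborel" using assms by (auto simp: set_integrable_def)
  have "(\<lambda>x. (indicator {-pi..pi} x *\<^sub>R f x) * cis (r * x)) \<in> borel_measurable lborel" by measurable
  then show "(\<lambda>x. indicator {-pi..pi} x *\<^sub>R (f x * cis (r * x))) \<in> borel_measurable lborel" by simp
qed (auto simp: norm_mult)

lemma fh_coeff_Suc:
  assumes a: "a > -1"
  shows "fh_coeff (a + 1) j = fh_coeff a j + fh_coeff a (j - 1)"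
proof -
  note int = set_integrable_mult_cis[OF set_integrable_fh_symbol[OF a]]
  have "fh_coeff (a + 1) j = (LINT x:{-pi..pi}|lborel. fh_symbol a x * cis (of_int j * x) + fh_symbol a x * cis (of_int (j - 1) * x))"
    unfolding fh_coeff_def
  proof (rule set_lebesgue_integral_cong)
    have "cis (of_int (j - 1) * x) = cis (- x) * cis (of_int j * x)" for x by (simp add: cis_mult algebra_simps)
    then show "\<forall>x. x \<in> {-pi..pi} \<longrightarrow> fh_symbol (a + 1) x * cis (of_int j * x) =
       fh_symbol a x * cis (of_int j * x) + fh_symbol a x * cis (of_int (j - 1) * x)"
      by (simp add: fh_symbol_Suc distrib_left distrib_right mult.assoc)
  qed simp
  also have "\<dots> = fh_coeff a j + fh_coeff a (j - 1)"
    unfolding fh_coeff_def by (rule set_integral_add(2)[OF int int])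
  finally show ?thesis .
qed

text \<open>Integrates the derivative of \<open>fh_symbol (a + 1) x * cis (j * x)\<close>, written
  as \<open>P\<close> by means of the half-angle cosine. Raising the exponent to a + 1 > 0 makes P
  continuous with value 0 at both ends; it is differentiated only in the interior.\<close>

lemma fh_coeff_rec:
  assumes a: "a > -1"
  shows "of_int j * fh_coeff (a + 1) j = of_real (a + 1) * fh_coeff a (j - 1)"
proof -
  define P where "P x = of_real ((2 * cos (x / 2)) powr (a + 1)) * cis ((of_int j - (a + 1) / 2) * x)" for x
  define p where "p x = \<i> * (of_int j * (fh_symbol (a + 1) x * cis (of_int j * x)) - of_real (a + 1) * (fh_symbol a x * cis (of_int (j - 1) * x)))" for x
  have a1: "a + 1 > -1" using a by simp
  note int = set_integrable_mult_cis[OF set_integrable_fh_symbol[OF a]] set_integrable_mult_cis[OF set_integrable_fh_symbol[OF a1]]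
  have "(p has_integral (P pi - P (- pi))) {-pi..pi}"
  proof (rule fundamental_theorem_of_calculus_interior)
    show "continuous_on {-pi..pi} P" unfolding P_def using a
      by (intro continuous_intros continuous_on_powr') (auto intro!: cos_ge_zero)
    fix x assume x: "x \<in> {-pi<..<pi}"
    then have c: "cos (x / 2) > 0" by (intro cos_gt_zero_pi) auto
    have xx: "x \<in> {-pi..pi}" using x by auto
    define C where "C = 2 * cos (x / 2)"
    have C: "C > 0" using c by (simp add: C_def)
    have d1: "((\<lambda>x. (2 * cos (x / 2)) powr (a + 1)) has_real_derivative - ((a + 1) * C powr a * sin (x / 2))) (at x)"
      using c by (auto intro!: derivative_eq_intros simp: C_def powr_diff)
    define \<beta> where "\<beta> = of_int j - (a + 1) / 2"
    have "((\<lambda>w. exp (\<i> * of_real \<beta> * w)) has_field_derivative \<i> * of_real \<beta> * exp (\<i> * of_real \<beta> * of_real x)) (at (of_real x))"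
      by (auto intro!: derivative_eq_intros)
    from has_vector_derivative_real_field[OF this]
    have d2: "((\<lambda>x. cis (\<beta> * x)) has_vector_derivative \<i> * of_real \<beta> * cis (\<beta> * x)) (at x)"
      by (simp add: cis_conv_exp mult.assoc)
    have "(P has_vector_derivative (of_real (C powr (a + 1)) * (\<i> * of_real \<beta> * cis (\<beta> * x))
        + of_real (- ((a + 1) * C powr a * sin (x / 2))) * cis (\<beta> * x))) (at x)"
      unfolding P_def \<beta>_def[symmetric] C_def
      by (rule has_vector_derivative_mult[OF has_vector_derivative_of_real d2])
         (use d1 in \<open>simp add: has_real_derivative_iff_has_vector_derivative C_def\<close>)
    also have "of_real (C powr (a + 1)) * (\<i> * of_real \<beta> * cis (\<beta> * x))
        + of_real (- ((a + 1) * C powr a * sin (x / 2))) * cis (\<beta> * x) = p x"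
    proof -
      have e1: "cis (- ((a + 1) * x / 2)) * cis (of_int j * x) = cis (\<beta> * x)"
        by (simp add: cis_mult \<beta>_def algebra_simps)
      have e2: "cis (- (a * x / 2)) * cis (of_int (j - 1) * x) = cis (\<beta> * x) * cis (- (x / 2))"
        by (simp add: cis_mult \<beta>_def algebra_simps add_divide_distrib)
      have e3: "C powr (a + 1) = C powr a * C" using C by (simp add: powr_add)
      have m: "cmod (1 + cis x) = C" using cmod_one_plus_cis[OF xx] by (simp add: C_def)
      have "p x = \<i> * (of_int j * of_real (C powr (a + 1)) * (cis (- ((a + 1) * x / 2)) * cis (of_int j * x))
          - of_real (a + 1) * of_real (C powr a) * (cis (- (a * x / 2)) * cis (of_int (j - 1) * x)))"
        by (simp add: p_def fh_symbol_def m mult_ac)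
      also have "\<dots> = cis (\<beta> * x) * of_real (C powr a) * (\<i> * (of_int j * of_real C - of_real (a + 1) * cis (- (x / 2))))"
        unfolding e1 e2 e3 by (simp add: algebra_simps)
      also have "\<i> * (of_int j * of_real C - of_real (a + 1) * cis (- (x / 2))) = \<i> * of_real \<beta> * of_real C - of_real (a + 1) * of_real (sin (x / 2))"
        by (simp add: complex_eq_iff \<beta>_def C_def algebra_simps add_divide_distrib)
      finally show ?thesis unfolding e3 by (simp add: algebra_simps)
    qed
    finally show "(P has_vector_derivative p x) (at x)" .
  qed (use pi_ge_zero in linarith)
  moreover have "P pi = 0" "P (- pi) = 0" by (simp_all add: P_def)
  ultimately have "integral {-pi..pi} p = 0" by (simp add: integral_unique)
  moreover have p_int: "set_integrable lborel {-pi..pi} p" unfolding p_def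
    by (intro set_integrable_mult_right set_integral_diff int)
  ultimately have "(LINT x:{-pi..pi}|lborel. p x) = 0" using set_borel_integral_eq_integral(2)[OF p_int] by simp
  also have "(LINT x:{-pi..pi}|lborel. p x) = \<i> * (of_int j * fh_coeff (a + 1) j - of_real (a + 1) * fh_coeff a (j - 1))"
    unfolding p_def fh_coeff_def using int
    by (simp add: set_integral_diff)
  finally show ?thesis by simp
qed

text \<open>On the open interval 1 + cis(-x) lies in the right half-plane with argument -x/2, so the
  symbol is the principal branch of its power.\<close>

lemma powr_eq_fh_symbol:
  assumes x: "x \<in> {-pi<..<pi}"
  shows "(1 + cis (- x)) powr of_real a = fh_symbol a x"
proof -
  have c: "cos (x / 2) > 0" using x by (intro cos_gt_zero_pi) auto
  define C where "C = 2 * cos (x / 2)"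
  have C: "C > 0" using c by (simp add: C_def)
  have m: "cmod (1 + cis x) = C" using cmod_one_plus_cis[of x] x by (simp add: C_def)
  have eq: "1 + cis (- x) = of_real C * cis (- x / 2)" using one_plus_cis[of "- x"] by (simp add: C_def)
  have "Ln (1 + cis (- x)) = of_real (ln C) - \<i> * of_real (x / 2)"
  proof (rule Ln_unique)
    show "exp (of_real (ln C) - \<i> * of_real (x / 2)) = 1 + cis (- x)"
    proof -
      have "exp (of_real (ln C) - \<i> * of_real (x / 2)) = exp (of_real (ln C)) * cis (- x / 2)"
        by (simp add: cis_conv_exp mult_exp_exp)
      moreover have "exp (complex_of_real (ln C)) = of_real C" using C by (simp add: exp_of_real)
      ultimately show ?thesis by (simp only: eq)
    qed
  qed (use x in auto)
  moreover have "1 + cis (- x) \<noteq> 0" using C by (simp add: eq)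
  ultimately have "(1 + cis (- x)) powr of_real a = exp (of_real a * (of_real (ln C) - \<i> * of_real (x / 2)))"
    by (simp add: powr_def)
  also have "\<dots> = exp (of_real (a * ln C)) * cis (- (a * x / 2))"
    by (simp add: cis_conv_exp mult_exp_exp algebra_simps)
  also have "exp (complex_of_real (a * ln C)) = of_real (C powr a)"
    unfolding exp_of_real using C by (simp add: powr_def)
  finally show ?thesis by (simp add: fh_symbol_def m mult.commute)
qed

text \<open>Mean value property: for radius r < 1 only the constant term of the binomial series
  survives integration. Then r tends to 1, with domination by 2^a, which is where a > 0
  enters.\<close>

lemma fh_coeff_0_pos:
  assumes a: "a > 0"
  shows "fh_coeff a 0 = of_real (2 * pi)"
proof -
  have [measurable]: "(\<lambda>x. cis (f x)) \<in> borel_measurable borel" if "f \<in> borel_measurable borel" for f :: "real \<Rightarrow> real"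
    using that by (intro measurable_compose[OF that] borel_measurable_continuous_onI continuous_intros)
  have mean: "(LINT x:{-pi..pi}|lborel. (1 + of_real r * cis (- x)) powr of_real a) = of_real (2 * pi)" if r: "0 \<le> r" "r < 1" for r
  proof -
    define b where "b n = (complex_of_real a gchoose n) * of_real r ^ n" for n
    obtain r' where r': "r < r'" "r' < 1" using r dense by blast
    have sb: "summable (\<lambda>n. norm (b n))"
      unfolding b_def
      by (rule powser_insidea[OF sums_summable[OF gen_binomial_complex[of "of_real r'" "of_real a"]]]) (use r r' in auto)
    define f where "f n x = indicator {-pi..pi} x *\<^sub>R (b n * cis (- (real n * x)))" for n and x :: real
    have "(\<lambda>n. integral\<^sup>L lborel (f n)) sums (\<integral>x. (\<Sum>n. f n x) \<partial>lborel)"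
    proof (rule sums_integral)
      show "integrable lborel (f n)" for n
        unfolding f_def by (fold set_integrable_def) (intro set_integrable_continuous_Icc continuous_intros)
      have "norm (f n x) = indicator {-pi..pi} x * norm (b n)" for n x by (simp add: f_def norm_mult)
      then show "AE x in lborel. summable (\<lambda>n. norm (f n x))" "summable (\<lambda>n. \<integral>x. norm (f n x) \<partial>lborel)"
        using sb by (auto intro!: summable_mult)
    qed
    moreover have "integral\<^sup>L lborel (f n) = (if n = 0 then of_real (2 * pi) else 0)" for n
    proof -
      have "integral\<^sup>L lborel (f n) = b n * (LINT x:{-pi..pi}|lborel. cis (of_int (- int n) * x))"
        unfolding f_def set_lebesgue_integral_def by (subst Bochner_Integration.integral_mult_right_zero[symmetric]) (simp add: scaleR_conv_of_real mult_ac)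
      then show ?thesis unfolding integral_cis_int by (simp add: b_def)
    qed
    moreover have "(\<Sum>n. f n x) = indicator {-pi..pi} x *\<^sub>R ((1 + of_real r * cis (- x)) powr of_real a)" for x
    proof -
      have "(\<lambda>n. (complex_of_real a gchoose n) * (of_real r * cis (- x)) ^ n) sums (1 + of_real r * cis (- x)) powr of_real a"
        using r by (intro gen_binomial_complex) (simp add: norm_mult)
      moreover have "(complex_of_real a gchoose n) * (of_real r * cis (- x)) ^ n = b n * cis (- (real n * x))" for n
        by (simp add: b_def power_mult_distrib Complex.DeMoivre)
      ultimately have "(\<lambda>n. f n x) sums (indicator {-pi..pi} x *\<^sub>R ((1 + of_real r * cis (- x)) powr of_real a))"
        unfolding f_def by (intro sums_scaleR_right) simp
      then show ?thesis by (simp add: sums_iff)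
    qed
    ultimately have "(\<lambda>n. if n = 0 then complex_of_real (2 * pi) else 0) sums (LINT x:{-pi..pi}|lborel. (1 + of_real r * cis (- x)) powr of_real a)"
      by (simp add: set_lebesgue_integral_def)
    moreover have "(\<lambda>n. if n = 0 then complex_of_real (2 * pi) else 0) sums complex_of_real (2 * pi)"
      using sums_single[of 0 "\<lambda>_. complex_of_real (2 * pi)"] by (simp add: if_distrib cong: if_cong)
    ultimately show ?thesis by (rule sums_unique2)
  qed
  define \<rho> where "\<rho> n = 1 - 1 / real (n + 2)" for n
  have \<rho>: "0 \<le> \<rho> n" "\<rho> n < 1" for n by (auto simp: \<rho>_def field_simps)
  have \<rho>lim: "\<rho> \<longlonglongrightarrow> 1" unfolding \<rho>_def by real_asymp
  define g where "g n x = indicator {-pi..pi} x *\<^sub>R ((1 + of_real (\<rho> n) * cis (- x)) powr complex_of_real a)" for n and x :: real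
  have "(\<lambda>n. integral\<^sup>L lborel (g n)) \<longlonglongrightarrow> (\<integral>x. indicator {-pi..pi} x *\<^sub>R fh_symbol a x \<partial>lborel)"
  proof (rule integral_dominated_convergence)
    show "integrable lborel (\<lambda>x::real. indicator {-pi..pi} x *\<^sub>R 2 powr a)" by simp
    show "g n \<in> borel_measurable lborel" for n unfolding g_def [abs_def] by measurable
    show "AE x in lborel. (\<lambda>n. g n x) \<longlonglongrightarrow> indicator {-pi..pi} x *\<^sub>R fh_symbol a x"
      using AE_lborel_singleton[of pi] AE_lborel_singleton[of "- pi"]
    proof eventually_elim
      case (elim x)
      show ?case
      proof (cases "x \<in> {-pi..pi}")
        case True
        then have x: "x \<in> {-pi<..<pi}" using elim by auto
        have "Re (1 + cis (- x)) > 0"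
        proof -
          have "cos (x / 2) > 0" using x by (intro cos_gt_zero_pi) auto
          moreover have "cos x = 2 * (cos (x / 2))\<^sup>2 - 1" using cos_double_cos[of "x / 2"] by simp
          ultimately show ?thesis by simp
        qed
        then have "1 + cis (- x) \<notin> \<real>\<^sub>\<le>\<^sub>0" by (auto elim!: nonpos_Reals_cases simp: complex_eq_iff)
        moreover have "(\<lambda>n. 1 + of_real (\<rho> n) * cis (- x)) \<longlonglongrightarrow> 1 + of_real 1 * cis (- x)"
          by (intro tendsto_intros \<rho>lim)
        ultimately have "(\<lambda>n. (1 + of_real (\<rho> n) * cis (- x)) powr complex_of_real a) \<longlonglongrightarrow> (1 + cis (- x)) powr complex_of_real a"
          by (intro tendsto_powr_complex tendsto_const) simp_all
        then show ?thesis using True powr_eq_fh_symbol[OF x, of a] by (simp add: g_def)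
      qed (simp add: g_def)
    qed
    show "AE x in lborel. norm (g n x) \<le> indicator {-pi..pi} x *\<^sub>R 2 powr a" for n
    proof (rule AE_I2)
      fix x :: real
      have "cmod (1 + of_real (\<rho> n) * cis (- x)) \<le> 1 + \<rho> n"
        using norm_triangle_ineq[of 1 "of_real (\<rho> n) * cis (- x)"] \<rho>[of n] by (simp add: norm_mult)
      then have "cmod (1 + of_real (\<rho> n) * cis (- x)) powr a \<le> 2 powr a"
        using \<rho>[of n] a by (intro powr_mono2) auto
      then show "norm (g n x) \<le> indicator {-pi..pi} x *\<^sub>R 2 powr a"
        by (auto simp: g_def norm_powr_real_powr' indicator_def)
    qed
  qed (measurable)
  moreover have "integral\<^sup>L lborel (g n) = of_real (2 * pi)" for n
    using mean[OF \<rho>, of n] by (simp add: g_def [abs_def] set_lebesgue_integral_def)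
  ultimately have "(\<integral>x. indicator {-pi..pi} x *\<^sub>R fh_symbol a x \<partial>lborel) = of_real (2 * pi)"
    by (simp add: LIMSEQ_const_iff)
  then show ?thesis by (simp add: fh_coeff_def set_lebesgue_integral_def)
qed

text \<open>The two relations between the exponents a and a + 1 combine into the recursion of the
  binomial coefficients. At j = 0 it forces the coefficient of index -1, hence all negative ones, to
  vanish. The constant term is borrowed from a + 1 > 0.\<close>

lemma fh_coeff_eq:
  assumes a: "a > -1"
  shows "fh_coeff a j = of_real (2 * pi * binom_coeff a j)"
proof -
  have rec: "of_int j * fh_coeff a j = of_real (a + 1 - of_int j) * fh_coeff a (j - 1)" for j
    using fh_coeff_rec[OF a, of j] fh_coeff_Suc[OF a, of j] by (simp add: algebra_simps)
  have neg1: "fh_coeff a (- 1) = 0"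
    using rec[of 0] a by (simp del: of_real_add add: complex_eq_iff) 
  have "fh_coeff a 0 = fh_coeff (a + 1) 0" using fh_coeff_Suc[OF a, of 0] neg1 by simp
  then have zero: "fh_coeff a 0 = of_real (2 * pi)" using fh_coeff_0_pos[of "a + 1"] a by simp
  show ?thesis
  proof (cases "j < 0")
    case True
    have "fh_coeff a (- 1 - int n) = 0" for n
    proof (induction n)
      case (Suc n)
      have "of_real (a + 1 - of_int (- 1 - int n)) * fh_coeff a (- 1 - int n - 1) = 0"
        using rec[of "- 1 - int n"] Suc by simp
      moreover have "complex_of_real (a + 1 - of_int (- 1 - int n)) \<noteq> 0"
        using a unfolding of_real_eq_0_iff by simp
      moreover have "- 1 - int n - 1 = - 1 - int (Suc n)" by simp
      ultimately show ?case by (metis mult_eq_0_iff)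
    qed (use neg1 in simp)
    from this[of "nat (- 1 - j)"] show ?thesis using True by (simp add: binom_coeff_def)
  next
    case False
    have "fh_coeff a (int n) = of_real (2 * pi * binom_coeff a (int n))" for n
    proof (induction n)
      case 0
      then show ?case using zero by (simp add: binom_coeff_def)
    next
      case (Suc n)
      have "of_int (int (Suc n)) * fh_coeff a (int (Suc n)) = of_real (a + 1 - of_int (int (Suc n))) * of_real (2 * pi * binom_coeff a (int n))"
        using rec[of "int (Suc n)"] Suc by simp
      also have "\<dots> = complex_of_real (2 * pi * ((a + 1 - of_int (int (Suc n))) * binom_coeff a (int (Suc n) - 1)))"
        by simp
      also have "\<dots> = of_int (int (Suc n)) * of_real (2 * pi * binom_coeff a (int (Suc n)))"
        unfolding binom_coeff_rec[symmetric] by (simp del: of_nat_Suc)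
      finally show ?case by (simp del: of_nat_Suc)
    qed
    from this[of "nat j"] show ?thesis using False by simp
  qed
qed

text \<open>Integrating against zeta^k extracts the coefficient at zeta^(-k), whence the
  sign.\<close>

lemma integral_fh_symbol_exp:
  fixes t :: real
  assumes a: "a > -1"
  shows "(LINT x:{-pi..pi}|lborel. fh_symbol a x * exp (of_real t * cis x) * cis (of_int k * x)) = of_real (2 * pi * toep_entry a (- k) t)"
proof -
  have "(\<lambda>n. of_real t ^ n / fact n * (LINT x:{-pi..pi}|lborel. (fh_symbol a x * cis (of_int k * x)) * cis (real n * x))) sums
     (LINT x:{-pi..pi}|lborel. (fh_symbol a x * cis (of_int k * x)) * exp (of_real t * cis x))"
    by (intro exp_cis_integral_series set_integrable_mult_cis set_integrable_fh_symbol a)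
  moreover have "(LINT x:{-pi..pi}|lborel. (fh_symbol a x * cis (of_int k * x)) * cis (real n * x)) = of_real (2 * pi * binom_coeff a (int n - (- k)))" for n
    using fh_coeff_eq[OF a, of "int n + k"] by (simp add: fh_coeff_def mult.assoc cis_mult algebra_simps)
  ultimately have "(\<lambda>n. of_real t ^ n / fact n * of_real (2 * pi * binom_coeff a (int n - (- k)))) sums
     (LINT x:{-pi..pi}|lborel. (fh_symbol a x * cis (of_int k * x)) * exp (of_real t * cis x))" by simp
  moreover have "(\<lambda>n. complex_of_real (2 * pi * (binom_coeff a (int n - (- k)) / fact n * t ^ n))) sums of_real (2 * pi * toep_entry a (- k) t)"
    unfolding sums_of_real_iff by (intro sums_mult toep_entry_sums)
  moreover have "(\<lambda>n. of_real t ^ n / fact n * of_real (2 * pi * binom_coeff a (int n - (- k)))) =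
     (\<lambda>n. complex_of_real (2 * pi * (binom_coeff a (int n - (- k)) / fact n * t ^ n)))"
    by (rule ext) simp
  ultimately have "(LINT x:{-pi..pi}|lborel. (fh_symbol a x * cis (of_int k * x)) * exp (of_real t * cis x)) = of_real (2 * pi * toep_entry a (- k) t)"
    by (simp only: sums_unique2)
  then show ?thesis by (simp add: mult_ac)
qed

section \<open>The circular integral\<close>

text \<open>Right multiplication by the unit upper triangular matrix of coefficients of the Newton
  polynomials, with roots x 0, ..., x (k - 1), makes the matrix lower triangular.\<close>

lemma det_vandermonde:
  fixes x :: "nat \<Rightarrow> 'a::idom"
  shows "det (mat n n (\<lambda>(j, k). x j ^ k)) = (\<Prod>k<n. \<Prod>i<k. (x k - x i))"
proof -
  define p where "p k = (\<Prod>i<k. [:- x i, 1:])" for k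
  have deg: "Polynomial.degree (p k) = k" for k
    unfolding p_def by (subst degree_prod_eq_sum_degree) auto
  have "lead_coeff (p k) = 1" for k unfolding p_def by (simp add: lead_coeff_prod)
  from this[unfolded deg] have coeff_p: "Polynomial.coeff (p k) k = 1" for k .
  have poly_p: "poly (p k) y = (\<Prod>i<k. (y - x i))" for k y by (simp add: p_def poly_prod)
  define V where "V = mat n n (\<lambda>(j, k). x j ^ k)"
  define C where "C = mat n n (\<lambda>(l, k). Polynomial.coeff (p k) l)"
  have V: "V \<in> carrier_mat n n" and C: "C \<in> carrier_mat n n" by (simp_all add: V_def C_def)
  have "upper_triangular C" by (auto simp: upper_triangular_def C_def deg intro!: coeff_eq_0)
  then have detC: "det C = 1"
    using C coeff_p by (subst det_upper_triangular[OF _ C]) (auto simp: prod_list_diag_prod C_def)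
  have VC: "(V * C) $$ (j, k) = (\<Prod>i<k. (x j - x i))" if "j < n" "k < n" for j k
  proof -
    have "(V * C) $$ (j, k) = (\<Sum>l\<in>{0..<n}. x j ^ l * Polynomial.coeff (p k) l)"
      using that by (simp add: V_def C_def scalar_prod_def)
    also have "\<dots> = (\<Sum>l\<le>k. Polynomial.coeff (p k) l * x j ^ l)"
      using that deg[of k] by (intro sum.mono_neutral_cong_right) (auto simp: mult.commute coeff_eq_0)
    also have "\<dots> = poly (p k) (x j)" using deg[of k] by (simp add: poly_altdef)
    finally show ?thesis by (simp add: poly_p)
  qed
  have "det (V * C) = prod_list (diag_mat (V * C))"
  proof (rule det_lower_triangular)
    show "(V * C) $$ (i, j) = 0" if "i < j" "j < n" for i j
      using that by (subst VC) auto
  qed (use V C in auto)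
  also have "\<dots> = (\<Prod>k<n. \<Prod>i<k. (x k - x i))"
  proof -
    have "dim_row (V * C) = n" by (simp add: V_def)
    then show ?thesis by (simp add: prod_list_diag_prod VC atLeast0LessThan del: index_mult_mat)
  qed
  finally show ?thesis using det_mult[OF V C] detC by (simp add: V_def)
qed

lemma vandermonde_norm_squared:
  fixes x :: "nat \<Rightarrow> complex"
  shows "complex_of_real (\<Prod>j<N. \<Prod>l\<in>{j<..<N}. (cmod (x l - x j))\<^sup>2) =
    det (mat N N (\<lambda>(j, k). x j ^ k)) * cnj (det (mat N N (\<lambda>(j, k). x j ^ k)))"
proof -
  have "(\<Prod>j<N. \<Prod>l\<in>{j<..<N}. (cmod (x l - x j))\<^sup>2) = (\<Prod>j\<in>{..<N}. \<Prod>l\<in>{l. l \<in> {..<N} \<and> j < l}. (cmod (x l - x j))\<^sup>2)"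
    by (intro prod.cong) auto
  also have "\<dots> = (\<Prod>l\<in>{..<N}. \<Prod>j\<in>{j. j \<in> {..<N} \<and> j < l}. (cmod (x l - x j))\<^sup>2)"
    by (rule prod.swap_restrict) auto
  also have "\<dots> = (\<Prod>l<N. \<Prod>j<l. (cmod (x l - x j))\<^sup>2)"
    by (intro prod.cong) auto
  also have "\<dots> = (cmod (det (mat N N (\<lambda>(j, k). x j ^ k))))\<^sup>2"
    unfolding det_vandermonde prod_norm[symmetric] by (simp add: prod_power_distrib)
  finally show ?thesis by (simp only: complex_norm_square)
qed

text \<open>Heine's identity: expand both Vandermonde determinants and integrate factor by factor.\<close>

lemma toeplitz_integral:
  fixes f :: "real \<Rightarrow> complex"
  assumes f: "set_integrable lborel {-pi..pi} f"
  defines "c k \<equiv> (LINT x:{-pi..pi}|lborel. f x * cis (of_int k * x))"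
  shows "(LINT \<theta>:PiE {..<N} (\<lambda>_. {-pi..pi})|PiM {..<N} (\<lambda>_. lborel).
      (\<Prod>j<N. f (\<theta> j)) * complex_of_real (\<Prod>j<N. \<Prod>l\<in>{j<..<N}. (cmod (cis (\<theta> l) - cis (\<theta> j)))\<^sup>2)) =
    fact N * det (mat N N (\<lambda>(i, k). c (int i - int k)))"
proof -
  interpret product_sigma_finite "\<lambda>_::nat. lborel :: real measure" by standard
  let ?P = "{p. p permutes {0..<N}}"
  define sg :: "(nat \<Rightarrow> nat) \<Rightarrow> complex" where "sg p = signof p" for p
  define h where "h k x = indicator {-pi..pi} x *\<^sub>R (f x * cis (of_int k * x))" for k and x :: real
  have h: "integrable lborel (h k)" for k
    unfolding h_def using set_integrable_mult_cis[OF f] by (simp add: set_integrable_def)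
  have hc: "integral\<^sup>L lborel (h k) = c k" for k by (simp add: h_def [abs_def] c_def set_lebesgue_integral_def)
  have expand: "indicator (PiE {..<N} (\<lambda>_. {-pi..pi})) \<theta> *\<^sub>R
      ((\<Prod>j<N. f (\<theta> j)) * complex_of_real (\<Prod>j<N. \<Prod>l\<in>{j<..<N}. (cmod (cis (\<theta> l) - cis (\<theta> j)))\<^sup>2))
    = (\<Sum>p\<in>?P. \<Sum>q\<in>?P. sg p * sg q * (\<Prod>j<N. h (int (p j) - int (q j)) (\<theta> j)))"
    if \<theta>: "\<theta> \<in> space (PiM {..<N} (\<lambda>_. lborel))" for \<theta> :: "nat \<Rightarrow> real"
  proof -
    \<comment> \<open>The indicator of the cube has to split for the integrand to factor. Points of
      the product space are extensional, so membership is decided coordinatewise.\<close>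
    have ind: "complex_of_real (indicator (PiE {..<N} (\<lambda>_. {-pi..pi})) \<theta>) = (\<Prod>j<N. complex_of_real (indicator {-pi..pi} (\<theta> j)))"
    proof (cases "\<theta> \<in> PiE {..<N} (\<lambda>_. {-pi..pi})")
      case True
      have "\<theta> j \<in> {-pi..pi}" if "j < N" for j using PiE_mem[OF True, of j] that by simp
      then have "(\<Prod>j<N. complex_of_real (indicator {-pi..pi} (\<theta> j))) = 1" by (intro prod.neutral) simp
      then show ?thesis unfolding indicator_simps(1)[OF True] by simp
    next
      case False
      have "\<theta> \<in> extensional {..<N}" using \<theta> by (simp add: space_PiM PiE_def)
      then obtain j where "j < N" "\<theta> j \<notin> {-pi..pi}" using False unfolding PiE_iff by blast
      then have "(\<Prod>j<N. complex_of_real (indicator {-pi..pi} (\<theta> j))) = 0"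
        by (intro prod_zero bexI[of _ j]) (simp_all only: indicator_simps finite_lessThan lessThan_iff of_real_0 not_False_eq_True)
      then show ?thesis unfolding indicator_simps(2)[OF False] by simp
    qed
    have D: "det (mat N N (\<lambda>(j, k). cis (\<theta> j) ^ k)) = (\<Sum>p\<in>?P. sg p * (\<Prod>j<N. cis (real (p j) * \<theta> j)))"
      by (subst det_def'[of _ N])
         (auto simp: sg_def atLeast0LessThan Complex.DeMoivre intro!: sum.cong prod.cong arg_cong2[where f = "(*)"] dest: permutes_in_image)
    then have D': "cnj (det (mat N N (\<lambda>(j, k). cis (\<theta> j) ^ k))) = (\<Sum>q\<in>?P. sg q * (\<Prod>j<N. cis (- (real (q j) * \<theta> j))))"
      by (simp add: cis_cnj sg_def)
    have "indicator (PiE {..<N} (\<lambda>_. {-pi..pi})) \<theta> *\<^sub>R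
      ((\<Prod>j<N. f (\<theta> j)) * complex_of_real (\<Prod>j<N. \<Prod>l\<in>{j<..<N}. (cmod (cis (\<theta> l) - cis (\<theta> j)))\<^sup>2))
     = (\<Prod>j<N. complex_of_real (indicator {-pi..pi} (\<theta> j)) * f (\<theta> j)) *
        ((\<Sum>p\<in>?P. sg p * (\<Prod>j<N. cis (real (p j) * \<theta> j))) * (\<Sum>q\<in>?P. sg q * (\<Prod>j<N. cis (- (real (q j) * \<theta> j)))))"
      unfolding vandermonde_norm_squared D' scaleR_conv_of_real ind prod.distrib unfolding D by (simp only: mult.assoc)
    also have "\<dots> = (\<Sum>p\<in>?P. \<Sum>q\<in>?P. (\<Prod>j<N. complex_of_real (indicator {-pi..pi} (\<theta> j)) * f (\<theta> j)) *
        ((sg p * (\<Prod>j<N. cis (real (p j) * \<theta> j))) * (sg q * (\<Prod>j<N. cis (- (real (q j) * \<theta> j))))))"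
      unfolding sum_product by (simp only: sum_distrib_left)
    also have "\<dots> = (\<Sum>p\<in>?P. \<Sum>q\<in>?P. sg p * sg q * (\<Prod>j<N. h (int (p j) - int (q j)) (\<theta> j)))"
    proof (intro sum.cong refl)
      fix p q
      have hh: "h (int (p j) - int (q j)) (\<theta> j) = (complex_of_real (indicator {-pi..pi} (\<theta> j)) * f (\<theta> j)) * (cis (real (p j) * \<theta> j) * cis (- (real (q j) * \<theta> j)))" for j
        by (simp add: h_def scaleR_conv_of_real cis_mult algebra_simps)
      show "(\<Prod>j<N. complex_of_real (indicator {-pi..pi} (\<theta> j)) * f (\<theta> j)) *
        ((sg p * (\<Prod>j<N. cis (real (p j) * \<theta> j))) * (sg q * (\<Prod>j<N. cis (- (real (q j) * \<theta> j))))) =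
        sg p * sg q * (\<Prod>j<N. h (int (p j) - int (q j)) (\<theta> j))"
        unfolding hh by (simp add: prod.distrib)
    qed
    finally show ?thesis .
  qed
  have int: "integrable (PiM {..<N} (\<lambda>_. lborel)) (\<lambda>\<theta>. \<Prod>j<N. h (int (p j) - int (q j)) (\<theta> j))" for p q
    by (rule product_integrable_prod) (auto intro: h)
  have "(LINT \<theta>:PiE {..<N} (\<lambda>_. {-pi..pi})|PiM {..<N} (\<lambda>_. lborel).
      (\<Prod>j<N. f (\<theta> j)) * complex_of_real (\<Prod>j<N. \<Prod>l\<in>{j<..<N}. (cmod (cis (\<theta> l) - cis (\<theta> j)))\<^sup>2)) =
    (\<integral>\<theta>. (\<Sum>p\<in>?P. \<Sum>q\<in>?P. sg p * sg q * (\<Prod>j<N. h (int (p j) - int (q j)) (\<theta> j))) \<partial>PiM {..<N} (\<lambda>_. lborel))"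
    unfolding set_lebesgue_integral_def by (rule Bochner_Integration.integral_cong[OF refl expand])
  also have "\<dots> = (\<Sum>p\<in>?P. \<Sum>q\<in>?P. sg p * sg q * (\<integral>\<theta>. (\<Prod>j<N. h (int (p j) - int (q j)) (\<theta> j)) \<partial>PiM {..<N} (\<lambda>_. lborel)))"
    using int by (subst Bochner_Integration.integral_sum; (subst Bochner_Integration.integral_sum)?) (auto intro!: Bochner_Integration.integrable_sum)
  also have "\<dots> = (\<Sum>p\<in>?P. \<Sum>q\<in>?P. sg p * sg q * (\<Prod>j\<in>{0..<N}. c (int (p j) - int (q j))))"
  proof (intro sum.cong refl arg_cong2[where f = "(*)"])
    fix p q
    show "(\<integral>\<theta>. (\<Prod>j<N. h (int (p j) - int (q j)) (\<theta> j)) \<partial>PiM {..<N} (\<lambda>_. lborel)) = (\<Prod>j\<in>{0..<N}. c (int (p j) - int (q j)))"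
      unfolding atLeast0LessThan by (subst product_integral_prod) (auto intro: h simp: hc)
  qed
  \<comment> \<open>Writing q = r \<circ> p and reindexing the product by p, every p contributes the
    same determinant.\<close>
  also have "\<dots> = (\<Sum>p\<in>?P. det (mat N N (\<lambda>(i, k). c (int i - int k))))"
  proof (rule sum.cong[OF refl])
    fix p assume "p \<in> ?P"
    then have p: "p permutes {0..<N}" by simp
    have "(\<Sum>q\<in>?P. sg p * sg q * (\<Prod>j\<in>{0..<N}. c (int (p j) - int (q j)))) =
       (\<Sum>r\<in>?P. sg p * sg (r \<circ> p) * (\<Prod>j\<in>{0..<N}. c (int (p j) - int ((r \<circ> p) j))))"
      by (rule sum_permutations_compose_right[OF p])
    also have "\<dots> = (\<Sum>r\<in>?P. sg r * (\<Prod>i\<in>{0..<N}. c (int i - int (r i))))"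
    proof (rule sum.cong[OF refl])
      fix r assume "r \<in> ?P"
      then have r: "r permutes {0..<N}" by simp
      have "sg p * sg (r \<circ> p) = sg r"
      proof -
        have "sg (r \<circ> p) = sg r * sg p"
          unfolding sg_def by (rule signof_compose[OF r p])
        moreover have "sg p * sg p = 1" by (simp add: sg_def flip: of_int_mult)
        ultimately show ?thesis by (simp add: mult_ac)
      qed
      moreover have "(\<Prod>j\<in>{0..<N}. c (int (p j) - int ((r \<circ> p) j))) = (\<Prod>i\<in>{0..<N}. c (int i - int (r i)))"
        using prod.permute[OF p, of "\<lambda>i. c (int i - int (r i))"] by (simp add: comp_def)
      ultimately show "sg p * sg (r \<circ> p) * (\<Prod>j\<in>{0..<N}. c (int (p j) - int ((r \<circ> p) j))) = sg r * (\<Prod>i\<in>{0..<N}. c (int i - int (r i)))"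
        by (simp only:)
    qed
    also have "\<dots> = det (mat N N (\<lambda>(i, k). c (int i - int k)))"
      by (subst det_def'[of _ N]) (auto simp: sg_def intro!: sum.cong prod.cong arg_cong2[where f = "(*)"] dest: permutes_in_image)
    finally show "(\<Sum>q\<in>?P. sg p * sg q * (\<Prod>j\<in>{0..<N}. c (int (p j) - int (q j)))) = det (mat N N (\<lambda>(i, k). c (int i - int k)))" .
  qed
  also have "\<dots> = fact N * det (mat N N (\<lambda>(i, k). c (int i - int k)))"
    by (simp add: card_permutations)
  finally show ?thesis .
qed

lemma set_integrable_fh_symbol_exp:
  assumes "a > -1"
  shows "set_integrable lborel {-pi..pi} (\<lambda>x. fh_symbol a x * exp (of_real t * cis x))"
  unfolding set_integrable_def
proof (rule Bochner_Integration.integrable_bound)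
  have [measurable]: "(\<lambda>x. cis x) \<in> borel_measurable borel"
    by (intro borel_measurable_continuous_onI continuous_intros)
  show "integrable lborel (\<lambda>x. exp \<bar>t\<bar> *\<^sub>R (indicator {-pi..pi} x *\<^sub>R fh_symbol a x))"
    using set_integrable_fh_symbol[OF assms] by (intro integrable_scaleR_right) (simp add: set_integrable_def)
  show "(\<lambda>x. indicator {-pi..pi} x *\<^sub>R (fh_symbol a x * exp (of_real t * cis x))) \<in> borel_measurable lborel"
    by measurable
  show "AE x in lborel. norm (indicator {-pi..pi} x *\<^sub>R (fh_symbol a x * exp (of_real t * cis x)))
     \<le> norm (exp \<bar>t\<bar> *\<^sub>R (indicator {-pi..pi} x *\<^sub>R fh_symbol a x))"
  proof (rule AE_I2)
    fix x :: real
    have "t * cos x \<le> \<bar>t\<bar> * 1" using mult_mono[of "\<bar>t\<bar>" "\<bar>t\<bar>" "\<bar>cos x\<bar>" 1] abs_ge_self[of "t * cos x"] by (simp add: abs_mult)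
    then have "norm (exp (of_real t * cis x)) \<le> exp \<bar>t\<bar>" by (simp add: norm_exp)
    then have "norm (exp (of_real t * cis x)) * cmod (fh_symbol a x) \<le> exp \<bar>t\<bar> * cmod (fh_symbol a x)"
      by (rule mult_right_mono) simp
    then show "norm (indicator {-pi..pi} x *\<^sub>R (fh_symbol a x * exp (of_real t * cis x)))
     \<le> norm (exp \<bar>t\<bar> *\<^sub>R (indicator {-pi..pi} x *\<^sub>R fh_symbol a x))"
      by (simp add: norm_mult mult.commute indicator_def)
  qed
qed

lemma circular_integral_eq_det:
  fixes \<gamma> t :: real
  assumes "\<gamma> > -2"
  shows "(LINT \<theta>:PiE {..<N} (\<lambda>_. {-pi..pi})|PiM {..<N} (\<lambda>_. lborel).
      (\<Prod>j<N. cis (- \<gamma> * \<theta> j / 4) * complex_of_real (cmod (1 + cis (\<theta> j)) powr (\<gamma> / 2)) * exp (complex_of_real t * cis (\<theta> j)))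
       * complex_of_real (\<Prod>j<N. \<Prod>l\<in>{j<..<N}. (cmod (cis (\<theta> l) - cis (\<theta> j)))\<^sup>2)) =
    of_real (fact N * (2 * pi) ^ N * det (toep_mat (\<gamma> / 2) N t))"
proof -
  have a: "\<gamma> / 2 > -1" using assms by simp
  define f where "f x = fh_symbol (\<gamma> / 2) x * exp (of_real t * cis x)" for x
  have f_eq: "cis (- \<gamma> * x / 4) * complex_of_real (cmod (1 + cis x) powr (\<gamma> / 2)) * exp (complex_of_real t * cis x) = f x" for x
    by (simp add: f_def fh_symbol_def)
  interpret of_real_hom: comm_ring_hom complex_of_real by unfold_locales auto
  have "mat N N (\<lambda>(i, k). complex_of_real (2 * pi * toep_entry (\<gamma> / 2) (- (int i - int k)) t)) =
      map_mat complex_of_real ((2 * pi) \<cdot>\<^sub>m toep_mat (\<gamma> / 2) N t)"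
    by (rule eq_matI) (auto simp: toep_mat_def)
  then have "det (mat N N (\<lambda>(i, k). complex_of_real (2 * pi * toep_entry (\<gamma> / 2) (- (int i - int k)) t))) =
     of_real ((2 * pi) ^ N * det (toep_mat (\<gamma> / 2) N t))"
    by (simp only: of_real_hom.hom_det det_smult) (simp add: toep_mat_def)
  moreover have "(LINT x:{-pi..pi}|lborel. f x * cis (of_int k * x)) = of_real (2 * pi * toep_entry (\<gamma> / 2) (- k) t)" for k
    unfolding f_def by (rule integral_fh_symbol_exp[OF a])
  ultimately show ?thesis
    unfolding f_eq
    using toeplitz_integral[OF set_integrable_fh_symbol_exp[OF a, of t], of N, folded f_def]
    by (simp only: of_real_mult of_real_fact mult.assoc)
qed

section \<open>The Gaussian moments\<close>

text \<open>Provides the continuity and Lipschitz assumptions of the end point asymptotics: an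
  entire function has bounded derivative on a compact interval.\<close>

lemma power_series_regular:
  fixes g :: "nat \<Rightarrow> real" and t :: real
  assumes t: "t \<ge> 0" and summ: "\<And>x. summable (\<lambda>n. g n * x ^ n)"
  defines "F x \<equiv> exp (- x) * (\<Sum>n. g n * x ^ n)"
  shows "continuous_on {0..t} F" "\<exists>C. \<forall>x\<in>{0..t}. \<bar>F x - F t\<bar> \<le> C * (t - x)"
proof -
  have summ': "summable (\<lambda>n. diffs g n * x ^ n)" for x
    by (rule termdiff_converges_all) (rule summ)
  have der: "((\<lambda>x. \<Sum>n. g n * x ^ n) has_real_derivative (\<Sum>n. diffs g n * x ^ n)) (at x)" for x
    by (rule termdiffs_strong_converges_everywhere) (rule summ)
  have der': "((\<lambda>x. \<Sum>n. diffs g n * x ^ n) has_real_derivative (\<Sum>n. diffs (diffs g) n * x ^ n)) (at x)" for x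
    by (rule termdiffs_strong_converges_everywhere) (rule summ')
  define F' where "F' x = exp (- x) * (\<Sum>n. diffs g n * x ^ n) - exp (- x) * (\<Sum>n. g n * x ^ n)" for x
  have dF: "(F has_real_derivative F' x) (at x)" for x
    unfolding F_def [abs_def] F'_def by (auto intro!: derivative_eq_intros der)
  have cont: "continuous_on {0..t} (\<lambda>x. \<Sum>n. diffs g n * x ^ n)" "continuous_on {0..t} (\<lambda>x. \<Sum>n. g n * x ^ n)"
    by (auto intro!: continuous_at_imp_continuous_on DERIV_isCont der der')
  show "continuous_on {0..t} F" unfolding F_def [abs_def] by (intro continuous_intros cont)
  have "continuous_on {0..t} F'" unfolding F'_def by (intro continuous_intros cont)
  then have "bounded (F' ` {0..t})" by (intro compact_imp_bounded compact_continuous_image) auto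
  then obtain C where "\<forall>y\<in>F' ` {0..t}. norm y \<le> C" unfolding bounded_iff by blast
  then have C: "norm (F' x) \<le> C" if "x \<in> {0..t}" for x using that by blast
  have "\<bar>F x - F t\<bar> \<le> C * (t - x)" if "x \<in> {0..t}" for x
  proof -
    have "norm (F x - F t) \<le> C * norm (x - t)"
      by (rule field_differentiable_bound[of "{0..t}" F F']) (use dF C that t in \<open>auto intro: DERIV_subset\<close>)
    then show ?thesis using that by auto
  qed
  then show "\<exists>C. \<forall>x\<in>{0..t}. \<bar>F x - F t\<bar> \<le> C * (t - x)" by blast
qed

lemma summable_Gamma_fact_squared:
  fixes b x :: real
  assumes "b > 0"
  shows "summable (\<lambda>n. Gamma (b + real n) / (fact n)\<^sup>2 * x ^ n)"
  using sums_summable[OF toep_entry_kummer[of "b - 1" 0 x]] assms by simp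

text \<open>The moment of order 2 \<alpha> of |det| for the unscaled Gaussian matrix, that is
  \<open>R_gamma0\<close> without its power of N.\<close>

definition moment_const :: "real \<Rightarrow> nat \<Rightarrow> real" where
  "moment_const \<alpha> N = (\<Prod>j<N. Gamma (\<alpha> + real j + 1) / fact j)"

text \<open>The variable is \<open>x = t * v\<^sup>2\<close> with \<open>t = \<bar>w\<bar>\<^sup>2\<close>, so that \<open>x = t\<close> is the scalar shift.\<close>

lemma shifted_moment_structure:
  fixes w :: complex and \<alpha> :: real
  assumes \<alpha>: "\<alpha> > -1" and w: "w \<noteq> 0"
  defines "t \<equiv> (cmod w)\<^sup>2"
  shows "\<exists>F. (\<forall>x\<in>{0..t}. shifted_moment m w \<alpha> (sqrt (x / t)) = ennreal (F x) \<and> F x > 0) \<and>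
     continuous_on {0..t} F \<and> (\<exists>C. \<forall>x\<in>{0..t}. \<bar>F x - F t\<bar> \<le> C * (t - x)) \<and>
     (\<exists>d. \<forall>x\<in>{0..t}. (t - x) ^ m * F x = (\<Sum>k<Suc m. d k * toep_entry \<alpha> (int k) x)) \<and>
     F t = moment_const \<alpha> (Suc m) * det (toep_mat \<alpha> (Suc m) t)"
proof (induction m)
  have t: "t > 0" using w by (simp add: t_def)
  have sx: "(cmod w * sqrt (x / t))\<^sup>2 = x" if "x \<in> {0..t}" for x
    using that t by (simp add: power_mult_distrib t_def[symmetric])
  {
    case 0
    define g where "g n = Gamma (\<alpha> + 1 + real n) / (fact n)\<^sup>2" for n
    define F where "F x = exp (- x) * (\<Sum>n. g n * x ^ n)" for x
    have gpos: "g n > 0" for n using \<alpha> by (auto simp: g_def intro!: divide_pos_pos Gamma_real_pos)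
    have gnonneg: "g n \<ge> 0" for n using gpos[of n] by simp
    have summ: "summable (\<lambda>n. g n * x ^ n)" for x
      unfolding g_def using \<alpha> by (intro summable_Gamma_fact_squared) simp
    have F_eq: "F x = Gamma (\<alpha> + 1) * toep_entry \<alpha> 0 x" for x
      using toep_entry_kummer[OF \<alpha>, of 0 x] by (simp add: F_def g_def sums_iff exp_minus)
    have "shifted_moment 0 w \<alpha> (sqrt (x / t)) = ennreal (F x) \<and> F x > 0" if x: "x \<in> {0..t}" for x
    proof
      have eq: "exp (- x) * x ^ n / (fact n)\<^sup>2 * Gamma (\<alpha> + 1 + real n) = exp (- x) * (g n * x ^ n)" for n
        by (simp add: g_def)
      have "shifted_moment 0 w \<alpha> (sqrt (x / t)) = (\<Sum>n. ennreal (exp (- x) * (g n * x ^ n)))"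
        unfolding shifted_moment_0[OF \<alpha>] sx[OF x] eq ..
      also have "\<dots> = ennreal (\<Sum>n. exp (- x) * (g n * x ^ n))"
        using x gnonneg summ by (intro suminf_ennreal2 summable_mult) (auto intro!: mult_nonneg_nonneg)
      also have "(\<Sum>n. exp (- x) * (g n * x ^ n)) = F x" unfolding F_def by (rule suminf_mult[OF summ])
      finally show "shifted_moment 0 w \<alpha> (sqrt (x / t)) = ennreal (F x)" .
      have "0 < (\<Sum>n. g n * x ^ n)"
        using x gpos gnonneg by (intro suminf_pos2[OF summ, of _ 0]) (auto intro!: mult_nonneg_nonneg)
      then show "F x > 0" by (simp add: F_def)
    qed
    moreover have "continuous_on {0..t} F" "\<exists>C. \<forall>x\<in>{0..t}. \<bar>F x - F t\<bar> \<le> C * (t - x)"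
      using power_series_regular[OF _ summ, of t] t unfolding F_def [abs_def] by auto
    moreover have "\<exists>d. \<forall>x\<in>{0..t}. (t - x) ^ 0 * F x = (\<Sum>k<Suc 0. d k * toep_entry \<alpha> (int k) x)"
      by (intro exI[of _ "\<lambda>_. Gamma (\<alpha> + 1)"]) (simp add: F_eq)
    moreover have "F t = moment_const \<alpha> (Suc 0) * det (toep_mat \<alpha> (Suc 0) t)"
      by (subst det_single) (auto simp: F_eq moment_const_def toep_mat_def)
    ultimately show ?case by blast
  next
    case (Suc m)
    then obtain F C d where F: "\<And>x. x \<in> {0..t} \<Longrightarrow> shifted_moment m w \<alpha> (sqrt (x / t)) = ennreal (F x)"
        "\<And>x. x \<in> {0..t} \<Longrightarrow> F x > 0" and cont: "continuous_on {0..t} F"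
        and lip: "\<And>x. x \<in> {0..t} \<Longrightarrow> \<bar>F x - F t\<bar> \<le> C * (t - x)"
        and d: "\<And>x. x \<in> {0..t} \<Longrightarrow> (t - x) ^ m * F x = (\<Sum>k<Suc m. d k * toep_entry \<alpha> (int k) x)"
        and Ft: "F t = moment_const \<alpha> (Suc m) * det (toep_mat \<alpha> (Suc m) t)"
      by blast
    have Fnn: "F x \<ge> 0" if "x \<in> {0..t}" for x using F(2)[OF that] by simp
    define M where "M = Suc m"
    define I where "I n = integral {0..t} (\<lambda>x. x ^ n * (t - x) ^ m * F x)" for n
    have Iint: "((\<lambda>x. x ^ n * (t - x) ^ m * F x) has_integral I n) {0..t}" for n
      unfolding I_def by (intro integrable_integral integrable_continuous_interval continuous_intros cont)
    have Inonneg: "I n \<ge> 0" for n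
      by (rule has_integral_nonneg[OF Iint]) (use Fnn in \<open>auto intro!: mult_nonneg_nonneg\<close>)
    \<comment> \<open>Strict positivity of the coefficient of index 0 makes K positive on all of
      [0, t], including x = 0.\<close>
    have I0: "I 0 > 0"
    proof (rule ccontr)
      assume "\<not> I 0 > 0"
      then have "I 0 = 0" using Inonneg[of 0] by simp
      then have "integral {0..t} (\<lambda>x. (t - x) ^ m * F x) = 0" by (simp add: I_def)
      moreover have "continuous_on {0..t} (\<lambda>x. (t - x) ^ m * F x)" by (intro continuous_intros cont)
      moreover have "0 \<le> (t - x) ^ m * F x" if "x \<in> {0..t}" for x using Fnn[OF that] that by simp
      ultimately have "\<forall>x\<in>{0..t}. (t - x) ^ m * F x = 0"
        using integral_eq_0_iff[of 0 t "\<lambda>x. (t - x) ^ m * F x"] t by blast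
      then have "(t - 0) ^ m * F 0 = 0" using t by auto
      then show False using t F(2)[of 0] by auto
    qed
    define g where "g n = Gamma (\<alpha> + 1 + real M + real n) / (fact n)\<^sup>2 * (I n / t ^ n) / (fact m * t ^ M)" for n
    define K where "K x = exp (- x) * (\<Sum>n. g n * x ^ n)" for x
    have Gpos: "Gamma (\<alpha> + 1 + real M + real n) > 0" for n using \<alpha> by (intro Gamma_real_pos) auto
    have gnonneg: "g n \<ge> 0" for n
      unfolding g_def using Gpos[of n] Inonneg[of n] t by (intro divide_nonneg_nonneg mult_nonneg_nonneg) auto
    have g0: "g 0 > 0" using Gpos[of 0] I0 t by (simp add: g_def)
    \<comment> \<open>The moments are bounded by a constant times t^n, so the coefficients are
      dominated by those of a summable Kummer series.\<close>
    have summ: "summable (\<lambda>n. g n * x ^ n)" for x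
    proof -
      have "bounded (F ` {0..t})" using cont by (intro compact_imp_bounded compact_continuous_image) auto
      then obtain B where "\<forall>y\<in>F ` {0..t}. norm y \<le> B" unfolding bounded_iff by blast
      then have B: "norm (F x) \<le> B" if "x \<in> {0..t}" for x using that by blast
      have In: "I n / t ^ n \<le> t ^ m * B * t" for n
      proof -
        have "norm (I n) \<le> (t ^ n * t ^ m * B) * measure lborel (cbox 0 t)"
        proof (rule has_integral_bound)
          show "0 \<le> t ^ n * t ^ m * B" using B[of 0] t by (intro mult_nonneg_nonneg) auto
          show "((\<lambda>x. x ^ n * (t - x) ^ m * F x) has_integral I n) (cbox 0 t)" using Iint by simp
          show "norm (x ^ n * (t - x) ^ m * F x) \<le> t ^ n * t ^ m * B" if "x \<in> cbox 0 t" for x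
            using that B[of x] by (auto simp: abs_mult intro!: mult_mono power_mono)
        qed
        then show ?thesis using t Inonneg[of n] by (simp add: field_simps)
      qed
      show ?thesis
      proof (rule summable_comparison_test')
        have "0 < \<alpha> + 1 + real M" using \<alpha> by simp
        from summable_mult[OF summable_Gamma_fact_squared[OF this, of "\<bar>x\<bar>"], of "t ^ m * B * t / (fact m * t ^ M)"]
        show "summable (\<lambda>n. t ^ m * B * t / (fact m * t ^ M) * (Gamma (\<alpha> + 1 + real M + real n) / (fact n)\<^sup>2 * \<bar>x\<bar> ^ n))" .
        fix n :: nat
        have "norm (g n * x ^ n) = g n * \<bar>x\<bar> ^ n" using gnonneg[of n] by (simp add: abs_mult power_abs)
        also have "\<dots> = (I n / t ^ n) * (Gamma (\<alpha> + 1 + real M + real n) / (fact n)\<^sup>2 * \<bar>x\<bar> ^ n / (fact m * t ^ M))"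
          by (simp add: g_def mult_ac)
        also have "\<dots> \<le> (t ^ m * B * t) * (Gamma (\<alpha> + 1 + real M + real n) / (fact n)\<^sup>2 * \<bar>x\<bar> ^ n / (fact m * t ^ M))"
          using In[of n] Gpos[of n] t by (intro mult_right_mono divide_nonneg_nonneg mult_nonneg_nonneg) auto
        finally show "norm (g n * x ^ n) \<le> t ^ m * B * t / (fact m * t ^ M) * (Gamma (\<alpha> + 1 + real M + real n) / (fact n)\<^sup>2 * \<bar>x\<bar> ^ n)"
          by (simp add: mult_ac)
      qed
    qed
    \<comment> \<open>Substituting u = y / t turns the integral in the recursion into a moment of F
      on [0, t].\<close>
    have inner: "(\<integral>\<^sup>+u. ennreal (u ^ n * (1 - u) ^ m) * shifted_moment m w \<alpha> (sqrt u) * indicator {0..1} u \<partial>lborel) = ennreal (I n / t ^ n / t ^ M)" for n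
    proof -
      have "(\<integral>\<^sup>+u. ennreal (u ^ n * (1 - u) ^ m) * shifted_moment m w \<alpha> (sqrt u) * indicator {0..1} u \<partial>lborel) =
        ennreal \<bar>1 / t\<bar> * (\<integral>\<^sup>+y. ennreal ((0 + 1 / t * y) ^ n * (1 - (0 + 1 / t * y)) ^ m) * shifted_moment m w \<alpha> (sqrt (0 + 1 / t * y)) * indicator {0..1} (0 + 1 / t * y) \<partial>lborel)"
        using t by (intro nn_integral_real_affine) auto
      also have "(\<integral>\<^sup>+y. ennreal ((0 + 1 / t * y) ^ n * (1 - (0 + 1 / t * y)) ^ m) * shifted_moment m w \<alpha> (sqrt (0 + 1 / t * y)) * indicator {0..1} (0 + 1 / t * y) \<partial>lborel)
        = (\<integral>\<^sup>+y. ennreal (y ^ n * (t - y) ^ m * F y / (t ^ n * t ^ m)) * indicator {0..t} y \<partial>lborel)"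
      proof (rule nn_integral_cong)
        fix y :: real
        show "ennreal ((0 + 1 / t * y) ^ n * (1 - (0 + 1 / t * y)) ^ m) * shifted_moment m w \<alpha> (sqrt (0 + 1 / t * y)) * indicator {0..1} (0 + 1 / t * y)
          = ennreal (y ^ n * (t - y) ^ m * F y / (t ^ n * t ^ m)) * indicator {0..t} y"
        proof (cases "y \<in> {0..t}")
          case True
          have "1 - y / t = (t - y) / t" using t by (simp add: field_simps)
          then have "(y / t) ^ n * (1 - y / t) ^ m * F y = y ^ n * (t - y) ^ m * F y / (t ^ n * t ^ m)"
            by (simp add: power_divide)
          moreover have "(y / t) ^ n * (1 - y / t) ^ m \<ge> 0" using True t by (intro mult_nonneg_nonneg zero_le_power) auto
          ultimately have "ennreal ((y / t) ^ n * (1 - y / t) ^ m) * ennreal (F y) = ennreal (y ^ n * (t - y) ^ m * F y / (t ^ n * t ^ m))"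
            by (metis ennreal_mult')
          then show ?thesis using True t F(1)[OF True] by (simp add: field_simps)
        next
          case False
          then have "0 + 1 / t * y \<notin> {0..1}" using t by (auto simp: field_simps)
          then show ?thesis unfolding indicator_simps(2)[OF False] indicator_simps(2)[OF \<open>0 + 1 / t * y \<notin> {0..1}\<close>] by simp
        qed
      qed
      also have "\<dots> = ennreal (I n / (t ^ n * t ^ m))"
        by (intro nn_integral_has_integral_lebesgue' has_integral_divide Iint)
           (use Fnn t in \<open>auto intro!: divide_nonneg_nonneg mult_nonneg_nonneg\<close>)
      also have "ennreal \<bar>1 / t\<bar> * ennreal (I n / (t ^ n * t ^ m)) = ennreal (I n / t ^ n / t ^ M)"
        using t Inonneg[of n] by (simp add: M_def mult.commute flip: ennreal_mult)
      finally show ?thesis .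
    qed
    have K: "shifted_moment M w \<alpha> (sqrt (x / t)) = ennreal (K x) \<and> K x > 0" if x: "x \<in> {0..t}" for x
    proof
      have "shifted_moment M w \<alpha> (sqrt (x / t)) = (\<Sum>n. ennreal (exp (- x) * x ^ n / (fact n)\<^sup>2 * Gamma (\<alpha> + 1 + real (Suc m) + real n) / fact m) * ennreal (I n / t ^ n / t ^ M))"
        unfolding M_def shifted_moment_recursion[OF \<alpha>] sx[OF x] inner[unfolded M_def] ..
      also have "\<dots> = (\<Sum>n. ennreal (exp (- x) * (g n * x ^ n)))"
      proof (rule suminf_cong)
        fix n
        have "(exp (- x) * x ^ n / (fact n)\<^sup>2 * Gamma (\<alpha> + 1 + real (Suc m) + real n) / fact m) * (I n / t ^ n / t ^ M) = exp (- x) * (g n * x ^ n)"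
          by (simp add: g_def M_def mult_ac)
        then show "ennreal (exp (- x) * x ^ n / (fact n)\<^sup>2 * Gamma (\<alpha> + 1 + real (Suc m) + real n) / fact m) * ennreal (I n / t ^ n / t ^ M) = ennreal (exp (- x) * (g n * x ^ n))"
          using Inonneg[of n] t by (metis divide_nonneg_pos ennreal_mult'' zero_less_power)
      qed
      also have "\<dots> = ennreal (\<Sum>n. exp (- x) * (g n * x ^ n))"
        using x gnonneg summ by (intro suminf_ennreal2 summable_mult) (auto intro!: mult_nonneg_nonneg)
      also have "(\<Sum>n. exp (- x) * (g n * x ^ n)) = K x" unfolding K_def by (rule suminf_mult[OF summ])
      finally show "shifted_moment M w \<alpha> (sqrt (x / t)) = ennreal (K x)" .
      have "0 < (\<Sum>n. g n * x ^ n)"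
        using x gnonneg g0 by (intro suminf_pos2[OF summ, of _ 0]) (auto intro!: mult_nonneg_nonneg)
      then show "K x > 0" by (simp add: K_def)
    qed
    have Kreg: "continuous_on {0..t} K" "\<exists>C. \<forall>x\<in>{0..t}. \<bar>K x - K t\<bar> \<le> C * (t - x)"
      using power_series_regular[OF _ summ, of t] t unfolding K_def [abs_def] by auto
    have series: "(\<lambda>n. (x / t) ^ n * (Gamma (\<alpha> + 1 + real (Suc m) + real n) / (fact n)\<^sup>2) * integral {0..t} (\<lambda>x. x ^ n * (t - x) ^ m * F x))
        sums (exp x * (fact m * t ^ Suc m * K x))" for x
    proof -
      have "exp x * (fact m * t ^ Suc m * K x) = fact m * t ^ M * (\<Sum>n. g n * x ^ n)"
        by (simp add: K_def M_def exp_minus)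
      moreover have "(\<lambda>n. fact m * t ^ M * (g n * x ^ n)) sums (fact m * t ^ M * (\<Sum>n. g n * x ^ n))"
        by (intro sums_mult summable_sums summ)
      moreover have "fact m * t ^ M * (g n * x ^ n) = (x / t) ^ n * (Gamma (\<alpha> + 1 + real (Suc m) + real n) / (fact n)\<^sup>2) * integral {0..t} (\<lambda>x. x ^ n * (t - x) ^ m * F x)" for n
        unfolding I_def[symmetric] using t by (simp add: g_def M_def power_divide mult_ac)
      ultimately show ?thesis by (simp only:)
    qed
    obtain e where e: "e M = Gamma (\<alpha> + real M + 1) * (- 1) ^ M * F t"
        "\<And>x. x \<in> {0..t} \<Longrightarrow> (t - x) ^ M * K x = (\<Sum>k\<le>M. e k * toep_entry \<alpha> (int k) x)"
      using toep_entry_chain_step[OF \<alpha> t cont lip d series] unfolding M_def by blast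
    have "e M * det (toep_mat \<alpha> (Suc M) t) = fact M * (- 1) ^ M * K t * det (toep_mat \<alpha> M t)"
      by (rule det_toep_mat_step[OF t Kreg(1) e(2)])
    then have "(- 1) ^ M * (Gamma (\<alpha> + real M + 1) * F t * det (toep_mat \<alpha> (Suc M) t)) = (- 1) ^ M * (fact M * K t * det (toep_mat \<alpha> M t))"
      by (simp add: e(1) mult_ac)
    then have "Gamma (\<alpha> + real M + 1) * F t * det (toep_mat \<alpha> (Suc M) t) = fact M * K t * det (toep_mat \<alpha> M t)"
      by simp
    \<comment> \<open>Being a positive moment, \<open>F t\<close> is nonzero, and its formula as a
      multiple of the smaller determinant makes that determinant nonzero too.\<close>
    moreover have "F t > 0" using F(2)[of t] t by simp
    then have "det (toep_mat \<alpha> M t) \<noteq> 0" using Ft by (auto simp: M_def)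
    ultimately have "K t = moment_const \<alpha> M * (Gamma (\<alpha> + real M + 1) / fact M) * det (toep_mat \<alpha> (Suc M) t)"
      unfolding Ft M_def[symmetric] by (simp add: field_simps)
    then have "K t = moment_const \<alpha> (Suc M) * det (toep_mat \<alpha> (Suc M) t)"
      by (simp add: moment_const_def)
    moreover have "(\<Sum>k<Suc M. e k * toep_entry \<alpha> (int k) x) = (\<Sum>k\<le>M. e k * toep_entry \<alpha> (int k) x)" for x
      by (simp only: lessThan_Suc_atMost)
    ultimately show ?case using K Kreg e(2) unfolding M_def[symmetric]
      by (intro exI[of _ K] conjI ballI exI[of _ e]) auto
  }
qed

text \<open>At 0 the entry of index k is the binomial coefficient of index -k, so the matrix is
  lower triangular with unit diagonal.\<close>

lemma det_toep_mat_0: "det (toep_mat \<alpha> N 0) = 1"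
proof -
  have "det (toep_mat \<alpha> N 0) = prod_list (diag_mat (toep_mat \<alpha> N 0))"
    by (rule det_lower_triangular[of N]) (auto simp: toep_mat_def toep_entry_0 binom_coeff_def)
  also have "\<dots> = 1"
    by (auto simp: prod_list_diag_prod toep_mat_def toep_entry_0 binom_coeff_def intro!: prod.neutral)
  finally show ?thesis .
qed

text \<open>For w = 0 the variable t v^2 degenerates, which makes this a separate case. Only the
  term n = 0 of the recursion survives; the integral of (1 - u)^m is 1 / (m + 1) and completes m! to
  (m + 1)!.\<close>

lemma shifted_moment_zero:
  assumes \<alpha>: "\<alpha> > -1"
  shows "shifted_moment m 0 \<alpha> v = ennreal (moment_const \<alpha> (Suc m))"
proof (induction m arbitrary: v)
  have single: "(\<Sum>n. if n = 0 then c else 0) = (c :: ennreal)" for c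
    using sums_single[of 0 "\<lambda>_. c"] by (simp add: sums_iff if_distrib cong: if_cong)
  {
    case 0
    have "exp (- (cmod 0 * v)\<^sup>2) * ((cmod 0 * v)\<^sup>2) ^ n / (fact n)\<^sup>2 * Gamma (\<alpha> + 1 + real n) = (if n = 0 then Gamma (\<alpha> + 1) else 0)" for n
      by simp
    then have "shifted_moment 0 0 \<alpha> v = (\<Sum>n. if n = 0 then ennreal (Gamma (\<alpha> + 1)) else 0)"
      unfolding shifted_moment_0[OF \<alpha>] by (auto intro!: suminf_cong)
    then show ?case by (simp add: single moment_const_def)
  next
    case (Suc m)
    have cpos: "moment_const \<alpha> (Suc m) \<ge> 0"
      unfolding moment_const_def using \<alpha> by (intro prod_nonneg divide_nonneg_nonneg ballI less_imp_le[OF Gamma_real_pos]) auto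
    have Gpos: "Gamma (\<alpha> + 1 + real (Suc m)) > 0" using \<alpha> by (intro Gamma_real_pos) auto
    have "exp (- (cmod 0 * v)\<^sup>2) * ((cmod 0 * v)\<^sup>2) ^ n / (fact n)\<^sup>2 * Gamma (\<alpha> + 1 + real (Suc m) + real n) / fact m
        = (if n = 0 then Gamma (\<alpha> + 1 + real (Suc m)) / fact m else 0)" for n by simp
    then have "shifted_moment (Suc m) 0 \<alpha> v = (\<Sum>n. if n = 0 then ennreal (Gamma (\<alpha> + 1 + real (Suc m)) / fact m) *
        (\<integral>\<^sup>+u. ennreal ((1 - u) ^ m) * ennreal (moment_const \<alpha> (Suc m)) * indicator {0..1} u \<partial>lborel) else 0)"
      unfolding shifted_moment_recursion[OF \<alpha>] Suc.IH by (auto intro!: suminf_cong)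
    also have "\<dots> = ennreal (Gamma (\<alpha> + 1 + real (Suc m)) / fact m) *
        (\<integral>\<^sup>+u. ennreal ((1 - u) ^ m) * ennreal (moment_const \<alpha> (Suc m)) * indicator {0..1} u \<partial>lborel)" by (rule single)
    also have "(\<integral>\<^sup>+u. ennreal ((1 - u) ^ m) * ennreal (moment_const \<alpha> (Suc m)) * indicator {0..1} u \<partial>lborel) =
        (\<integral>\<^sup>+u. ennreal ((1 - u) ^ m) * indicator {0..1} u * ennreal (moment_const \<alpha> (Suc m)) \<partial>lborel)"
      by (simp only: mult_ac)
    also have "\<dots> = (\<integral>\<^sup>+u. ennreal ((1 - u) ^ m) * indicator {0..1} u \<partial>lborel) * ennreal (moment_const \<alpha> (Suc m))"
      by (rule nn_integral_multc) measurable
    also have "(\<integral>\<^sup>+u. ennreal ((1 - u) ^ m) * indicator {0..1} u \<partial>lborel) = ennreal (- ((1 - 1) ^ Suc m / real (Suc m)) - - ((1 - 0) ^ Suc m / real (Suc m)))"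
      by (rule nn_integral_FTC_Icc) (auto intro!: derivative_eq_intros simp del: of_nat_Suc power_Suc)
    also have "- ((1 - 1) ^ Suc m / real (Suc m)) - - ((1 - 0) ^ Suc m / real (Suc m)) = 1 / real (Suc m)" by simp
    also have "ennreal (1 / real (Suc m)) * ennreal (moment_const \<alpha> (Suc m)) = ennreal (1 / real (Suc m) * moment_const \<alpha> (Suc m))"
      by (rule ennreal_mult'[symmetric]) simp
    also have "ennreal (Gamma (\<alpha> + 1 + real (Suc m)) / fact m) * ennreal (1 / real (Suc m) * moment_const \<alpha> (Suc m)) =
        ennreal (Gamma (\<alpha> + 1 + real (Suc m)) / fact m * (1 / real (Suc m) * moment_const \<alpha> (Suc m)))"
      using Gpos by (intro ennreal_mult'[symmetric]) simp
    also have "Gamma (\<alpha> + 1 + real (Suc m)) / fact m * (1 / real (Suc m) * moment_const \<alpha> (Suc m)) = moment_const \<alpha> (Suc (Suc m))"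
      unfolding moment_const_def by (subst (2) prod.lessThan_Suc) (simp add: fact_Suc add_ac mult_ac del: of_nat_Suc prod.lessThan_Suc)
    finally show ?case .
  }
qed

lemma shifted_moment_scalar:
  assumes "\<alpha> > -1"
  shows "shifted_moment m w \<alpha> 1 = ennreal (moment_const \<alpha> (Suc m) * det (toep_mat \<alpha> (Suc m) ((cmod w)\<^sup>2)))"
    and "moment_const \<alpha> (Suc m) * det (toep_mat \<alpha> (Suc m) ((cmod w)\<^sup>2)) \<ge> 0"
proof -
  have "shifted_moment m w \<alpha> 1 = ennreal (moment_const \<alpha> (Suc m) * det (toep_mat \<alpha> (Suc m) ((cmod w)\<^sup>2))) \<and>
    moment_const \<alpha> (Suc m) * det (toep_mat \<alpha> (Suc m) ((cmod w)\<^sup>2)) \<ge> 0"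
  proof (cases "w = 0")
    case True
    have "moment_const \<alpha> (Suc m) \<ge> 0"
      unfolding moment_const_def using assms by (intro prod_nonneg divide_nonneg_nonneg ballI less_imp_le[OF Gamma_real_pos]) auto
    then show ?thesis using True assms by (simp add: shifted_moment_zero det_toep_mat_0)
  next
    case False
    then have t: "(cmod w)\<^sup>2 \<in> {0..(cmod w)\<^sup>2}" "(cmod w)\<^sup>2 / (cmod w)\<^sup>2 = 1" by auto
    obtain F where "\<forall>x\<in>{0..(cmod w)\<^sup>2}. shifted_moment m w \<alpha> (sqrt (x / (cmod w)\<^sup>2)) = ennreal (F x) \<and> F x > 0"
        "F ((cmod w)\<^sup>2) = moment_const \<alpha> (Suc m) * det (toep_mat \<alpha> (Suc m) ((cmod w)\<^sup>2))"
      using shifted_moment_structure[OF assms False, of m] by blast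
    then show ?thesis using t by (metis real_sqrt_one less_imp_le)
  qed
  then show "shifted_moment m w \<alpha> 1 = ennreal (moment_const \<alpha> (Suc m) * det (toep_mat \<alpha> (Suc m) ((cmod w)\<^sup>2)))"
    "moment_const \<alpha> (Suc m) * det (toep_mat \<alpha> (Suc m) ((cmod w)\<^sup>2)) \<ge> 0" by auto
qed

text \<open>Scaling: G_N - z is N^(-1/2) times G - sqrt(N) z. The N rows give the power of N in
  \<open>R_gamma0\<close>, and the squared shift is N |z|^2.\<close>

lemma ginibre_moment:
  fixes \<gamma> :: real and z :: complex
  assumes \<gamma>: "\<gamma> > -2" and N: "N \<ge> 1"
  shows "(\<integral>G. cmod (det (ginibre_mat N G - z \<cdot>\<^sub>m 1\<^sub>m N)) powr \<gamma> \<partial>ginibre_entries N) =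
    R_gamma0 N \<gamma> * det (toep_mat (\<gamma> / 2) N (real N * (cmod z)\<^sup>2))"
proof -
  obtain m where m: "N = Suc m" using N by (cases N) auto
  define w where "w = of_real (sqrt (real N)) * z"
  have N0: "real N > 0" using N by simp
  have \<alpha>: "\<gamma> / 2 > -1" using \<gamma> by simp
  have w2: "(cmod w)\<^sup>2 = real N * (cmod z)\<^sup>2" by (simp add: w_def norm_mult power_mult_distrib)
  have norm_det: "cmod (det (ginibre_mat N G - z \<cdot>\<^sub>m 1\<^sub>m N)) powr \<gamma> = real N powr (- \<gamma> * real N / 2) * cmod (det (shifted m w 1 G)) powr (2 * (\<gamma> / 2))" for G
  proof -
    have "ginibre_mat N G - z \<cdot>\<^sub>m 1\<^sub>m N = (1 / complex_of_real (sqrt (real N))) \<cdot>\<^sub>m shifted m w 1 G"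
      unfolding ginibre_mat_def shifted_def m[symmetric]
      by (rule eq_matI) (use N0 in \<open>auto simp: w_def m[symmetric] field_simps\<close>)
    then have "cmod (det (ginibre_mat N G - z \<cdot>\<^sub>m 1\<^sub>m N)) = (1 / sqrt (real N)) ^ N * cmod (det (shifted m w 1 G))"
      by (simp add: norm_mult norm_power norm_divide shifted_def m[symmetric])
    moreover have "((1 / sqrt (real N)) ^ N) powr \<gamma> = real N powr (- \<gamma> * real N / 2)"
    proof -
      have "1 / sqrt (real N) = real N powr (- 1 / 2)" using N0 by (simp add: powr_minus_divide powr_half_sqrt)
      then have "(1 / sqrt (real N)) ^ N = real N powr (- 1 / 2 * real N)"
        using N0 by (simp add: powr_powr flip: powr_realpow)
      then show ?thesis by (simp add: powr_powr mult_ac)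
    qed
    ultimately show ?thesis by (simp add: powr_mult)
  qed
  have meas: "(\<lambda>G. cmod (det (shifted m w 1 G)) powr (2 * (\<gamma> / 2))) \<in> borel_measurable (gauss_PiM ({..<Suc m} \<times> {..<Suc m}))"
  proof -
    have "(\<lambda>G. det (shifted m w 1 G)) \<in> borel_measurable (gauss_PiM ({..<Suc m} \<times> {..<Suc m}))"
      unfolding shifted_def
      by (rule borel_measurable_det) (auto intro!: borel_measurable_diff borel_measurable_gauss_component)
    then show ?thesis by measurable
  qed
  \<comment> \<open>The nonnegative integral is finite by \<open>shifted_moment_scalar\<close>, so
    \<open>enn2real\<close> returns its true value and not the default 0.\<close>
  have "(\<integral>G. cmod (det (shifted m w 1 G)) powr (2 * (\<gamma> / 2)) \<partial>gauss_PiM ({..<Suc m} \<times> {..<Suc m})) = enn2real (shifted_moment m w (\<gamma> / 2) 1)"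
    unfolding shifted_moment_def using meas by (intro integral_eq_nn_integral) auto
  also have "\<dots> = moment_const (\<gamma> / 2) N * det (toep_mat (\<gamma> / 2) N (real N * (cmod z)\<^sup>2))"
    using shifted_moment_scalar[OF \<alpha>, of m w] by (simp only: w2 m[symmetric] enn2real_ennreal)
  finally have "(\<integral>G. cmod (det (ginibre_mat N G - z \<cdot>\<^sub>m 1\<^sub>m N)) powr \<gamma> \<partial>ginibre_entries N) =
     real N powr (- \<gamma> * real N / 2) * (moment_const (\<gamma> / 2) N * det (toep_mat (\<gamma> / 2) N (real N * (cmod z)\<^sup>2)))"
    unfolding norm_det ginibre_entries_def m[symmetric] by simp
  moreover have "Gamma (real j + 1) = fact j" for j using Gamma_fact[of j, where 'a = real] by (simp add: add.commute)
  ultimately show ?thesis by (simp add: R_gamma0_def moment_const_def)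
qed

theorem theorem3p2:
  fixes \<gamma> :: real and N :: nat and z :: complex
  assumes "\<gamma> > -2" and "N \<ge> 1"
  shows "(\<integral>G. cmod (det (ginibre_mat N G)) powr \<gamma> \<partial>ginibre_entries N) = R_gamma0 N \<gamma>
    \<and> complex_of_real
        (\<integral>G. cmod (det (ginibre_mat N G - z \<cdot>\<^sub>m 1\<^sub>m N)) powr \<gamma> \<partial>ginibre_entries N)
      = complex_of_real (R_gamma0 N \<gamma> / (fact N * (2 * pi) ^ N)) *
        (\<integral>\<theta> \<in> PiE {..<N} (\<lambda>_. {-pi..pi}).
           (\<Prod>j<N. cis (- \<gamma> * \<theta> j / 4)
                   * complex_of_real (cmod (1 + cis (\<theta> j)) powr (\<gamma> / 2))
                   * exp (complex_of_real (real N * (cmod z)\<^sup>2) * cis (\<theta> j)))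
           * complex_of_real (\<Prod>j<N. \<Prod>l\<in>{j<..<N}. (cmod (cis (\<theta> l) - cis (\<theta> j)))\<^sup>2)
         \<partial>(PiM {..<N} (\<lambda>_. lborel)))"
proof
  \<comment> \<open>At z = 0 the Toeplitz determinant is 1, which identifies \<open>R_gamma0\<close>
    as the moment of the unshifted matrix.\<close>
  have "ginibre_mat N G - 0 \<cdot>\<^sub>m 1\<^sub>m N = ginibre_mat N G" for G
    by (rule eq_matI) (auto simp: ginibre_mat_def)
  then show "(\<integral>G. cmod (det (ginibre_mat N G)) powr \<gamma> \<partial>ginibre_entries N) = R_gamma0 N \<gamma>"
    using ginibre_moment[OF assms, of 0] by (simp add: det_toep_mat_0)
  have c: "fact N * (2 * pi) ^ N \<noteq> 0" by simp
  show "complex_of_real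
        (\<integral>G. cmod (det (ginibre_mat N G - z \<cdot>\<^sub>m 1\<^sub>m N)) powr \<gamma> \<partial>ginibre_entries N)
      = complex_of_real (R_gamma0 N \<gamma> / (fact N * (2 * pi) ^ N)) *
        (\<integral>\<theta> \<in> PiE {..<N} (\<lambda>_. {-pi..pi}).
           (\<Prod>j<N. cis (- \<gamma> * \<theta> j / 4)
                   * complex_of_real (cmod (1 + cis (\<theta> j)) powr (\<gamma> / 2))
                   * exp (complex_of_real (real N * (cmod z)\<^sup>2) * cis (\<theta> j)))
           * complex_of_real (\<Prod>j<N. \<Prod>l\<in>{j<..<N}. (cmod (cis (\<theta> l) - cis (\<theta> j)))\<^sup>2)
         \<partial>(PiM {..<N} (\<lambda>_. lborel)))"
    unfolding circular_integral_eq_det[OF assms(1)] ginibre_moment[OF assms] of_real_mult[symmetric]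
    using c by (simp only: of_real_eq_iff) simp
qed

end
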